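(* Let $k$ be a field of characteristic zero, let $p,q$ be prime numbers, not necessarily distinct, and let $D$ be an irreducible non-triangularizable homogeneous locally nilpotent derivation of rank $2$ and degree $pq-2$ on $B=k[U,V,W]$. Let $A=\ker(D)$ and let $X$ be a linear variable of $B$ such that $X\in\ker(D)$. Then the image ideals $I_n=D^nB\cap A$ (as ideals of $A$) have one of the following two forms: (a) for every $n\in\mathbb{N}$, $I_n=\left(X^{n(pq-2)+qr+s+t}\right)$, where $r$ is the remainder of $n$ modulo $p$, and, if $t'$ is the quotient of $n$ when divided by $p$, then $t$ and $s$ are respectively the quotient and remainder of $t'$ when divided by $q$; or (b) for every $n\in\mathbb{N}$, $I_n=\left(X^{n(pq-2)+pr+s+t}\right)$, where $r$ is the remainder of $n$ modulo $q$, and, if $t'$ is the quotient of $n$ when divided by $q$, then $t$ and $s$ are respectively the quotient and remainder of $t'$ when divided by $p$.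
   Context: Let $k$ be a field of characteristic zero and $B=k[U,V,W]$ the polynomial ring in three variables. A locally nilpotent derivation (LND) of $B$ is a $k$-derivation $D:B\to B$ such that for each $b\in B$ there is $n$ with $D^n b=0$. Homogeneous and degree: $B$ has the standard grading $\deg U=\deg V=\deg W=1$, $B=\bigoplus_i B_i$. A nonzero $D$ is homogeneous of degree $d\in\mathbb{Z}$ if $D(B_i)\subseteq B_{i+d}$ for all $i$. Irreducible: the ideal of $B$ generated by $D(B)$ is not contained in any proper principal ideal of $B$. Rank: the smallest positive integer $r$ for which there is a coordinate system $\{V_1,V_2,V_3\}$ of $B$ (i.e. $B=k[V_1,V_2,V_3]$) with $DV_i\neq 0$ for $i\le r$ and $DV_i=0$ for $i>r$. Triangularizable: there is a coordinate system $\{X_1,X_2,X_3\}$ of $B$ with $DX_1\in k$, $DX_2\in k[X_1]$ and $DX_3\in k[X_1,X_2]$; non-triangularizable means not triangularizable. A linear variable of $B$ is a nonzero homogeneous linear form in $U,V,W$. For $n\ge 0$, the $n$-th image ideal of $D$ is $I_n=D^n(B)\cap A$, an ideal of $A=\ker(D)$. *)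

theory Defs
  imports Complex_Main "HOL-Library.Poly_Mapping" "HOL-Computational_Algebra.Primes"
begin

text \<open>
  The polynomial ring \<open>B = k[U,V,W]\<close> is the monoid algebra over \<open>k\<close> of the exponent vectors
  \<open>indet \<Rightarrow>\<^sub>0 nat\<close>; ring operations come from the instances in \<open>Poly_Mapping\<close>.
\<close>

datatype indet = U | V | W

type_synonym 'k poly3 = "(indet \<Rightarrow>\<^sub>0 nat) \<Rightarrow>\<^sub>0 'k"

definition const :: "'k::field \<Rightarrow> 'k poly3" where
  "const c = Poly_Mapping.single 0 c"

definition mdeg :: "(indet \<Rightarrow>\<^sub>0 nat) \<Rightarrow> nat" where
  "mdeg m = (\<Sum>x\<in>Poly_Mapping.keys m. Poly_Mapping.lookup m x)"

text \<open>The homogeneous component \<open>B\<^sub>i\<close>; it is zero for negative \<open>i\<close>.\<close>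

definition graded_part :: "int \<Rightarrow> 'k::field poly3 set" where
  "graded_part i = {f. \<forall>m\<in>Poly_Mapping.keys f. int (mdeg m) = i}"

definition linear_variable :: "'k::field poly3 \<Rightarrow> bool" where
  "linear_variable X \<longleftrightarrow> X \<noteq> 0 \<and> X \<in> graded_part 1"

definition subalgebra :: "'k::field poly3 set \<Rightarrow> bool" where
  "subalgebra S \<longleftrightarrow> range const \<subseteq> S \<and> (\<forall>a\<in>S. \<forall>b\<in>S. a + b \<in> S \<and> a * b \<in> S)"

text \<open>\<open>adjoin S\<close> is \<open>k[S]\<close>.\<close>

definition adjoin :: "'k::field poly3 set \<Rightarrow> 'k poly3 set" where
  "adjoin S = subalgebra hull S"

text \<open>
  Three elements generating \<open>B\<close> as a \<open>k\<close>-algebra are automatically algebraically independent.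
  Only the values of \<open>C\<close> at 1, 2 and 3 matter.
\<close>

definition coordinate_system :: "(nat \<Rightarrow> 'k::field poly3) \<Rightarrow> bool" where
  "coordinate_system C \<longleftrightarrow> adjoin {C 1, C 2, C 3} = UNIV"

definition is_ideal :: "'k::field poly3 set \<Rightarrow> 'k poly3 set \<Rightarrow> bool" where
  "is_ideal A I \<longleftrightarrow> I \<subseteq> A \<and> 0 \<in> I \<and> (\<forall>a\<in>I. \<forall>b\<in>I. a + b \<in> I) \<and> (\<forall>r\<in>A. \<forall>a\<in>I. r * a \<in> I)"

text \<open>The ideal of the subring \<open>A\<close> generated by \<open>S\<close>; meaningful only for \<open>S \<subseteq> A\<close>.\<close>

definition ideal_gen :: "'k::field poly3 set \<Rightarrow> 'k poly3 set \<Rightarrow> 'k poly3 set" where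
  "ideal_gen A S = is_ideal A hull S"

definition derivation :: "('k::field poly3 \<Rightarrow> 'k poly3) \<Rightarrow> bool" where
  "derivation D \<longleftrightarrow>
     (\<forall>a b. D (a + b) = D a + D b) \<and>
     (\<forall>a b. D (a * b) = D a * b + a * D b) \<and>
     (\<forall>c. D (const c) = 0)"

definition lnd :: "('k::field poly3 \<Rightarrow> 'k poly3) \<Rightarrow> bool" where
  "lnd D \<longleftrightarrow> derivation D \<and> (\<forall>b. \<exists>n. (D ^^ n) b = 0)"

definition kernel :: "('k::field poly3 \<Rightarrow> 'k poly3) \<Rightarrow> 'k poly3 set" where
  "kernel D = {b. D b = 0}"

definition homogeneous_of_degree :: "('k::field poly3 \<Rightarrow> 'k poly3) \<Rightarrow> int \<Rightarrow> bool" where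
  "homogeneous_of_degree D d \<longleftrightarrow>
     (\<exists>b. D b \<noteq> 0) \<and> (\<forall>i. D ` graded_part i \<subseteq> graded_part (i + d))"

definition irreducible_derivation :: "('k::field poly3 \<Rightarrow> 'k poly3) \<Rightarrow> bool" where
  "irreducible_derivation D \<longleftrightarrow>
     \<not> (\<exists>f. ideal_gen UNIV {f} \<noteq> UNIV \<and> ideal_gen UNIV (range D) \<subseteq> ideal_gen UNIV {f})"

text \<open>For \<open>D \<noteq> 0\<close> a suitable \<open>r\<close> exists: reorder \<open>U, V, W\<close>.\<close>

definition derivation_rank :: "('k::field poly3 \<Rightarrow> 'k poly3) \<Rightarrow> nat" where
  "derivation_rank D =
     (LEAST r. r > 0 \<and> (\<exists>C. coordinate_system C \<and> (\<forall>i\<in>{1..3}. D (C i) \<noteq> 0 \<longleftrightarrow> i \<le> r)))"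

definition triangularizable :: "('k::field poly3 \<Rightarrow> 'k poly3) \<Rightarrow> bool" where
  "triangularizable D \<longleftrightarrow>
     (\<exists>C. coordinate_system C \<and>
        D (C 1) \<in> range const \<and> D (C 2) \<in> adjoin {C 1} \<and> D (C 3) \<in> adjoin {C 1, C 2})"

definition image_ideal :: "('k::field poly3 \<Rightarrow> 'k poly3) \<Rightarrow> nat \<Rightarrow> 'k poly3 set" where
  "image_ideal D n = range (D ^^ n) \<inter> kernel D"

end

theory Submission
  imports Defs "HOL-Computational_Algebra.Polynomial"
begin

text \<open>
  Setting \<open>X = 1\<close> turns \<open>D\<close> into a locally nilpotent derivation \<open>\<delta>\<close> of \<open>k[x,y]\<close>. In the manner of
  Rentschler's theorem, a Euclidean algorithm on coordinate pairs, ordered by the degree function of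
  \<open>\<delta>\<close>, starts from linear coordinates \<open>(b, a)\<close> and subtracts a polynomial in the second coordinate
  from the first. Each step has quotient degree at least 2, and homogeneity of degree \<open>pq - 2\<close> forces
  \<open>deg\<^sub>\<delta> b = pq\<close>. One step would triangularize \<open>D\<close>, hence there are exactly two: \<open>s = b - \<psi>(a)\<close> and
  \<open>f = a - \<phi>(s)\<close> with \<open>\<delta> f = 0\<close>, \<open>\<delta> s \<in> k\<^sup>*\<close> and \<open>{deg \<phi>, deg \<psi>} = {p, q}\<close>.

  Homogenizing, the products \<open>S\<^sup>r Y\<^sub>1\<^sup>j Y\<^sub>2\<^sup>t\<close> with \<open>r < deg \<phi>\<close>, \<open>j < deg \<psi>\<close> span \<open>B\<close> over the kernel
  \<open>A\<close> and have pairwise distinct degrees \<open>r + j deg \<phi> + t pq\<close> with respect to \<open>D\<close>. Therefore \<open>I\<^sub>n\<close>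
  is generated by \<open>D\<^sup>n\<close> of the unique product of degree \<open>n\<close>, which is a scalar multiple of a power of
  \<open>X\<close> whose exponent is found by counting degrees.
\<close>

text \<open>Setting \<open>X = 1\<close> loses nothing on homogeneous elements of a known degree, so
  what is found for \<open>\<delta>\<close> lifts back to \<open>D\<close>. Irreducibility enters
  twice. It makes \<open>\<delta> s\<close> constant whenever \<open>(f, s)\<close> are coordinates
  with \<open>\<delta> f = 0\<close>. It also keeps \<open>\<delta> x\<close> and
  \<open>\<delta> y\<close> from both having total degree below \<open>pq - 1\<close>, since
  otherwise \<open>X\<close> would divide every value of \<open>D\<close>. The second fact is what
  fixes the degree of \<open>b\<close>: along the algorithm the total degree of
  \<open>\<delta> b\<close> comes out as \<open>deg b - 1\<close>, and it has to be
  \<open>pq - 1\<close>.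

  Degrees in the algorithm multiply: \<open>pq\<close> is the product of the quotient degrees and
  the last nonzero degree. Here primality is used, and the forms (a) and (b) are the two orders in
  which \<open>p\<close> and \<open>q\<close> can occur as quotient degrees.

  The main obstacle is that a division step exists at all, that is, that for two coordinates of
  positive degree one degree divides the other. It is overcome by passing to leading forms for the
  weights given by these degrees, where \<open>\<delta>\<close> induces another locally nilpotent
  derivation.\<close>

text \<open>The order serves only to obtain the \<open>idom\<close> instance of \<open>Poly_Mapping\<close>.\<close>

instantiation indet :: linorder
begin

definition rank_indet :: "indet \<Rightarrow> nat" where
  "rank_indet v = (case v of U \<Rightarrow> 0 | V \<Rightarrow> 1 | W \<Rightarrow> 2)"

definition less_eq_indet :: "indet \<Rightarrow> indet \<Rightarrow> bool" where
  "less_eq_indet a b \<longleftrightarrow> rank_indet a \<le> rank_indet b"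

definition less_indet :: "indet \<Rightarrow> indet \<Rightarrow> bool" where
  "less_indet a b \<longleftrightarrow> rank_indet a < rank_indet b"

instance
  by standard (auto simp: less_eq_indet_def less_indet_def rank_indet_def split: indet.splits)

end

lemma UNIV_indet: "UNIV = {U, V, W}"
  using indet.exhaust by auto

instance indet :: finite
  by standard (simp add: UNIV_indet)

section \<open>Polynomials in finitely many variables and substitution\<close>

abbreviation "lookup \<equiv> Poly_Mapping.lookup"
abbreviation "keys \<equiv> Poly_Mapping.keys"
abbreviation "single \<equiv> Poly_Mapping.single"

text \<open>A common type for both rings involved: index type \<open>indet\<close> gives
  \<open>B\<close>, index type \<open>bool\<close> gives \<open>k[x,y]\<close>.\<close>

type_synonym ('v, 'k) mp = "('v \<Rightarrow>\<^sub>0 nat) \<Rightarrow>\<^sub>0 'k"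

definition cst :: "'k::field \<Rightarrow> ('v::{finite,linorder}, 'k) mp" where
  "cst c = single 0 c"

definition var :: "'v::{finite,linorder} \<Rightarrow> ('v, 'k::field) mp" where
  "var v = single (single v 1) 1"

lemma cst_0 [simp]: "cst 0 = 0" by (simp add: cst_def)
lemma cst_1 [simp]: "cst 1 = 1" by (simp add: cst_def)
lemma cst_add: "cst (a + b) = cst a + cst b" by (simp add: cst_def single_add)
lemma cst_diff: "cst (a - b) = cst a - cst b" by (simp add: cst_def single_diff)
lemma cst_uminus: "cst (- a) = - cst a" by (simp add: cst_def single_uminus)
lemma cst_mult: "cst (a * b) = cst a * cst b" by (simp add: cst_def mult_single)
lemma cst_power: "cst (a ^ n) = cst a ^ n" by (induction n) (simp_all add: cst_mult)
lemma cst_of_nat: "cst (of_nat n) = of_nat n" by (simp add: cst_def)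
lemma cst_eq_iff [simp]: "cst a = cst b \<longleftrightarrow> a = b"
  by (metis cst_def lookup_single_eq)
lemma cst_eq_0_iff [simp]: "cst a = 0 \<longleftrightarrow> a = 0"
  using cst_eq_iff[of a 0] by (simp del: cst_eq_iff)
lemma cst_inverse: "a \<noteq> 0 \<Longrightarrow> cst (inverse a) * cst a = 1"
  by (simp flip: cst_mult)

lemma lookup_cst_mult: "lookup (cst c * f) m = c * lookup f m"
proof -
  have "cst c * f = Poly_Mapping.map ((*) c) f" by (simp add: cst_def mult_map_scale_conv_mult)
  then show ?thesis by (simp add: map.rep_eq when_def)
qed

lemma sum_singles: "f = (\<Sum>m\<in>keys f. single m (lookup f m))"
  by (rule poly_mapping_eqI)
    (auto simp: lookup_sum lookup_single when_def in_keys_iff sum.delta)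

lemma single_prod_var:
  fixes m :: "'v::{finite,linorder} \<Rightarrow>\<^sub>0 nat" and c :: "'k::field"
  shows "single m c = cst c * (\<Prod>v\<in>UNIV. var v ^ lookup m v)"
proof -
  have pw: "var v ^ n = single (single v n) (1::'k)" for v :: 'v and n
    by (induction n) (simp_all add: var_def mult_single flip: single_add)
  have pr: "(\<Prod>v\<in>S. single (g v) 1) = single (\<Sum>v\<in>S. g v) (1::'k)"
    if "finite S" for S and g :: "'v \<Rightarrow> 'v \<Rightarrow>\<^sub>0 nat"
    using that by induction (simp_all add: mult_single)
  have "(\<Sum>v\<in>UNIV. single v (lookup m v)) = m"
    by (rule poly_mapping_eqI) (simp add: lookup_sum lookup_single when_def)
  then show ?thesis by (simp add: pw pr cst_def mult_single)
qed

lemma mp_induct [case_names cst var add mult]: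
  fixes f :: "('v::{finite,linorder}, 'k::field) mp"
  assumes c: "\<And>c. P (cst c)" and v: "\<And>v. P (var v)"
    and a: "\<And>f g. P f \<Longrightarrow> P g \<Longrightarrow> P (f + g)" and t: "\<And>f g. P f \<Longrightarrow> P g \<Longrightarrow> P (f * g)"
  shows "P f"
proof -
  have 1: "P 1" using c[of 1] by simp
  have pw: "P (var v ^ n)" for v n by (induction n) (auto simp: 1 v t)
  have pr: "finite S \<Longrightarrow> P (\<Prod>v\<in>S. var v ^ g v)" for S g
    by (induction rule: finite_induct) (auto simp: 1 pw t)
  have s: "P (single m x)" for m x
    unfolding single_prod_var by (intro t c pr) simp
  have "finite S \<Longrightarrow> P (\<Sum>m\<in>S. single m (g m))" for S g
    by (induction rule: finite_induct) (use c[of 0] in \<open>auto intro: a s\<close>)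
  then show ?thesis by (subst sum_singles) simp
qed

lemma mp_linear_induct [case_names single add]:
  fixes f :: "'m \<Rightarrow>\<^sub>0 'k::field"
  assumes s: "\<And>m c. P (single m c)"
    and a: "\<And>f g. P f \<Longrightarrow> P g \<Longrightarrow> P (f + g)"
  shows "P f"
proof -
  have 0: "P 0" using s[of undefined 0] by simp
  have "finite S \<Longrightarrow> P (\<Sum>m\<in>S. single m (g m))" for S g
    by (induction rule: finite_induct) (auto intro: a s 0)
  then show ?thesis by (subst sum_singles) simp
qed

text \<open>For \<open>F\<close> additive in the coefficient this is the additive extension from
  terms to polynomials. Substitution, homogenization and the graded derivation \<open>dtop\<close>
  are all built from it.\<close>

definition lext :: "('m \<Rightarrow> 'k::zero \<Rightarrow> 'b::comm_monoid_add) \<Rightarrow> ('m \<Rightarrow>\<^sub>0 'k) \<Rightarrow> 'b" where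
  "lext F f = (\<Sum>m\<in>keys f. F m (lookup f m))"

lemma lext_single: "(\<And>m. F m 0 = 0) \<Longrightarrow> lext F (single m c) = F m c"
  by (cases "c = 0") (auto simp: lext_def)

lemma lext_superset:
  assumes "\<And>m. F m 0 = 0" "finite S" "keys f \<subseteq> S"
  shows "lext F f = (\<Sum>m\<in>S. F m (lookup f m))"
  unfolding lext_def using assms
  by (intro sum.mono_neutral_left) (auto simp: in_keys_iff)

lemma lext_add:
  fixes F :: "'m \<Rightarrow> 'k::field \<Rightarrow> 'b::comm_monoid_add"
  assumes 0: "\<And>m. F m 0 = 0" and a: "\<And>m c d. F m (c + d) = F m c + F m d"
  shows "lext F (f + g) = lext F f + lext F g"
proof -
  let ?S = "keys f \<union> keys g"
  have "keys (f + g) \<subseteq> ?S" by (rule keys_add)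
  then show ?thesis
    by (simp add: lext_superset[where F=F and S="?S", OF 0] lookup_add a sum.distrib)
qed

definition ev :: "('v::{finite,linorder} \<Rightarrow> ('w::{finite,linorder}, 'k::field) mp)
    \<Rightarrow> ('v, 'k) mp \<Rightarrow> ('w, 'k) mp" where
  "ev u = lext (\<lambda>m c. cst c * (\<Prod>v\<in>UNIV. u v ^ lookup m v))"

lemma ev_single: "ev u (single m c) = cst c * (\<Prod>v\<in>UNIV. u v ^ lookup m v)"
  unfolding ev_def by (rule lext_single) simp

lemma ev_add: "ev u (f + g) = ev u f + ev u g"
  unfolding ev_def by (rule lext_add) (simp_all add: cst_add algebra_simps)

lemma ev_cst [simp]: "ev u (cst c) = cst c"
  using ev_single[of u 0 c] by (simp add: cst_def)

lemma ev_0 [simp]: "ev u 0 = 0" using ev_cst[of u 0] by simp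
lemma ev_1 [simp]: "ev u 1 = 1" using ev_cst[of u 1] by simp

lemma ev_var [simp]: "ev u (var v) = u v"
proof -
  have "(\<Prod>x\<in>UNIV. u x ^ (1 when v = x)) = (\<Prod>x\<in>UNIV. if x = v then u x else 1)"
    by (rule prod.cong) (auto simp: when_def)
  then show ?thesis by (simp add: var_def ev_single lookup_single)
qed

lemma ev_mult: "ev u (f * g) = ev u f * ev u g"
proof (induction f rule: mp_linear_induct)
  case (single m c)
  show ?case
  proof (induction g rule: mp_linear_induct)
    case (single n d)
    then show ?case
      by (simp add: mult_single ev_single lookup_add power_add prod.distrib cst_mult algebra_simps)
  qed (simp_all add: algebra_simps ev_add)
qed (simp_all add: algebra_simps ev_add)

lemma ev_uminus: "ev u (- f) = - ev u f"
  using ev_add[of u f "- f"] by (simp add: eq_neg_iff_add_eq_0 add.commute)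
lemma ev_diff: "ev u (f - g) = ev u f - ev u g"
  using ev_add[of u f "- g"] by (simp add: ev_uminus)
lemma ev_power: "ev u (f ^ n) = ev u f ^ n"
  by (induction n) (simp_all add: ev_mult)
lemma ev_sum: "ev u (sum h S) = (\<Sum>i\<in>S. ev u (h i))"
  by (induction S rule: infinite_finite_induct) (simp_all add: ev_add)

lemmas ev_simps = ev_add ev_mult ev_uminus ev_diff ev_power ev_sum

lemma ev_ev: "ev u (ev t f) = ev (\<lambda>v. ev u (t v)) f"
  by (induction f rule: mp_induct) (simp_all add: ev_simps)

lemma ev_var_id [simp]: "ev var f = f"
  by (induction f rule: mp_induct) (simp_all add: ev_simps)

section \<open>Weighted degrees\<close>

text \<open>Integer-valued although the weights are natural numbers, because a derivation may shift
  degrees by a negative amount.\<close>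

definition wd :: "('v::finite \<Rightarrow> nat) \<Rightarrow> ('v \<Rightarrow>\<^sub>0 nat) \<Rightarrow> int" where
  "wd w m = int (\<Sum>v\<in>UNIV. w v * lookup m v)"

lemma wd_add: "wd w (m + n) = wd w m + wd w n"
  by (simp add: wd_def lookup_add algebra_simps sum.distrib)
lemma wd_0 [simp]: "wd w 0 = 0" by (simp add: wd_def)
lemma wd_nonneg: "wd w m \<ge> 0" unfolding wd_def by (rule of_nat_0_le_iff)
lemma wd_single [simp]: "wd w (single v n) = int (w v * n)"
  by (simp add: wd_def lookup_single when_def if_distrib cong: if_cong)

definition hdeg :: "('v::{finite,linorder} \<Rightarrow> nat) \<Rightarrow> int \<Rightarrow> ('v, 'k::field) mp \<Rightarrow> bool" where
  "hdeg w i f \<longleftrightarrow> (\<forall>m\<in>keys f. wd w m \<le> i)"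

definition homog :: "('v::{finite,linorder} \<Rightarrow> nat) \<Rightarrow> int \<Rightarrow> ('v, 'k::field) mp \<Rightarrow> bool" where
  "homog w i f \<longleftrightarrow> (\<forall>m\<in>keys f. wd w m = i)"

definition hcomp :: "('v::{finite,linorder} \<Rightarrow> nat) \<Rightarrow> int \<Rightarrow> ('v, 'k::field) mp \<Rightarrow> ('v, 'k) mp" where
  "hcomp w i f = Poly_Mapping.mapp (\<lambda>m c. if wd w m = i then c else 0) f"

lemma lookup_hcomp: "lookup (hcomp w i f) m = (if wd w m = i then lookup f m else 0)"
  by (auto simp: hcomp_def lookup_mapp when_def in_keys_iff)

lemma hcomp_add: "hcomp w i (f + g) = hcomp w i f + hcomp w i g"
  by (rule poly_mapping_eqI) (simp add: lookup_hcomp lookup_add)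
lemma hcomp_0 [simp]: "hcomp w i 0 = 0"
  by (rule poly_mapping_eqI) (simp add: lookup_hcomp)
lemma hcomp_diff: "hcomp w i (f - g) = hcomp w i f - hcomp w i g"
  by (rule poly_mapping_eqI) (simp add: lookup_hcomp lookup_minus)

lemma hcomp_sum: "hcomp w i (sum g S) = (\<Sum>x\<in>S. hcomp w i (g x))"
  by (induction S rule: infinite_finite_induct) (simp_all add: hcomp_add)

lemma homog_imp_hdeg: "homog w i f \<Longrightarrow> hdeg w i f"
  by (auto simp: homog_def hdeg_def)
lemma hdeg_mono: "hdeg w i f \<Longrightarrow> i \<le> j \<Longrightarrow> hdeg w j f"
  by (force simp: hdeg_def)
lemma hdeg_0 [simp]: "hdeg w i 0" by (simp add: hdeg_def)
lemma homog_0 [simp]: "homog w i 0" by (simp add: homog_def)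
lemma hdeg_add: "hdeg w i f \<Longrightarrow> hdeg w i g \<Longrightarrow> hdeg w i (f + g)"
  using keys_add[of f g] by (auto simp: hdeg_def)
lemma homog_add: "homog w i f \<Longrightarrow> homog w i g \<Longrightarrow> homog w i (f + g)"
  using keys_add[of f g] by (auto simp: homog_def)
lemma hdeg_uminus [simp]: "hdeg w i (- f) \<longleftrightarrow> hdeg w i f"
  by (simp add: hdeg_def in_keys_iff)
lemma homog_uminus [simp]: "homog w i (- f) \<longleftrightarrow> homog w i f"
  by (simp add: homog_def in_keys_iff)
lemma hdeg_diff: "hdeg w i f \<Longrightarrow> hdeg w i g \<Longrightarrow> hdeg w i (f - g)"
  using hdeg_add[of w i f "- g"] by simp
lemma homog_diff: "homog w i f \<Longrightarrow> homog w i g \<Longrightarrow> homog w i (f - g)"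
  using homog_add[of w i f "- g"] by simp
lemma homog_mult: "homog w i f \<Longrightarrow> homog w j g \<Longrightarrow> homog w (i + j) (f * g)"
  using keys_mult[of f g] by (fastforce simp: homog_def wd_add)
lemma hdeg_mult: "hdeg w i f \<Longrightarrow> hdeg w j g \<Longrightarrow> hdeg w (i + j) (f * g)"
  unfolding hdeg_def using keys_mult[of f g] by (fastforce simp: wd_add intro!: add_mono)
lemma homog_sum: "(\<And>x. x \<in> S \<Longrightarrow> homog w i (f x)) \<Longrightarrow> homog w i (sum f S)"
  by (induction S rule: infinite_finite_induct) (auto intro: homog_add)
lemma hdeg_sum: "(\<And>x. x \<in> S \<Longrightarrow> hdeg w i (f x)) \<Longrightarrow> hdeg w i (sum f S)"
  by (induction S rule: infinite_finite_induct) (auto intro: hdeg_add)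
lemma homog_cst [simp]: "homog w 0 (cst c)"
  by (simp add: homog_def cst_def)
lemma homog_1 [simp]: "homog w 0 1"
  using homog_cst[of w 1] by simp
lemma homog_var: "homog w (int (w v)) (var v)"
  by (simp add: homog_def var_def)
lemma homog_power: "homog w i f \<Longrightarrow> homog w (int n * i) (f ^ n)"
  by (induction n) (auto simp: algebra_simps dest: homog_mult)
lemma hdeg_power: "hdeg w i f \<Longrightarrow> hdeg w (int n * i) (f ^ n)"
  by (induction n) (auto simp: algebra_simps homog_imp_hdeg dest: hdeg_mult)
lemma homog_cst_mult: "homog w i f \<Longrightarrow> homog w i (cst c * f)"
  using homog_mult[OF homog_cst] by fastforce
lemma hdeg_cst_mult: "hdeg w i f \<Longrightarrow> hdeg w i (cst c * f)"
  using hdeg_mult[OF homog_imp_hdeg[OF homog_cst]] by fastforce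

lemma homog_hcomp: "homog w i (hcomp w i f)"
  by (auto simp: homog_def in_keys_iff lookup_hcomp split: if_splits)

lemma hcomp_homog: "homog w i f \<Longrightarrow> hcomp w j f = (if i = j then f else 0)"
  by (rule poly_mapping_eqI) (auto simp: lookup_hcomp homog_def in_keys_iff)

lemma hdeg_negD: "hdeg w i f \<Longrightarrow> i < 0 \<Longrightarrow> f = 0"
  by (metis hdeg_def dual_order.strict_trans2 in_keys_iff leD poly_mapping_eqI lookup_zero wd_nonneg)

lemma hdeg_hcomp_eq_0: "hdeg w i f \<Longrightarrow> i < j \<Longrightarrow> hcomp w j f = 0"
  by (rule poly_mapping_eqI) (force simp: lookup_hcomp hdeg_def in_keys_iff)

lemma hdeg_minus_hcomp: "hdeg w i f \<Longrightarrow> hdeg w (i - 1) (f - hcomp w i f)"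
  by (force simp: hdeg_def in_keys_iff lookup_hcomp lookup_minus split: if_splits)

lemma hcomp_mult:
  assumes f: "hdeg w i f" and g: "hdeg w j g"
  shows "hcomp w (i + j) (f * g) = hcomp w i f * hcomp w j g"
proof -
  define f' g' where "f' = f - hcomp w i f" and "g' = g - hcomp w j g"
  have h: "hdeg w (i - 1) f'" "hdeg w (j - 1) g'"
    unfolding f'_def g'_def using f g by (auto intro: hdeg_minus_hcomp)
  have "f * g = hcomp w i f * hcomp w j g + (f' * g + hcomp w i f * g')"
    by (simp add: f'_def g'_def algebra_simps)
  moreover have "hcomp w (i + j) (hcomp w i f * hcomp w j g) = hcomp w i f * hcomp w j g"
    by (simp add: hcomp_homog[OF homog_mult[OF homog_hcomp homog_hcomp]])
  moreover have "hcomp w (i + j) (f' * g) = 0"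
    using hdeg_mult[OF h(1) g] by (rule hdeg_hcomp_eq_0) simp
  moreover have "hcomp w (i + j) (hcomp w i f * g') = 0"
    using hdeg_mult[OF homog_imp_hdeg[OF homog_hcomp] h(2)] by (rule hdeg_hcomp_eq_0) simp
  ultimately show ?thesis by (simp add: hcomp_add)
qed

lemma hcomp_homog_mult: "homog w i f \<Longrightarrow> hcomp w (i + j) (f * g) = f * hcomp w j g"
proof (induction g rule: mp_linear_induct)
  case (single m c)
  have h: "homog w (wd w m) (single m c)" by (simp add: homog_def)
  show ?case
    using hcomp_homog[OF homog_mult[OF single h]] by (simp add: hcomp_homog[OF h])
qed (simp_all add: hcomp_add algebra_simps)

text \<open>The value at \<open>0\<close> is meaningless.\<close>

definition tdeg :: "('v::{finite,linorder} \<Rightarrow> nat) \<Rightarrow> ('v, 'k::field) mp \<Rightarrow> int" where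
  "tdeg w f = Max (wd w ` keys f)"

lemma hdeg_tdeg: "hdeg w (tdeg w f) f"
  by (auto simp: hdeg_def tdeg_def)

lemma hcomp_tdeg_nz:
  assumes "f \<noteq> 0" shows "hcomp w (tdeg w f) f \<noteq> 0"
proof -
  have "tdeg w f \<in> wd w ` keys f" unfolding tdeg_def using assms by (intro Max_in) auto
  then obtain m where "m \<in> keys f" "wd w m = tdeg w f" by auto
  then have "lookup (hcomp w (tdeg w f) f) m \<noteq> 0" by (simp add: lookup_hcomp in_keys_iff)
  then show ?thesis by auto
qed

lemma tdeg_nonneg: assumes "f \<noteq> 0" shows "tdeg w f \<ge> 0"
  using assms hdeg_negD[OF hdeg_tdeg, of w f] by linarith

lemma tdeg_unique:
  assumes "hdeg w i f" "hcomp w i f \<noteq> 0" shows "tdeg w f = i"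
proof -
  have "f \<noteq> 0" using assms by auto
  have "i \<le> tdeg w f" using hdeg_hcomp_eq_0[OF hdeg_tdeg[of w f], of i] assms by force
  moreover have "tdeg w f \<le> i" using hdeg_hcomp_eq_0[OF assms(1), of "tdeg w f"] hcomp_tdeg_nz[OF \<open>f \<noteq> 0\<close>, of w] by force
  ultimately show ?thesis by simp
qed

lemma hdeg_iff_tdeg: "f \<noteq> 0 \<Longrightarrow> hdeg w i f \<longleftrightarrow> tdeg w f \<le> i"
  by (metis hcomp_tdeg_nz hdeg_hcomp_eq_0 hdeg_mono hdeg_tdeg linorder_not_le)

lemma tdeg_mult:
  assumes "f \<noteq> 0" "g \<noteq> 0" shows "tdeg w (f * g) = tdeg w f + tdeg w g"
  by (rule tdeg_unique)
    (auto simp: hdeg_mult hdeg_tdeg hcomp_mult hcomp_tdeg_nz assms)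

lemma tdeg_power: "f \<noteq> 0 \<Longrightarrow> tdeg w (f ^ n) = int n * tdeg w f"
proof (induction n)
  case 0
  have "tdeg w (1::('a,'b) mp) = 0"
    by (rule tdeg_unique) (simp_all add: homog_imp_hdeg hcomp_homog[OF homog_1])
  then show ?case by simp
qed (auto simp: tdeg_mult algebra_simps)

lemma hdeg_0_cst:
  assumes "\<And>v. w v > 0" "hdeg w 0 f" shows "\<exists>c. f = cst c"
proof -
  have "m = 0" if "m \<in> keys f" for m
  proof -
    have "wd w m = 0" using assms(2) that wd_nonneg[of w m] by (auto simp: hdeg_def intro: antisym)
    then have "\<forall>v. w v * lookup m v = 0" by (simp add: wd_def del: of_nat_sum of_nat_mult)
    then have "\<forall>v. lookup m v = 0" using assms(1) by (metis mult_is_0 not_gr_zero)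
    then show "m = 0" by (intro poly_mapping_eqI) simp
  qed
  then have "f = cst (lookup f 0)"
    by (intro poly_mapping_eqI) (auto simp: cst_def lookup_single when_def in_keys_iff)
  then show ?thesis by blast
qed

section \<open>Locally nilpotent derivations\<close>

locale kder =
  fixes d :: "('v::{finite,linorder}, 'k::field_char_0) mp \<Rightarrow> ('v, 'k) mp"
  assumes d_add: "d (a + b) = d a + d b"
    and d_mult: "d (a * b) = d a * b + a * d b"
    and d_cst [simp]: "d (cst c) = 0"
begin

lemma d_0 [simp]: "d 0 = 0" using d_cst[of 0] by simp
lemma d_1 [simp]: "d 1 = 0" using d_cst[of 1] by simp
lemma d_uminus: "d (- a) = - d a"
  using d_add[of a "- a"] by (simp add: eq_neg_iff_add_eq_0 add.commute)
lemma d_diff: "d (a - b) = d a - d b"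
  using d_add[of a "- b"] by (simp add: d_uminus)
lemma d_sum: "d (sum f S) = (\<Sum>i\<in>S. d (f i))"
  by (induction S rule: infinite_finite_induct) (simp_all add: d_add)
lemma d_cst_mult: "d (cst c * a) = cst c * d a"
  by (simp add: d_mult)
lemma d_power: "d (a ^ n) = of_nat n * a ^ (n - 1) * d a"
proof (induction n)
  case (Suc n)
  then show ?case by (cases n) (simp_all add: d_mult algebra_simps)
qed simp

lemma funpow_add: "(d ^^ n) (a + b) = (d ^^ n) a + (d ^^ n) b"
  by (induction n) (simp_all add: d_add)
lemma funpow_0 [simp]: "(d ^^ n) 0 = 0"
  by (induction n) simp_all
lemma funpow_diff: "(d ^^ n) (a - b) = (d ^^ n) a - (d ^^ n) b"
  by (induction n) (simp_all add: d_diff)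
lemma funpow_sum: "(d ^^ n) (sum f S) = (\<Sum>i\<in>S. (d ^^ n) (f i))"
  by (induction n) (simp_all add: d_sum)
lemma funpow_ker_mult: "d a = 0 \<Longrightarrow> (d ^^ n) (a * b) = a * (d ^^ n) b"
  by (induction n) (simp_all add: d_mult)
lemma funpow_ker_mult': "d a = 0 \<Longrightarrow> (d ^^ n) (b * a) = (d ^^ n) b * a"
  by (induction n) (simp_all add: d_mult)
lemma funpow_cst_mult: "(d ^^ n) (cst c * b) = cst c * (d ^^ n) b"
  by (simp add: funpow_ker_mult)

lemma funpow_mono: "(d ^^ n) a = 0 \<Longrightarrow> n \<le> m \<Longrightarrow> (d ^^ m) a = 0"
  by (metis funpow_0 funpow_add comp_apply funpow_add le_add_diff_inverse2 Nat.funpow_add)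

text \<open>In Leibniz's formula for the power \<open>i + j\<close> only one term survives. The
  induction applies the claim to \<open>d a * b\<close> and \<open>a * d b\<close>, and Pascal's
  rule adds up the two binomial coefficients.\<close>

lemma funpow_mult_top:
  assumes "(d ^^ Suc i) a = 0" "(d ^^ Suc j) b = 0"
  shows "(d ^^ (i + j)) (a * b) = of_nat ((i + j) choose i) * ((d ^^ i) a * (d ^^ j) b)
    \<and> (d ^^ Suc (i + j)) (a * b) = 0"
  using assms
proof (induction "i + j" arbitrary: i j a b)
  case 0
  then show ?case by (simp add: d_mult)
next
  case (Suc n)
  show ?case
  proof (cases "i = 0 \<or> j = 0")
    case True
    then show ?thesis
    proof
      assume "i = 0"
      with Suc.prems show ?thesis
        using funpow_ker_mult[of a "Suc j" b] by (simp add: funpow_ker_mult d_mult)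
    next
      assume "j = 0"
      with Suc.prems show ?thesis
        using funpow_ker_mult'[of b "Suc i" a] by (simp add: funpow_ker_mult' d_mult)
    qed
  next
    case False
    then obtain i' j' where ij: "i = Suc i'" "j = Suc j'" by (metis not0_implies_Suc)
    have n: "n = i' + j" "n = i + j'" using Suc.hyps(2) ij by simp_all
    have "(d ^^ Suc i') (d a) = 0" "(d ^^ Suc j') (d b) = 0"
      using Suc.prems ij by (simp_all add: funpow_swap1)
    then have "(d ^^ (i' + j)) (d a * b) = of_nat ((i' + j) choose i') * ((d ^^ i') (d a) * (d ^^ j) b)"
        "(d ^^ Suc (i' + j)) (d a * b) = 0"
        "(d ^^ (i + j')) (a * d b) = of_nat ((i + j') choose i) * ((d ^^ i) a * (d ^^ j') (d b))"
        "(d ^^ Suc (i + j')) (a * d b) = 0"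
      using Suc.hyps(1)[of i' j "d a" b] Suc.hyps(1)[of i j' a "d b"] Suc.prems n by blast+
    moreover have "(d ^^ i') (d a) = (d ^^ i) a" "(d ^^ j') (d b) = (d ^^ j) b"
      by (simp_all add: ij funpow_swap1)
    moreover have "(d ^^ Suc m) (a * b) = (d ^^ m) (d a * b) + (d ^^ m) (a * d b)" for m
      by (simp only: funpow_Suc_right comp_apply d_mult funpow_add)
    moreover have "i + j = Suc n" using Suc.hyps(2) by simp
    moreover have "Suc n choose i = (n choose i') + (n choose i)" using ij by simp
    ultimately show ?thesis by (simp add: n[symmetric] algebra_simps del: funpow.simps)
  qed
qed

text \<open>
  If \<open>d s = 1\<close> for some \<open>s\<close> in a localization, then \<open>lc n a\<close> is the coefficient of \<open>s\<^sup>n\<close> in \<open>a\<close>,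
  provided that \<open>a\<close> has degree at most \<open>n\<close> in \<open>s\<close>.
\<close>

definition lc :: "nat \<Rightarrow> ('v, 'k) mp \<Rightarrow> ('v, 'k) mp" where
  "lc n a = cst (inverse (fact n)) * (d ^^ n) a"

lemma lc_add: "lc n (a + b) = lc n a + lc n b" by (simp add: lc_def funpow_add algebra_simps)
lemma lc_diff: "lc n (a - b) = lc n a - lc n b" by (simp add: lc_def funpow_diff algebra_simps)
lemma lc_sum: "lc n (sum f S) = (\<Sum>i\<in>S. lc n (f i))" by (simp add: lc_def funpow_sum sum_distrib_left)
lemma lc_cst_mult: "lc n (cst c * b) = cst c * lc n b" by (simp add: lc_def funpow_cst_mult)
lemma lc_0_left [simp]: "lc 0 a = a" by (simp add: lc_def)
lemma lc_eq_0_iff: "lc n a = 0 \<longleftrightarrow> (d ^^ n) a = 0" by (simp add: lc_def)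
lemma funpow_eq_lc: "(d ^^ n) a = cst (fact n) * lc n a"
  by (simp add: lc_def flip: cst_mult mult.assoc)

lemma lc_mult:
  assumes "(d ^^ Suc i) a = 0" "(d ^^ Suc j) b = 0"
  shows "lc (i + j) (a * b) = lc i a * lc j b"
proof -
  have "inverse (fact (i + j)) * of_nat ((i + j) choose i) = (inverse (fact i) * inverse (fact j) :: 'k)"
    by (simp add: binomial_fact field_simps)
  then have "cst (inverse (fact (i + j))) * of_nat ((i + j) choose i) = (cst (inverse (fact i)) * cst (inverse (fact j)) :: ('v,'k) mp)"
    by (simp flip: cst_mult cst_of_nat)
  then show ?thesis
    using funpow_mult_top[OF assms] by (simp add: lc_def algebra_simps)
qed

lemma funpow_mult_0:
  assumes "(d ^^ Suc i) a = 0" "(d ^^ Suc j) b = 0"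
  shows "(d ^^ Suc (i + j)) (a * b) = 0"
  using funpow_mult_top[OF assms] by blast

lemma lc_power:
  assumes "(d ^^ Suc i) a = 0"
  shows "(d ^^ Suc (n * i)) (a ^ n) = 0 \<and> lc (n * i) (a ^ n) = lc i a ^ n"
proof (induction n)
  case (Suc n)
  then show ?case
    using funpow_mult_0[OF assms, of "n * i" "a ^ n"] lc_mult[OF assms, of "n * i" "a ^ n"] by simp
qed simp

lemma lc_prod:
  assumes "\<And>x. x \<in> S \<Longrightarrow> (d ^^ Suc (n x)) (f x) = 0"
  shows "(d ^^ Suc (sum n S)) (prod f S) = 0 \<and> lc (sum n S) (prod f S) = (\<Prod>x\<in>S. lc (n x) (f x))"
  using assms
proof (induction S rule: infinite_finite_induct)
  case (insert x S)
  then have "(d ^^ Suc (n x)) (f x) = 0" "(d ^^ Suc (sum n S)) (prod f S) = 0" by auto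
  then show ?case
    using insert funpow_mult_0[of "n x" "f x" "sum n S" "prod f S"]
      lc_mult[of "n x" "f x" "sum n S" "prod f S"] by simp
qed simp_all

text \<open>Weights that bound the degrees of the variables bound the degree of every polynomial,
  and only terms of weight exactly \<open>N\<close> can contribute to \<open>lc N\<close>. Hence
  \<open>(d ^^ N) f = 0\<close> exactly when the component of weight \<open>N\<close> vanishes at
  the leading coefficients of the variables.\<close>

lemma lc_hcomp:
  assumes n: "\<And>v. (d ^^ Suc (w v)) (var v) = 0" and f: "hdeg w (int N) f"
  shows "(d ^^ Suc N) f = 0" "lc N f = ev (\<lambda>v. lc (w v) (var v)) (hcomp w (int N) f)"
proof -
  let ?u = "\<lambda>v. lc (w v) (var v)"
  have mon: "(d ^^ Suc N) (single m c) = 0 \<and> lc N (single m c) = ev ?u (hcomp w (int N) (single m c))"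
    if m: "wd w m \<le> int N" for m c
  proof -
    let ?k = "\<Sum>v\<in>UNIV. lookup m v * w v"
    have k: "wd w m = int ?k" by (simp add: wd_def mult.commute)
    let ?p = "\<Prod>v\<in>UNIV. var v ^ lookup m v"
    have p: "(d ^^ Suc ?k) ?p = 0" "lc ?k ?p = (\<Prod>v\<in>UNIV. ?u v ^ lookup m v)"
      using lc_prod[of UNIV "\<lambda>v. lookup m v * w v" "\<lambda>v. var v ^ lookup m v"] lc_power[OF n]
      by auto
    have s: "single m c = cst c * ?p" by (rule single_prod_var)
    have z: "(d ^^ Suc ?k) (single m c) = 0"
      unfolding s funpow_cst_mult using p by simp
    have l: "lc ?k (single m c) = ev ?u (single m c)"
    proof -
      have "lc ?k (single m c) = cst c * lc ?k ?p" by (simp only: s lc_cst_mult)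
      then show ?thesis by (simp add: p(2) ev_single)
    qed
    have h: "homog w (int ?k) (single m c)" by (simp add: homog_def k)
    show ?thesis
    proof (cases "?k = N")
      case True
      then show ?thesis using z l hcomp_homog[OF h] by simp
    next
      case False
      have "?k \<le> N" using m unfolding k by (simp only: of_nat_le_iff)
      then have "Suc ?k \<le> N" using False by linarith
      then have "(d ^^ N) (single m c) = 0" "(d ^^ Suc N) (single m c) = 0"
        using z funpow_mono[OF z] by auto
      moreover have "hcomp w (int N) (single m c) = 0"
        using False by (simp only: hcomp_homog[OF h] of_nat_eq_iff if_False)
      ultimately show ?thesis by (simp add: lc_eq_0_iff)
    qed
  qed
  define S g where "S = keys f" and "g m = single m (lookup f m)" for m
  have f_eq: "f = sum g S" unfolding S_def g_def by (rule sum_singles)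
  have "wd w m \<le> int N" if "m \<in> S" for m using f that by (simp add: hdeg_def S_def)
  then have "(d ^^ Suc N) (g m) = 0" "lc N (g m) = ev ?u (hcomp w (int N) (g m))" if "m \<in> S" for m
    using mon that by (simp_all only: g_def)
  then show "(d ^^ Suc N) f = 0" "lc N f = ev ?u (hcomp w (int N) f)"
    by (simp_all only: f_eq funpow_sum lc_sum hcomp_sum ev_sum) simp_all
qed

lemma dvd_ev:
  assumes "\<And>v. u dvd d (t v)" shows "u dvd d (ev t f)"
  by (induction f rule: mp_induct) (auto simp: ev_simps d_add d_mult assms)

lemma dvd_gen:
  assumes "\<And>v. u dvd d (var v)" shows "u dvd d f"
  using dvd_ev[of u var f] assms by simp

lemma hdeg_raise:
  assumes v: "\<And>v. hdeg w (int (w v) + e) (d (var v))" and f: "hdeg w i f"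
  shows "hdeg w (i + e) (d f)"
proof -
  define P where "P i f \<longleftrightarrow> hdeg w i f \<and> hdeg w (i + e) (d f)" for i f
  have Pm: "P (i + j) (f * g)" if "P i f" "P j g" for i j f g
    using that hdeg_mult[of w i f j g] hdeg_mult[of w "i + e" "d f" j g] hdeg_mult[of w i f "j + e" "d g"]
    by (auto simp: P_def d_mult algebra_simps intro!: hdeg_add)
  have Pc: "P 0 (cst c)" for c by (simp add: P_def homog_imp_hdeg)
  have P1: "P 0 1" using Pc[of 1] by simp
  have Pw: "P (int (n * w v)) (var v ^ n)" for v n
  proof (induction n)
    case (Suc n)
    have "P (int (w v)) (var v)" by (simp add: P_def v homog_imp_hdeg homog_var)
    from Pm[OF this Suc] show ?case by simp
  qed (simp add: P1)
  have Pp: "P (\<Sum>v\<in>S. int (g v * w v)) (\<Prod>v\<in>S. var v ^ g v)" if "finite S" for S g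
    using that by induction (auto simp: P1 intro: Pm[OF Pw, simplified])
  have Ps: "P (wd w m) (single m c)" for m c
    using Pm[OF Pc Pp[of UNIV "lookup m"], of c]
    by (simp add: single_prod_var[of m c] wd_def mult.commute)
  have "hdeg w (i + e) (d (single m (lookup f m)))" if "m \<in> keys f" for m
    using Ps[of m "lookup f m"] f that by (auto simp: P_def hdeg_def[of w i f] intro: hdeg_mono)
  then show ?thesis by (subst sum_singles[of f]) (auto simp: d_sum intro: hdeg_sum)
qed

text \<open>If \<open>d\<close> raises weights by at most \<open>e\<close>, this is the derivation
  that \<open>d\<close> induces on the associated graded ring: only the part with shift exactly
  \<open>e\<close> is kept.\<close>

definition dtop :: "('v \<Rightarrow> nat) \<Rightarrow> int \<Rightarrow> ('v, 'k) mp \<Rightarrow> ('v, 'k) mp" where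
  "dtop w e = lext (\<lambda>m c. hcomp w (wd w m + e) (d (single m c)))"

lemma dtop_add: "dtop w e (f + g) = dtop w e f + dtop w e g"
  unfolding dtop_def by (rule lext_add) (simp_all add: single_add d_add hcomp_add)

lemma dtop_homog: "homog w i f \<Longrightarrow> dtop w e f = hcomp w (i + e) (d f)"
proof -
  assume h: "homog w i f"
  have "dtop w e f = (\<Sum>m\<in>keys f. hcomp w (i + e) (d (single m (lookup f m))))"
    using h by (auto simp: dtop_def lext_def homog_def intro: sum.cong)
  also have "\<dots> = hcomp w (i + e) (d (\<Sum>m\<in>keys f. single m (lookup f m)))"
    by (simp add: d_sum hcomp_sum)
  finally show ?thesis by (simp flip: sum_singles)
qed

text \<open>A homogeneous factor can be pulled out of a homogeneous component, so the Leibniz rule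
  for \<open>d\<close> on monomials passes to components.\<close>

lemma kder_dtop: "kder (dtop w e)"
proof
  show "dtop w e (f + g) = dtop w e f + dtop w e g" for f g by (rule dtop_add)
  show "dtop w e (cst c) = 0" for c by (simp add: dtop_homog[OF homog_cst])
  show "dtop w e (f * g) = dtop w e f * g + f * dtop w e g" for f g
  proof (induction f rule: mp_linear_induct)
    case (single m c)
    show ?case
    proof (induction g rule: mp_linear_induct)
      case (single n x)
      have h: "homog w (wd w m) (single m c)" "homog w (wd w n) (single n x)"
        by (simp_all add: homog_def)
      show ?case
        using hcomp_homog_mult[OF h(1), of "wd w n + e" "d (single n x)"]
          hcomp_homog_mult[OF h(2), of "wd w m + e" "d (single m c)"]
        by (simp add: dtop_homog[OF homog_mult[OF h]] dtop_homog[OF h(1)] dtop_homog[OF h(2)]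
            d_mult hcomp_add algebra_simps)
    qed (simp add: dtop_add algebra_simps)
  qed (simp add: dtop_add algebra_simps)
qed

lemma dtop_hcomp:
  assumes v: "\<And>v. hdeg w (int (w v) + e) (d (var v))" and f: "hdeg w i f"
  shows "hcomp w (i + e) (d f) = dtop w e (hcomp w i f)"
proof -
  define g where "g = f - hcomp w i f"
  have g: "hdeg w (i - 1) g" unfolding g_def by (rule hdeg_minus_hcomp[OF f])
  have "hcomp w (i + e) (d g) = 0"
    using hdeg_raise[OF v g] by (rule hdeg_hcomp_eq_0) simp
  then show ?thesis
    by (simp add: g_def d_diff hcomp_diff dtop_homog[OF homog_hcomp])
qed

lemma dtop_funpow:
  assumes v: "\<And>v. hdeg w (int (w v) + e) (d (var v))" and f: "hdeg w i f"
  shows "hdeg w (i + int k * e) ((d ^^ k) f) \<and> hcomp w (i + int k * e) ((d ^^ k) f) = (dtop w e ^^ k) (hcomp w i f)"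
proof (induction k)
  case (Suc k)
  then show ?case
    using hdeg_raise[OF v, of "i + int k * e" "(d ^^ k) f"] dtop_hcomp[OF v, of "i + int k * e" "(d ^^ k) f"]
    by (simp add: algebra_simps)
qed (simp add: f)

end

section \<open>The degree function of a locally nilpotent derivation\<close>

locale lnd_mp = kder d for d :: "('v::{finite,linorder}, 'k::field_char_0) mp \<Rightarrow> ('v, 'k) mp" +
  assumes nilp: "\<exists>n. (d ^^ n) a = 0"
begin

text \<open>The value \<open>deg 0 = 0\<close> makes \<open>deg a = 0\<close> equivalent to
  \<open>d a = 0\<close>; in return, additivity on products requires nonzero factors.\<close>

definition deg :: "('v, 'k) mp \<Rightarrow> nat" where
  "deg a = (LEAST n. (d ^^ Suc n) a = 0)"

lemma deg_nil: "(d ^^ Suc (deg a)) a = 0"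
proof -
  obtain n where "(d ^^ n) a = 0" using nilp by blast
  then have "(d ^^ Suc n) a = 0" by simp
  then show ?thesis unfolding deg_def by (rule LeastI)
qed

lemma deg_le_iff: "deg a \<le> n \<longleftrightarrow> (d ^^ Suc n) a = 0"
proof
  show "deg a \<le> n \<Longrightarrow> (d ^^ Suc n) a = 0" using funpow_mono[OF deg_nil, of a "Suc n"] by simp
  show "(d ^^ Suc n) a = 0 \<Longrightarrow> deg a \<le> n" unfolding deg_def by (rule Least_le)
qed

lemma deg_less_iff: "n > 0 \<Longrightarrow> deg a < n \<longleftrightarrow> (d ^^ n) a = 0"
  using deg_le_iff[of a "n - 1"] by auto

lemma deg_top: "a \<noteq> 0 \<Longrightarrow> (d ^^ deg a) a \<noteq> 0"
  using deg_less_iff[of "deg a" a] by (cases "deg a = 0") auto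

lemma deg_unique: "(d ^^ n) a \<noteq> 0 \<Longrightarrow> (d ^^ Suc n) a = 0 \<Longrightarrow> deg a = n"
  using deg_le_iff[of a n] deg_less_iff[of n a] by (cases "n = 0") (auto simp del: funpow.simps)

lemma deg_0 [simp]: "deg 0 = 0" using deg_le_iff[of 0 0] by simp
lemma deg_eq_0_iff: "deg a = 0 \<longleftrightarrow> d a = 0" using deg_le_iff[of a 0] by simp
lemma deg_cst [simp]: "deg (cst c) = 0" by (simp add: deg_eq_0_iff)

lemma lc_deg_nz: "a \<noteq> 0 \<Longrightarrow> lc (deg a) a \<noteq> 0"
  by (simp add: lc_eq_0_iff deg_top)

text \<open>Leading coefficients multiply, and the ring is a domain.\<close>

lemma deg_mult:
  assumes "a \<noteq> 0" "b \<noteq> 0" shows "deg (a * b) = deg a + deg b"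
proof (rule deg_unique)
  show "(d ^^ Suc (deg a + deg b)) (a * b) = 0" by (rule funpow_mult_0[OF deg_nil deg_nil])
  have "lc (deg a + deg b) (a * b) \<noteq> 0"
    using lc_mult[OF deg_nil[of a] deg_nil[of b]] assms by (simp add: lc_deg_nz)
  then show "(d ^^ (deg a + deg b)) (a * b) \<noteq> 0" by (simp add: lc_eq_0_iff)
qed

lemma deg_power: "a \<noteq> 0 \<Longrightarrow> deg (a ^ n) = n * deg a"
proof (induction n)
  case 0
  show ?case by (simp add: deg_eq_0_iff)
qed (simp add: deg_mult)

lemma deg_cst_mult: "c \<noteq> 0 \<Longrightarrow> deg (cst c * a) = deg a"
  by (cases "a = 0") (simp_all add: deg_mult)

lemma deg_d: "d a \<noteq> 0 \<Longrightarrow> Suc (deg (d a)) = deg a"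
proof -
  assume "d a \<noteq> 0"
  then have a: "a \<noteq> 0" "deg a \<noteq> 0" by (auto simp: deg_eq_0_iff)
  then obtain n where n: "deg a = Suc n" using not0_implies_Suc by blast
  have "deg (d a) = n"
    by (rule deg_unique) (use deg_top[OF a(1)] deg_nil[of a] n in \<open>simp_all add: funpow_swap1\<close>)
  then show ?thesis using n by simp
qed

lemma deg_add_le: "deg a \<le> n \<Longrightarrow> deg b \<le> n \<Longrightarrow> deg (a + b) \<le> n"
  unfolding deg_le_iff by (simp only: funpow_add) simp

lemma deg_sum_le: "(\<And>i. i \<in> S \<Longrightarrow> deg (f i) \<le> n) \<Longrightarrow> deg (sum f S) \<le> n"
  by (induction S rule: infinite_finite_induct) (auto intro: deg_add_le)

text \<open>Otherwise \<open>d a\<close> would have degree at least \<open>deg a\<close>, whereas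
  \<open>d\<close> lowers the degree by one.\<close>

lemma dvd_self: "a dvd d a \<Longrightarrow> d a = 0"
proof (rule ccontr)
  assume "a dvd d a" and nz: "d a \<noteq> 0"
  then obtain c where c: "d a = a * c" by auto
  then have "deg (d a) = deg a + deg c" using nz by (simp add: deg_mult)
  then show False using deg_d[OF nz] by simp
qed

text \<open>On a monomial the iterates of \<open>dtop w e\<close> are components of the iterates of
  \<open>d\<close>, so they vanish together with these.\<close>

lemma lnd_dtop:
  assumes v: "\<And>v. hdeg w (int (w v) + e) (d (var v))"
  shows "lnd_mp (dtop w e)"
proof -
  interpret t: kder "dtop w e" by (rule kder_dtop)
  have "\<exists>n. (dtop w e ^^ n) f = 0" for f
  proof (induction f rule: mp_linear_induct)
    case (single m c)
    have h: "homog w (wd w m) (single m c)" by (simp add: homog_def)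
    obtain n where "(d ^^ n) (single m c) = 0" using nilp by blast
    then show ?case
      using dtop_funpow[OF v homog_imp_hdeg[OF h], of n] hcomp_homog[OF h, of "wd w m"] by auto
  next
    case (add f g)
    then obtain n m where nm: "(dtop w e ^^ n) f = 0" "(dtop w e ^^ m) g = 0" by blast
    then have "(dtop w e ^^ (n + m)) (f + g) = 0"
      using t.funpow_mono[OF nm(1), of "n + m"] t.funpow_mono[OF nm(2), of "n + m"]
      by (simp add: t.funpow_add)
    then show ?case by blast
  qed
  then show ?thesis by unfold_locales
qed

end

section \<open>Homogeneous relations\<close>

lemma var_neq_0 [simp]: "var v \<noteq> 0"
  unfolding var_def by (metis keys_single keys_zero insert_not_empty one_neq_zero)

lemma cst_sum: "cst (sum h S) = (\<Sum>j\<in>S. cst (h j))"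
  by (induction S rule: infinite_finite_induct) (simp_all add: cst_add)

lemma poly_altdef_le:
  fixes p :: "'a::idom poly"
  assumes "degree p \<le> n" shows "poly p x = (\<Sum>i\<le>n. coeff p i * x ^ i)"
  unfolding poly_altdef using assms
  by (intro sum.mono_neutral_left) (auto simp: coeff_eq_0)

text \<open>A bound for the leading monomial in a term order. The coefficient at
  \<open>\<mu>\<close> may be zero, so that two polynomials can share one bound.\<close>

definition keys_le :: "('v::linorder \<Rightarrow>\<^sub>0 nat) \<Rightarrow> ('v, 'k::field) mp \<Rightarrow> bool" where
  "keys_le \<mu> f \<longleftrightarrow> (\<forall>m\<in>keys f. m \<le> \<mu>)"

lemma keys_le_mult:
  assumes f: "keys_le \<mu> f" and g: "keys_le \<nu> g"
  shows "keys_le (\<mu> + \<nu>) (f * g)" "lookup (f * g) (\<mu> + \<nu>) = lookup f \<mu> * lookup g \<nu>"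
proof -
  show "keys_le (\<mu> + \<nu>) (f * g)"
    using keys_mult[of f g] f g unfolding keys_le_def by (fastforce intro: add_mono)
  define f' g' where "f' = f - single \<mu> (lookup f \<mu>)" and "g' = g - single \<nu> (lookup g \<nu>)"
  have ls: "\<forall>m\<in>keys (h - single \<rho> (lookup h \<rho>)). m < \<rho>" if "keys_le \<rho> h" for \<rho> and h :: "('a, 'b) mp"
  proof
    fix m assume m: "m \<in> keys (h - single \<rho> (lookup h \<rho>))"
    then have "m \<noteq> \<rho>" by (auto simp: in_keys_iff lookup_minus)
    moreover have "m \<in> keys h" using m \<open>m \<noteq> \<rho>\<close> by (auto simp: in_keys_iff lookup_minus lookup_single)
    ultimately show "m < \<rho>" using that by (auto simp: keys_le_def order.strict_iff_order)
  qed
  have l: "\<forall>m\<in>keys f'. m < \<mu>" "\<forall>m\<in>keys g'. m < \<nu>"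
    unfolding f'_def g'_def using f g ls by blast+
  have z: "lookup (p * q) (\<mu> + \<nu>) = 0"
    if "\<forall>m\<in>keys p. \<forall>k\<in>keys q. m + k < \<mu> + \<nu>" for p q :: "('a, 'b) mp"
  proof (rule ccontr)
    assume "lookup (p * q) (\<mu> + \<nu>) \<noteq> 0"
    then have "\<mu> + \<nu> \<in> keys (p * q)" by (simp add: in_keys_iff)
    then obtain m k where "m \<in> keys p" "k \<in> keys q" "\<mu> + \<nu> = m + k"
      using keys_mult[of p q] by blast
    then show False using that by force
  qed
  have eq: "f * g = single (\<mu> + \<nu>) (lookup f \<mu> * lookup g \<nu>)
      + (f' * g + single \<mu> (lookup f \<mu>) * g')"
    by (simp add: f'_def g'_def algebra_simps flip: mult_single)
  have 1: "lookup (f' * g) (\<mu> + \<nu>) = 0"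
    using l g by (intro z) (auto simp: keys_le_def intro: add_less_le_mono)
  have 2: "lookup (single \<mu> (lookup f \<mu>) * g') (\<mu> + \<nu>) = 0"
    using l by (intro z) (auto split: if_splits)
  show "lookup (f * g) (\<mu> + \<nu>) = lookup f \<mu> * lookup g \<nu>"
    using arg_cong[OF eq, of "\<lambda>h. lookup h (\<mu> + \<nu>)"]
    by (simp only: lookup_add 1 2 lookup_single_eq add_0_right)
qed

primrec nmult :: "nat \<Rightarrow> 'a::comm_monoid_add \<Rightarrow> 'a" where
  "nmult 0 m = 0"
| "nmult (Suc n) m = m + nmult n m"

lemma nmult_add: "nmult (i + j) m = nmult i m + nmult j m"
  by (induction i) (simp_all add: algebra_simps)

lemma keys_le_power:
  assumes "keys_le \<mu> f"
  shows "keys_le (nmult n \<mu>) (f ^ n) \<and> lookup (f ^ n) (nmult n \<mu>) = lookup f \<mu> ^ n"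
proof (induction n)
  case 0
  show ?case by (simp add: keys_le_def)
next
  case (Suc n)
  then show ?case using keys_le_mult[OF assms, of "nmult n \<mu>" "f ^ n"] by simp
qed

text \<open>For \<open>degree Q \<le> J\<close> this is \<open>b^J Q(a/b)\<close> without
  denominators.\<close>

definition hpoly :: "nat \<Rightarrow> 'k::field poly \<Rightarrow> ('v::{finite,linorder}, 'k) mp \<Rightarrow> ('v, 'k) mp \<Rightarrow> ('v, 'k) mp" where
  "hpoly J Q a b = (\<Sum>j\<le>J. cst (coeff Q j) * (a ^ j * b ^ (J - j)))"

lemma hpoly_root:
  assumes "degree Q \<le> J"
  shows "hpoly (Suc J) ([:- c, 1:] * Q) a b = (a - cst c * b) * hpoly J Q a b"
proof -
  have z: "coeff Q (Suc J) = 0" using assms by (simp add: coeff_eq_0)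
  have "hpoly (Suc J) ([:- c, 1:] * Q) a b = hpoly (Suc J) (pCons 0 Q) a b - cst c * hpoly (Suc J) Q a b"
    by (simp add: hpoly_def sum_distrib_left cst_diff cst_mult algebra_simps del: sum.atMost_Suc
        flip: sum_subtractf)
  also have "hpoly (Suc J) (pCons 0 Q) a b = a * hpoly J Q a b"
    unfolding hpoly_def by (subst sum.atMost_Suc_shift) (simp add: sum_distrib_left algebra_simps)
  also have "hpoly (Suc J) Q a b = b * hpoly J Q a b"
    by (simp add: hpoly_def z sum_distrib_left Suc_diff_le algebra_simps)
  finally show ?thesis by (simp add: algebra_simps)
qed

text \<open>In other words: \<open>k\<close> is algebraically closed in the field of rational functions.\<close>

lemma hpoly_eq_0_ratio:
  fixes a b :: "('v::{finite,linorder}, 'k::field) mp"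
  assumes ab: "a \<noteq> 0" "b \<noteq> 0" and "Q \<noteq> 0" "degree Q \<le> J" "hpoly J Q a b = 0"
  shows "\<exists>c. a = cst c * b"
  using assms(3-)
proof (induction J arbitrary: Q)
  case 0
  then have "Q = [:coeff Q 0:]" by (metis degree_0_id le_zero_eq)
  with 0 show ?case by (simp add: hpoly_def)
next
  case (Suc J)
  \<comment> \<open>The coefficient of the relation at \<open>Suc J\<close> times the larger of the
    two leading monomials is a relation over \<open>k\<close> between the coefficients of
    \<open>a\<close> and \<open>b\<close> at \<open>\<mu>\<close>.\<close>
  define \<mu> where "\<mu> = Max (keys a \<union> keys b)"
  have fin: "finite (keys a \<union> keys b)" "keys a \<union> keys b \<noteq> {}" using ab by auto
  have "\<mu> \<in> keys a \<union> keys b" unfolding \<mu>_def using fin by (rule Max_in)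
  then have nz: "lookup a \<mu> \<noteq> 0 \<or> lookup b \<mu> \<noteq> 0" by (simp add: in_keys_iff)
  have le: "keys_le \<mu> a" "keys_le \<mu> b" using fin by (auto simp: keys_le_def \<mu>_def)
  let ?J = "Suc J"
  have "lookup (cst (coeff Q j) * (a ^ j * b ^ (?J - j))) (nmult ?J \<mu>)
      = coeff Q j * (lookup a \<mu> ^ j * lookup b \<mu> ^ (?J - j))" if "j \<le> ?J" for j
  proof -
    have "nmult ?J \<mu> = nmult j \<mu> + nmult (?J - j) \<mu>" using that by (simp flip: nmult_add)
    then show ?thesis
      using keys_le_power[OF le(1), of j] keys_le_power[OF le(2), of "?J - j"]
      by (simp only: lookup_cst_mult keys_le_mult(2))
  qed
  then have "lookup (hpoly ?J Q a b) (nmult ?J \<mu>)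
      = (\<Sum>j\<le>?J. coeff Q j * (lookup a \<mu> ^ j * lookup b \<mu> ^ (?J - j)))"
    unfolding hpoly_def lookup_sum by (intro sum.cong) (auto simp del: nmult.simps)
  then have s: "(\<Sum>j\<le>?J. coeff Q j * (lookup a \<mu> ^ j * lookup b \<mu> ^ (?J - j))) = 0"
    using Suc.prems by simp
  show ?case
  proof (cases "lookup b \<mu> = 0")
    \<comment> \<open>Here \<open>b\<close> has the smaller leading monomial, so only the term with
      \<open>j = Suc J\<close> is left. Thus the top coefficient of \<open>Q\<close> vanishes and a
      factor \<open>b\<close> can be cancelled.\<close>
    case True
    have "(\<Sum>j\<le>J. coeff Q j * (lookup a \<mu> ^ j * lookup b \<mu> ^ (?J - j))) = 0"
      using True by (intro sum.neutral) (auto simp: Suc_diff_le)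
    with s True nz have q: "coeff Q ?J = 0" by (auto simp: )
    have d: "degree Q \<le> J"
      using q Suc.prems by (metis le_SucE leading_coeff_0_iff)
    have "hpoly ?J Q a b = b * hpoly J Q a b"
      by (simp add: hpoly_def q sum_distrib_left Suc_diff_le algebra_simps)
    then show ?thesis using Suc d ab by simp
  next
    case False
    \<comment> \<open>The only possible value of the ratio. It is a root of \<open>Q\<close>; the
      corresponding linear factor \<open>a - c b\<close> is either zero, which is the claim, or
      cancels.\<close>
    define c where "c = lookup a \<mu> / lookup b \<mu>"
    have "(\<Sum>j\<le>?J. coeff Q j * c ^ j) * lookup b \<mu> ^ ?J
        = (\<Sum>j\<le>?J. coeff Q j * (lookup a \<mu> ^ j * lookup b \<mu> ^ (?J - j)))"
      unfolding sum_distrib_right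
    proof (rule sum.cong)
      fix j assume "j \<in> {..?J}"
      then have "lookup b \<mu> ^ ?J = lookup b \<mu> ^ j * lookup b \<mu> ^ (?J - j)"
        by (metis atMost_iff le_add_diff_inverse power_add)
      then show "coeff Q j * c ^ j * lookup b \<mu> ^ ?J = coeff Q j * (lookup a \<mu> ^ j * lookup b \<mu> ^ (?J - j))"
        using False by (simp add: c_def power_divide)
    qed simp
    then have "(\<Sum>j\<le>?J. coeff Q j * c ^ j) = 0" using s False by (auto simp: )
    then have "poly Q c = 0"
      using poly_altdef_le[OF Suc.prems(2)] by simp
    then obtain Q1 where Q1: "Q = [:- c, 1:] * Q1" by (auto simp: poly_eq_0_iff_dvd)
    then have "Q1 \<noteq> 0" using Suc.prems by auto
    then have "degree Q = Suc (degree Q1)" by (simp add: Q1 degree_mult_eq del: mult_pCons_left)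
    then have d: "degree Q1 \<le> J" "Q1 \<noteq> 0" using Suc.prems \<open>Q1 \<noteq> 0\<close> by simp_all
    show ?thesis
    proof (cases "a = cst c * b")
      case False
      then have "hpoly J Q1 a b = 0" using hpoly_root[OF d(1), of c a b] Suc.prems Q1 by simp
      then show ?thesis using Suc.IH d by blast
    qed blast
  qed
qed

text \<open>Setting \<open>v\<close> to zero is reduction modulo \<open>v\<close> and fixes
  \<open>w\<close>, so \<open>b\<close> itself must reduce to zero; one factor \<open>v\<close> is
  split off at a time.\<close>

lemma var_dvd_mult_var:
  assumes vw: "v \<noteq> w" and d: "var v ^ i dvd var w ^ j * b"
  shows "var v ^ i dvd (b :: ('v::{finite,linorder}, 'k::field) mp)"
proof -
  let ?e = "ev (var(v := 0)) :: ('v, 'k) mp \<Rightarrow> ('v, 'k) mp"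
  have red: "var v dvd f - ?e f" for f
  proof (induction f rule: mp_induct)
    case (add f g)
    then show ?case using dvd_add[OF add] by (simp add: ev_simps algebra_simps)
  next
    case (mult f g)
    have "f * g - ?e (f * g) = (f - ?e f) * g + ?e f * (g - ?e g)"
      by (simp add: ev_simps algebra_simps)
    then show ?case using mult by (metis dvd_add dvd_mult dvd_mult2)
  qed auto
  note vnz = var_neq_0
  have one: "var v dvd b" if "var v dvd var w ^ j * b" for b :: "('v, 'k) mp"
  proof -
    from that obtain c where "var w ^ j * b = var v * c" by (rule dvdE)
    then have "?e (var w ^ j * b) = ?e (var v * c)" by simp
    then have "?e b = 0" using vw vnz by (simp add: ev_simps)
    then show ?thesis using red[of b] by simp
  qed
  show ?thesis using d
  proof (induction i arbitrary: b)
    case (Suc i)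
    have "var v dvd var w ^ j * b" using Suc.prems by (metis dvd_mult_left power_Suc)
    then obtain b' where b': "b = var v * b'" using one by blast
    have "var v * var v ^ i dvd var v * (var w ^ j * b')"
      using Suc.prems by (simp add: b' algebra_simps)
    then have "var v ^ i dvd var w ^ j * b'" using vnz by simp
    from Suc.IH[OF this] show ?case by (simp add: b' mult_dvd_mono)
  qed simp
qed

abbreviation pX :: "(bool, 'k::field) mp" where "pX \<equiv> var False"
abbreviation pY :: "(bool, 'k::field) mp" where "pY \<equiv> var True"

definition bw :: "'a \<Rightarrow> 'a \<Rightarrow> bool \<Rightarrow> 'a" where
  "bw m n b = (if b then n else m)"

lemma bw_simps [simp]: "bw m n False = m" "bw m n True = n"
  by (simp_all add: bw_def)

definition bexp :: "nat \<Rightarrow> nat \<Rightarrow> bool \<Rightarrow>\<^sub>0 nat" where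
  "bexp u v = single False u + single True v"

lemma lookup_bexp [simp]: "lookup (bexp u v) False = u" "lookup (bexp u v) True = v"
  by (simp_all add: bexp_def lookup_add lookup_single)

lemma bexp_lookup: "bexp (lookup m False) (lookup m True) = m"
proof (rule poly_mapping_eqI)
  show "lookup (bexp (lookup m False) (lookup m True)) b = lookup m b" for b
    by (cases b) simp_all
qed

lemma bexp_eq_iff: "bexp u v = bexp u' v' \<longleftrightarrow> u = u' \<and> v = v'"
  by (metis lookup_bexp)

lemma wd_bw: "wd (bw m n) k = int (m * lookup k False + n * lookup k True)"
  by (simp add: wd_def UNIV_bool)

lemma single_bexp: "single (bexp u v) c = cst c * (pX ^ u * pY ^ v)"
  by (simp add: single_prod_var UNIV_bool)

text \<open>As \<open>m\<close> and \<open>n\<close> are coprime, exponent vectors of equal weight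
  differ by multiples of \<open>(n, -m)\<close>. Counted from the vector with the least first
  exponent \<open>u0\<close>, they are \<open>(u0 + n j, v0 - m j)\<close>; the common monomial has
  exponents \<open>u0\<close> and \<open>v0 mod m\<close>.\<close>

lemma homog_decomp:
  fixes T :: "(bool, 'k::field) mp"
  assumes T: "homog (bw (g * m) (g * n)) N T" "T \<noteq> 0" and pos: "g > 0" "m > 0" "n > 0"
    and co: "coprime m n"
  obtains u v J Q where "Q \<noteq> 0" "degree Q \<le> J" "T = pX ^ u * pY ^ v * hpoly J Q (pX ^ n) (pY ^ m)"
proof -
  let ?U = "(\<lambda>k. lookup k False) ` keys T"
  have "Min ?U \<in> ?U" using T by (intro Min_in) auto
  then obtain k0 where k0: "k0 \<in> keys T" "lookup k0 False = Min ?U" by auto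
  define u0 v0 where "u0 = lookup k0 False" and "v0 = lookup k0 True"
  have u0: "u0 \<le> lookup k False" if "k \<in> keys T" for k
    using that k0 by (simp add: u0_def)
  define J where "J = v0 div m"
  define f where "f j = bexp (u0 + n * j) (v0 - m * j)" for j
  have injf: "inj_on f {..J}"
    using pos by (auto simp: inj_on_def f_def bexp_eq_iff)
  have cover: "keys T \<subseteq> f ` {..J}"
  proof
    fix k assume k: "k \<in> keys T"
    obtain a where a: "lookup k False = u0 + a" using u0[OF k] le_Suc_ex by blast
    have "wd (bw (g * m) (g * n)) k = wd (bw (g * m) (g * n)) k0"
      using T(1) k k0 by (simp add: homog_def)
    then have "g * m * (u0 + a) + g * n * lookup k True = g * m * u0 + g * n * v0"
      by (simp only: wd_bw of_nat_eq_iff a u0_def v0_def)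
    then have "g * (m * a + n * lookup k True) = g * (n * v0)" by (simp add: algebra_simps)
    then have eq: "m * a + n * lookup k True = n * v0" using pos by simp
    then have le: "lookup k True \<le> v0" using pos by (metis le_add2 nat_mult_le_cancel1)
    then have eq2: "m * a = n * (v0 - lookup k True)" using eq by (simp add: diff_mult_distrib2)
    then have "n dvd m * a" by simp
    then have "n dvd a" using co by (simp add: coprime_commute coprime_dvd_mult_right_iff)
    then obtain j where j: "a = n * j" by blast
    then have mj: "m * j = v0 - lookup k True" using eq2 pos by simp
    have "j \<le> J" unfolding J_def using mj pos by (metis diff_le_self less_eq_div_iff_mult_less_eq mult.commute)
    moreover have "k = f j" using bexp_lookup[of k] a j mj le by (simp add: f_def)
    ultimately show "k \<in> f ` {..J}" by auto
  qed
  define Q where "Q = (\<Sum>j\<le>J. monom (lookup T (f j)) j)"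
  have cQ: "coeff Q j = (if j \<le> J then lookup T (f j) else 0)" for j
    by (simp add: Q_def coeff_sum)
  have "T = (\<Sum>k\<in>keys T. single k (lookup T k))" by (rule sum_singles)
  also have "\<dots> = (\<Sum>k\<in>f ` {..J}. single k (lookup T k))"
    using cover by (intro sum.mono_neutral_left) (auto simp: in_keys_iff)
  also have "\<dots> = (\<Sum>j\<le>J. single (f j) (lookup T (f j)))"
    using injf by (simp add: sum.reindex)
  also have "\<dots> = (\<Sum>j\<le>J. pX ^ u0 * pY ^ (v0 mod m) * (cst (coeff Q j) * ((pX ^ n) ^ j * (pY ^ m) ^ (J - j))))"
  proof (rule sum.cong)
    fix j assume j: "j \<in> {..J}"
    have "m * J + v0 mod m = v0" by (simp add: J_def)
    moreover have "m * j \<le> m * J" using j by simp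
    ultimately have "v0 - m * j = v0 mod m + m * (J - j)"
      unfolding diff_mult_distrib2 by linarith
    then show "single (f j) (lookup T (f j))
        = pX ^ u0 * pY ^ (v0 mod m) * (cst (coeff Q j) * ((pX ^ n) ^ j * (pY ^ m) ^ (J - j)))"
      using j by (simp only: f_def single_bexp cQ power_add power_mult atMost_iff if_True)
        (simp add: mult_ac)
  qed simp
  finally have eq: "T = pX ^ u0 * pY ^ (v0 mod m) * hpoly J Q (pX ^ n) (pY ^ m)"
    by (simp add: hpoly_def sum_distrib_left)
  have "Q \<noteq> 0" using eq T(2) by (auto simp: hpoly_def)
  moreover have "degree Q \<le> J" by (rule degree_le) (simp add: cQ)
  ultimately show thesis using eq that by blast
qed

lemma ev_hpoly: "ev u (hpoly J Q a b) = hpoly J Q (ev u a) (ev u b)"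
  by (simp add: hpoly_def ev_simps)

section \<open>Divisibility of degrees in two variables\<close>

locale lnd2 = lnd_mp d for d :: "(bool, 'k::field_char_0) mp \<Rightarrow> (bool, 'k) mp"
begin

text \<open>Both leading coefficients lie in the kernel. If one of them is not constant, it has
  positive weight but degree zero, so its top form is a nontrivial relation between
  \<open>\<alpha>\<close> and \<open>\<beta>\<close> by \<open>lc_hcomp\<close>. Homogeneity turns
  this into an equation for the ratio of \<open>\<alpha> ^ n\<close> and \<open>\<beta> ^ m\<close>
  over \<open>k\<close>.\<close>

lemma leading_coeffs_dependent:
  assumes m: "deg pX = g * m" and n: "deg pY = g * n"
    and pos: "g > 0" "m > 0" "n > 0" and co: "coprime m n"
  defines "\<alpha> \<equiv> lc (g * m) pX" and "\<beta> \<equiv> lc (g * n) pY"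
  shows "\<exists>c. c \<noteq> 0 \<and> \<alpha> ^ n = cst c * \<beta> ^ m"
proof -
  let ?w = "bw (g * m) (g * n)"
  note vnz = var_neq_0
  have nz: "\<alpha> \<noteq> 0" "\<beta> \<noteq> 0"
    using lc_deg_nz[OF vnz, of False] lc_deg_nz[OF vnz, of True] by (simp_all add: \<alpha>_def \<beta>_def m n)
  have nil: "(d ^^ Suc (?w b)) (var b) = 0" for b
    using deg_nil[of "var b"] by (cases b) (simp_all add: m n)
  have lcev: "(\<lambda>b. lc (?w b) (var b)) = bw \<alpha> \<beta>"
    by (auto simp: bw_def \<alpha>_def \<beta>_def)
  have ker: "d \<alpha> = 0" "d \<beta> = 0"
    using nil[of False] nil[of True] by (simp_all add: \<alpha>_def \<beta>_def lc_def d_cst_mult)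
  have "\<exists>c. \<alpha> ^ n = cst c * \<beta> ^ m"
  proof (cases "(\<exists>c. \<alpha> = cst c) \<and> (\<exists>c. \<beta> = cst c)")
    case True
    then obtain a b where ab: "\<alpha> = cst a" "\<beta> = cst b" by blast
    then have "b \<noteq> 0" using nz by auto
    then have "\<alpha> ^ n = cst (a ^ n / b ^ m) * \<beta> ^ m"
      by (simp add: ab flip: cst_power cst_mult)
    then show ?thesis by blast
  next
    case False
    then obtain \<kappa> where \<kappa>: "d \<kappa> = 0" "\<nexists>c. \<kappa> = cst c" using ker by blast
    then have "\<kappa> \<noteq> 0" by (metis cst_0)
    define N where "N = tdeg ?w \<kappa>"
    have wpos: "0 < ?w b" for b using pos by (cases b) auto
    have "\<not> hdeg ?w 0 \<kappa>" using hdeg_0_cst[where w="?w" and f=\<kappa>, OF wpos] \<kappa> by blast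
    then have "N > 0" using \<open>\<kappa> \<noteq> 0\<close> by (simp add: hdeg_iff_tdeg N_def)
    then obtain M where M: "N = int (Suc M)" by (metis gr0_implies_Suc pos_int_cases)
    define T where "T = hcomp ?w N \<kappa>"
    have T: "T \<noteq> 0" "homog ?w N T"
      using hcomp_tdeg_nz[OF \<open>\<kappa> \<noteq> 0\<close>] by (simp_all add: T_def N_def homog_hcomp)
    have "hdeg ?w N \<kappa>" unfolding N_def by (rule hdeg_tdeg)
    then have "hdeg ?w (int (Suc M)) \<kappa>" by (simp only: M)
    from lc_hcomp(2)[OF nil this] have "ev (bw \<alpha> \<beta>) T = lc (Suc M) \<kappa>"
      by (simp only: lcev T_def M)
    also have "\<dots> = 0" using \<kappa>(1) by (simp add: lc_eq_0_iff funpow_swap1)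
    finally have T0: "ev (bw \<alpha> \<beta>) T = 0" .
    obtain u v J Q where Q: "Q \<noteq> 0" "degree Q \<le> J" "T = pX ^ u * pY ^ v * hpoly J Q (pX ^ n) (pY ^ m)"
      by (rule homog_decomp[OF T(2,1) pos co])
    then have "hpoly J Q (\<alpha> ^ n) (\<beta> ^ m) = 0" using T0 nz by (simp add: ev_simps ev_hpoly)
    then show ?thesis using hpoly_eq_0_ratio[of "\<alpha> ^ n" "\<beta> ^ m"] Q nz by simp
  qed
  moreover have "\<alpha> ^ n \<noteq> 0" using nz by simp
  ultimately show ?thesis by (metis cst_0 mult_zero_left)
qed

text \<open>In the factorization of \<open>homog_decomp\<close>, vanishing at
  \<open>(\<alpha>, \<beta>)\<close> makes \<open>c\<close> a root of \<open>Q\<close>, and the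
  linear factor of \<open>Q\<close> homogenizes to the claimed divisor.\<close>

lemma homog_dvd:
  fixes \<alpha> \<beta> :: "(bool, 'k) mp"
  assumes T: "homog (bw (g * m) (g * n)) N T" and pos: "g > 0" "m > 0" "n > 0" and co: "coprime m n"
    and ab: "\<alpha> ^ n = cst c * \<beta> ^ m" "\<alpha> \<noteq> 0" "\<beta> \<noteq> 0" and 0: "ev (bw \<alpha> \<beta>) T = 0"
  shows "(pX ^ n - cst c * pY ^ m) dvd T"
proof (cases "T = 0")
  case False
  obtain u v J Q where Q: "Q \<noteq> 0" "degree Q \<le> J" "T = pX ^ u * pY ^ v * hpoly J Q (pX ^ n) (pY ^ m)"
    by (rule homog_decomp[OF T False pos co])
  have "hpoly J Q (\<alpha> ^ n) (\<beta> ^ m) = cst (poly Q c) * (\<beta> ^ m) ^ J"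
  proof -
    have "hpoly J Q (\<alpha> ^ n) (\<beta> ^ m) = (\<Sum>j\<le>J. cst (coeff Q j * c ^ j) * (\<beta> ^ m) ^ J)"
      unfolding hpoly_def
    proof (rule sum.cong)
      fix j assume "j \<in> {..J}"
      then have "(\<beta> ^ m) ^ J = (\<beta> ^ m) ^ j * (\<beta> ^ m) ^ (J - j)" by (metis atMost_iff le_add_diff_inverse power_add)
      then show "cst (coeff Q j) * ((\<alpha> ^ n) ^ j * (\<beta> ^ m) ^ (J - j)) = cst (coeff Q j * c ^ j) * (\<beta> ^ m) ^ J"
        unfolding ab by (simp add: power_mult_distrib cst_mult cst_power algebra_simps)
    qed simp
    moreover have "poly Q c = (\<Sum>j\<le>J. coeff Q j * c ^ j)" using Q(2) by (rule poly_altdef_le)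
    ultimately show ?thesis by (simp only: cst_sum sum_distrib_right)
  qed
  moreover have "hpoly J Q (\<alpha> ^ n) (\<beta> ^ m) = 0" using 0 ab by (simp add: Q ev_simps ev_hpoly)
  ultimately have "poly Q c = 0" using ab by simp
  then obtain Q1 where Q1: "Q = [:- c, 1:] * Q1" by (auto simp: poly_eq_0_iff_dvd)
  then have "Q1 \<noteq> 0" using Q(1) by auto
  then have "degree Q = Suc (degree Q1)" by (simp add: Q1 degree_mult_eq del: mult_pCons_left)
  then obtain J' where "J = Suc J'" "degree Q1 \<le> J'" using Q(2) by (metis Suc_le_D Suc_le_mono)
  then show ?thesis by (simp add: Q Q1 hpoly_root del: mult_pCons_left)
qed simp

text \<open>
  For suitable \<open>e\<close> the derivation \<open>dtop w e\<close> is nonzero and locally nilpotent. It maps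
  \<open>p = x\<^sup>n - c y\<^sup>m\<close> to a multiple of \<open>p\<close>, hence to \<open>0\<close>, so \<open>y\<^sup>m\<^sup>-\<^sup>1\<close> divides the image of \<open>x\<close>
  and \<open>x\<^sup>n\<^sup>-\<^sup>1\<close> divides the image of \<open>y\<close>; comparing degrees excludes \<open>m, n \<ge> 2\<close>.
\<close>

lemma deg_dvd_aux:
  assumes m: "deg pX = g * m" and n: "deg pY = g * n"
    and pos: "g > 0" "m > 0" "n > 0" and co: "coprime m n"
    and c: "c \<noteq> 0" "lc (g * m) pX ^ n = cst c * lc (g * n) pY ^ m"
  shows "m = 1 \<or> n = 1"
proof (rule ccontr)
  assume "\<not> (m = 1 \<or> n = 1)"
  then have mn: "m \<ge> 2" "n \<ge> 2" using pos by auto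
  let ?w = "bw (g * m) (g * n)"
  define \<alpha> \<beta> where "\<alpha> = lc (g * m) pX" and "\<beta> = lc (g * n) pY"
  note vnz = var_neq_0
  have nz: "\<alpha> \<noteq> 0" "\<beta> \<noteq> 0"
    using lc_deg_nz[OF vnz, of False] lc_deg_nz[OF vnz, of True] by (simp_all add: \<alpha>_def \<beta>_def m n)
  have nil: "(d ^^ Suc (?w b)) (var b) = 0" for b
    using deg_nil[of "var b"] by (cases b) (simp_all add: m n)
  have lcev: "(\<lambda>b. lc (?w b) (var b)) = bw \<alpha> \<beta>"
    by (auto simp: bw_def \<alpha>_def \<beta>_def)
  have hd: "(d ^^ Suc N) f = 0" "lc N f = ev (bw \<alpha> \<beta>) (hcomp ?w (int N) f)"
    if "hdeg ?w (int N) f" for N f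
    using lc_hcomp[OF nil that] by (simp_all only: lcev)
  have dnz: "d (var b) \<noteq> 0" for b
    using deg_eq_0_iff[of "var b"] m n pos by (cases b) auto
  \<comment> \<open>The largest weight shift that \<open>d\<close> has on a variable: it bounds
    \<open>d\<close> everywhere, and a variable attaining it has a nonzero image under
    \<open>dtop\<close>.\<close>
  define e where "e = max (tdeg ?w (d pX) - int (g * m)) (tdeg ?w (d pY) - int (g * n))"
  have he: "hdeg ?w (int (?w b) + e) (d (var b))" for b
  proof -
    have "tdeg ?w (d (var b)) \<le> int (?w b) + e" by (cases b) (auto simp: e_def)
    then show ?thesis using hdeg_mono[OF hdeg_tdeg] by blast
  qed
  have emax: "\<exists>b. hcomp ?w (int (?w b) + e) (d (var b)) \<noteq> 0"
  proof -
    have "\<exists>b. tdeg ?w (d (var b)) = int (?w b) + e"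
    proof (cases "e = tdeg ?w (d pX) - int (g * m)")
      case True
      then show ?thesis by (intro exI[of _ False]) simp
    next
      case False
      then show ?thesis by (intro exI[of _ True]) (auto simp: e_def max_def split: if_splits)
    qed
    then show ?thesis using hcomp_tdeg_nz[OF dnz] by metis
  qed
  \<comment> \<open>Otherwise \<open>d pX\<close> would have weight, hence degree, at most
    \<open>g * m - 2\<close>, but its degree is \<open>g * m - 1\<close>.\<close>
  have e1: "e \<ge> -1"
  proof (rule ccontr)
    assume "\<not> e \<ge> -1"
    then have h: "hdeg ?w (int (g * m) - 2) (d pX)" using he[of False] hdeg_mono by fastforce
    have "\<not> int (g * m) - 2 < 0" using hdeg_negD[OF h] dnz[of False] by blast
    then have "g * m \<ge> 2" by (simp del: of_nat_mult)
    then obtain k where k: "g * m = Suc (Suc k)" by (metis add_2_eq_Suc le_Suc_ex)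
    then have "(d ^^ Suc k) (d pX) = 0" using hd(1)[of k "d pX"] h by simp
    then have "(d ^^ (g * m)) pX = 0" by (simp add: k funpow_swap1)
    then show False using deg_top[OF vnz, of False] m by simp
  qed
  interpret t: lnd_mp "dtop ?w e" by (rule lnd_dtop) (rule he)
  let ?t = "dtop ?w e"
  have tv: "?t (var b) = hcomp ?w (int (?w b) + e) (d (var b))" for b
    by (rule dtop_homog) (rule homog_var)
  define p where "p = pX ^ n - cst c * pY ^ m"
  have hp: "homog ?w (int (g * m * n)) p"
    unfolding p_def
    using homog_power[OF homog_var[of ?w False], of n] homog_power[OF homog_var[of ?w True], of m]
    by (intro homog_diff homog_cst_mult) (simp_all add: algebra_simps)
  obtain K where K: "g * m * n = Suc K" using pos by (metis gr0_implies_Suc nat_0_less_mult_iff)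
  then have KK: "int (g * m * n) = int K + 1" by (simp del: of_nat_mult)
  \<comment> \<open>The form \<open>p\<close> vanishes at the leading coefficients, so its degree is
    below its weight \<open>Suc K\<close>.\<close>
  have "lc (Suc K) p = ev (bw \<alpha> \<beta>) p"
    using hd(2)[of "Suc K" p] hp hcomp_homog[OF hp] homog_imp_hdeg[OF hp] by (simp only: K) simp
  also have "\<dots> = 0" using c by (simp add: p_def ev_simps \<alpha>_def \<beta>_def)
  finally have "(d ^^ K) (d p) = 0" by (simp add: lc_eq_0_iff funpow_swap1)
  have tp: "?t p = hcomp ?w (int K + 1 + e) (d p)"
    using dtop_homog[OF hp] by (simp only: KK)
  \<comment> \<open>By \<open>e \<ge> -1\<close> the weight \<open>L\<close> of \<open>?t p\<close>
    is at least \<open>K\<close>, while \<open>d p\<close> is killed by the \<open>K\<close>-th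
    power of \<open>d\<close>. So the top form \<open>?t p\<close> of \<open>d p\<close> vanishes at
    the leading coefficients, and \<open>homog_dvd\<close> applies.\<close>
  have "0 \<le> int K + 1 + e" using e1 by linarith
  then obtain L where L1: "int K + 1 + e = int L" by (metis nonneg_int_cases)
  then have L: "int K + 1 + e = int L" "K \<le> L" using e1 by linarith+
  have "hdeg ?w (int L) (d p)"
    using hdeg_raise[OF he homog_imp_hdeg[OF hp]] by (simp only: KK L)
  from hd(2)[OF this] have "ev (bw \<alpha> \<beta>) (?t p) = lc L (d p)" by (simp add: tp L)
  also have "\<dots> = 0" using funpow_mono[OF \<open>(d ^^ K) (d p) = 0\<close> L(2)] by (simp add: lc_eq_0_iff)
  finally have "p dvd ?t p"
    unfolding p_def
    using homog_dvd[OF _ pos co _ nz, of "int L" "?t p" c] c tp homog_hcomp L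
    by (metis \<alpha>_def \<beta>_def p_def)
  then have tp0: "?t p = 0" by (rule t.dvd_self)
  have rel: "of_nat n * pX ^ (n - 1) * ?t pX = cst c * (of_nat m * pY ^ (m - 1) * ?t pY)"
    using tp0 by (simp add: p_def t.d_diff t.d_cst_mult t.d_power)
  have onz: "of_nat n \<noteq> (0 :: (bool,'k) mp)" "of_nat m \<noteq> (0 :: (bool,'k) mp)" using pos by simp_all
  have tnz: "?t pX \<noteq> 0" "?t pY \<noteq> 0"
  proof -
    have "?t pX \<noteq> 0 \<or> ?t pY \<noteq> 0" using emax by (metis (full_types) tv)
    moreover have "?t pX = 0 \<longleftrightarrow> ?t pY = 0" using rel onz c vnz by auto
    ultimately show "?t pX \<noteq> 0" "?t pY \<noteq> 0" by auto
  qed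
  have canc: "cst a * M = cst b * N \<Longrightarrow> a \<noteq> 0 \<Longrightarrow> N dvd M" for a b and M N :: "(bool, 'k) mp"
  proof -
    assume "cst a * M = cst b * N" "a \<noteq> 0"
    then have "M = cst (inverse a) * cst b * N" by (metis cst_inverse mult.assoc mult_1)
    then show "N dvd M" by simp
  qed
  have rel': "cst (of_nat n) * (pX ^ (n - 1) * ?t pX) = cst (c * of_nat m) * (pY ^ (m - 1) * ?t pY)"
    using rel by (simp add: cst_mult cst_of_nat mult.assoc)
  have dv1: "pY ^ (m - 1) dvd ?t pX"
    by (rule var_dvd_mult_var[of True False _ "n - 1"], simp)
      (use canc[OF rel'] pos dvd_mult_left in auto)
  have dv2: "pX ^ (n - 1) dvd ?t pY"
    by (rule var_dvd_mult_var[of False True _ "m - 1"], simp)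
      (use canc[OF rel'[symmetric]] pos c dvd_mult_left in auto)
  have "(m - 1) * t.deg pY \<le> t.deg (?t pX)"
    using dv1 tnz vnz by (auto elim!: dvdE simp: t.deg_mult t.deg_power)
  moreover have "(n - 1) * t.deg pX \<le> t.deg (?t pY)"
    using dv2 tnz vnz by (auto elim!: dvdE simp: t.deg_mult t.deg_power)
  moreover have "t.deg pY \<le> (m - 1) * t.deg pY" "t.deg pX \<le> (n - 1) * t.deg pX" using mn by auto
  moreover have "Suc (t.deg (?t pX)) = t.deg pX" "Suc (t.deg (?t pY)) = t.deg pY"
    using t.deg_d tnz by auto
  ultimately show False by linarith
qed

text \<open>One of the coprime parts of the two degrees is 1, and by the order of the degrees it is
  that of \<open>pY\<close>. The relation between the leading coefficients then reads
  \<open>\<alpha> = c \<beta>^m\<close>, so a multiple of \<open>pY ^ m\<close> cancels the top of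
  \<open>pX\<close>.\<close>

lemma reduce_step:
  assumes "deg pY > 0" "deg pY \<le> deg pX"
  shows "\<exists>c l. c \<noteq> 0 \<and> l * deg pY = deg pX \<and> (d ^^ deg pX) (pX - cst c * pY ^ l) = 0"
proof -
  define g where "g = gcd (deg pX) (deg pY)"
  define m n where "m = deg pX div g" and "n = deg pY div g"
  have g: "g > 0" using assms by (simp add: g_def)
  have mn: "deg pX = g * m" "deg pY = g * n" by (simp_all add: m_def n_def g_def)
  have pos: "m > 0" "n > 0" using mn assms by (auto intro: Nat.gr0I)
  have co: "coprime m n" using assms by (simp add: m_def n_def g_def div_gcd_coprime)
  obtain c where c: "c \<noteq> 0" "lc (g * m) pX ^ n = cst c * lc (g * n) pY ^ m"
    using leading_coeffs_dependent[OF mn g pos co] by blast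
  have "n \<le> m" using assms mn g by simp
  moreover have "m = 1 \<or> n = 1" by (rule deg_dvd_aux[OF mn g pos co c])
  ultimately have n1: "n = 1" using pos by auto
  have "lc (deg pX) (pX - cst c * pY ^ m) = 0"
    using lc_power[OF deg_nil, of m pY] c by (simp add: mn n1 lc_diff lc_cst_mult mult.commute)
  moreover have "m * deg pY = deg pX" by (simp add: mn n1)
  ultimately show ?thesis using c(1) by (auto simp: lc_eq_0_iff)
qed

end

section \<open>Coordinate pairs\<close>

text \<open>Stated as bijectivity of the substitution, since derivations are going to be conjugated
  by it.\<close>

definition coords :: "(bool, 'k::field) mp \<Rightarrow> (bool, 'k) mp \<Rightarrow> bool" where
  "coords g h \<longleftrightarrow> bij (ev (bw g h))"

definition upol :: "nat \<Rightarrow> (nat \<Rightarrow> 'k) \<Rightarrow> ('v::{finite,linorder}, 'k::field) mp \<Rightarrow> ('v, 'k) mp" where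
  "upol k c h = (\<Sum>i\<le>k. cst (c i) * h ^ i)"

lemma ev_upol: "ev u (upol k c h) = upol k c (ev u h)"
  by (simp add: upol_def ev_simps)

lemma upol_uminus: "upol k (\<lambda>i. - c i) h = - upol k c h"
  by (simp add: upol_def cst_uminus sum_negf)

lemma upol_single: "upol k (\<lambda>i. if i = k then c else 0) h = cst c * h ^ k"
proof -
  have "upol k (\<lambda>i. if i = k then c else 0) h = (\<Sum>i\<le>k. if i = k then cst c * h ^ i else 0)"
    unfolding upol_def by (rule sum.cong) auto
  then show ?thesis by simp
qed

lemma upol_add: "upol k (\<lambda>i. c i + e i) h = upol k c h + upol k e h"
  by (simp add: upol_def cst_add algebra_simps sum.distrib)

lemma upol_extend: "k \<le> l \<Longrightarrow> upol l (\<lambda>i. if i \<le> k then c i else 0) h = upol k c h"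
  unfolding upol_def by (rule sum.mono_neutral_cong_right) auto

lemma bw_comp: "(\<lambda>v. f (bw a b v)) = bw (f a) (f b)"
  by (auto simp: bw_def)

lemma ev_bw_ev: "ev u (ev (bw a b) f) = ev (bw (ev u a) (ev u b)) f"
  by (simp only: ev_ev bw_comp)

lemma bw_pX_pY: "bw pX pY = var"
proof
  show "bw pX pY v = var v" for v by (cases v) simp_all
qed

lemma coords_std: "coords (pX :: (bool, 'k::field) mp) pY"
proof -
  have "ev (bw pX pY) = (id :: (bool, 'k) mp \<Rightarrow> (bool, 'k) mp)" by (auto simp: bw_pX_pY)
  then show ?thesis by (simp only: coords_def bij_id)
qed

lemma coords_swap:
  assumes "coords g h" shows "coords h g"
proof -
  let ?s = "ev (bw pY pX) :: (bool, 'a) mp \<Rightarrow> _"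
  have "?s \<circ> ?s = id" by (auto simp: ev_bw_ev bw_pX_pY)
  then have "bij ?s" using o_bij by blast
  moreover have "ev (bw h g) = ev (bw g h) \<circ> ?s" by (auto simp: ev_bw_ev)
  ultimately show ?thesis using assms by (simp add: coords_def bij_comp)
qed

lemma coords_shear:
  assumes "coords g h" shows "coords (g - upol k c h) h"
proof -
  let ?s = "\<lambda>c. ev (bw (pX - upol k c pY) pY) :: (bool, 'a) mp \<Rightarrow> _"
  have i: "?s c \<circ> ?s (\<lambda>i. - c i) = id" for c
    by (auto simp: ev_bw_ev ev_simps ev_upol upol_uminus bw_pX_pY)
  then have "bij (?s c)" using o_bij[OF i[of "\<lambda>i. - c i"], simplified] i[of c] o_bij by fastforce
  moreover have "ev (bw (g - upol k c h) h) = ev (bw g h) \<circ> ?s c"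
    by (auto simp: ev_bw_ev ev_simps ev_upol)
  ultimately show ?thesis using assms by (simp add: coords_def bij_comp)
qed

context lnd2
begin

text \<open>Conjugating \<open>d\<close> by the substitution carries \<open>(g, h)\<close> to
  \<open>(pX, pY)\<close> and preserves degrees.\<close>

lemma reduce_coords:
  assumes co: "coords g h" and h: "deg h > 0" "deg h \<le> deg g"
  shows "\<exists>c l. c \<noteq> 0 \<and> l * deg h = deg g \<and> (d ^^ deg g) (g - cst c * h ^ l) = 0"
proof -
  define \<Phi> \<Psi> where "\<Phi> = ev (bw g h)" and "\<Psi> = inv \<Phi>"
  have b: "bij \<Phi>" using co by (simp add: coords_def \<Phi>_def)
  have \<Phi>\<Psi>: "\<Phi> (\<Psi> a) = a" and \<Psi>\<Phi>: "\<Psi> (\<Phi> a) = a" for a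
    using b by (simp_all add: \<Psi>_def bij_is_surj surj_f_inv_f bij_is_inj)
  have inj: "\<Phi> a = \<Phi> a' \<Longrightarrow> a = a'" for a a' by (metis \<Psi>\<Phi>)
  define t where "t a = \<Psi> (d (\<Phi> a))" for a
  have \<Phi>t: "\<Phi> (t a) = d (\<Phi> a)" for a by (simp add: t_def \<Phi>\<Psi>)
  have \<Phi>s: "\<Phi> (a + a') = \<Phi> a + \<Phi> a'" "\<Phi> (a * a') = \<Phi> a * \<Phi> a'" "\<Phi> (cst c) = cst c" "\<Phi> 0 = 0" for a a' c
    by (simp_all add: \<Phi>_def ev_simps)
  have \<Phi>p: "\<Phi> ((t ^^ n) a) = (d ^^ n) (\<Phi> a)" for n a
    by (induction n) (simp_all add: \<Phi>t)
  interpret t: lnd2 t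
  proof
    show "t (a + a') = t a + t a'" for a a' by (rule inj) (simp add: \<Phi>t \<Phi>s d_add)
    show "t (a * a') = t a * a' + a * t a'" for a a' by (rule inj) (simp add: \<Phi>t \<Phi>s d_mult)
    show "t (cst c) = 0" for c by (rule inj) (simp add: \<Phi>t \<Phi>s)
    show "\<exists>n. (t ^^ n) a = 0" for a
      using nilp[of "\<Phi> a"] by (metis \<Phi>p \<Phi>s(4) inj)
  qed
  have z: "(t ^^ n) a = 0 \<longleftrightarrow> (d ^^ n) (\<Phi> a) = 0" for n a by (metis \<Phi>p \<Phi>s(4) inj)
  have dg: "t.deg a = deg (\<Phi> a)" for a unfolding t.deg_def deg_def z ..
  have XY: "\<Phi> pX = g" "\<Phi> pY = h" by (simp_all add: \<Phi>_def)
  obtain c l where "c \<noteq> 0" "l * t.deg pY = t.deg pX" "(t ^^ t.deg pX) (pX - cst c * pY ^ l) = 0"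
    using t.reduce_step h by (auto simp: dg XY)
  moreover have "\<Phi> (pX - cst c * pY ^ l) = g - cst c * h ^ l"
    by (simp add: \<Phi>_def ev_simps)
  ultimately show ?thesis by (auto simp: z dg XY)
qed

text \<open>Monomials in \<open>h\<close> are subtracted until the degree falls below
  \<open>deg h\<close>. Their exponents decrease strictly, so the first one fixes both
  \<open>k\<close> and the nonzero top coefficient.\<close>

lemma euclid_step:
  assumes "coords g h" "deg h > 0"
  shows "\<exists>k c. deg (g - upol k c h) < deg h \<and> (deg h \<le> deg g \<longrightarrow> k * deg h = deg g \<and> c k \<noteq> 0)"
  using assms(1)
proof (induction "deg g" arbitrary: g rule: less_induct)
  case less
  show ?case
  proof (cases "deg h \<le> deg g")
    case False
    have "upol 0 (\<lambda>_. 0) h = 0" by (simp add: upol_def)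
    then have "deg (g - upol 0 (\<lambda>_. 0) h) < deg h" using False by simp
    then show ?thesis using False by blast
  next
    case True
    obtain c l where cl: "c \<noteq> 0" "l * deg h = deg g" "(d ^^ deg g) (g - cst c * h ^ l) = 0"
      using reduce_coords[OF less.prems assms(2) True] by blast
    define e where "e = (\<lambda>i. if i = l then c else 0)"
    define g1 where "g1 = g - upol l e h"
    have co1: "coords g1 h" unfolding g1_def by (rule coords_shear[OF less.prems])
    have lt: "deg g1 < deg g"
      using cl(3) True assms(2) by (simp add: deg_less_iff g1_def e_def upol_single)
    obtain k1 c1 where k1: "deg (g1 - upol k1 c1 h) < deg h"
        "deg h \<le> deg g1 \<longrightarrow> k1 * deg h = deg g1 \<and> c1 k1 \<noteq> 0"
      using less.hyps[OF lt co1] by blast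
    show ?thesis
    proof (cases "deg h \<le> deg g1")
      case False
      then have "deg (g - upol l e h) < deg h" by (simp add: g1_def)
      moreover have "e l \<noteq> 0" using cl by (simp add: e_def)
      ultimately show ?thesis using cl(2) by blast
    next
      case T1: True
      then have "k1 * deg h < l * deg h" using k1 lt cl by simp
      then have kl: "k1 < l" by simp
      define c' where "c' i = e i + (if i \<le> k1 then c1 i else 0)" for i
      have "upol l c' h = upol l e h + upol k1 c1 h"
        using kl by (simp add: c'_def[abs_def] upol_add upol_extend)
      then have "deg (g - upol l c' h) < deg h" using k1 by (simp add: g1_def algebra_simps)
      moreover have "c' l \<noteq> 0" using kl cl by (simp add: c'_def e_def)
      ultimately show ?thesis using cl(2) by blast
    qed
  qed
qed

end

section \<open>Total degrees along the Euclidean algorithm\<close>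

definition w1 :: "'v \<Rightarrow> nat" where "w1 = (\<lambda>_. 1)"

lemma int_w1 [simp]: "int (w1 v) = 1" by (simp add: w1_def)

abbreviation td :: "('v::{finite,linorder}, 'k::field) mp \<Rightarrow> int" where
  "td \<equiv> tdeg w1"

lemma tdeg_add_eq:
  assumes "b \<noteq> 0" "a = 0 \<or> tdeg w a < tdeg w b" shows "tdeg w (a + b) = tdeg w b"
proof (cases "a = 0")
  case False
  then have l: "tdeg w a < tdeg w b" using assms by simp
  have ha: "hdeg w (tdeg w b) a" using hdeg_mono[OF hdeg_tdeg less_imp_le[OF l]] .
  show ?thesis
    by (rule tdeg_unique)
      (use hdeg_add[OF ha hdeg_tdeg] hdeg_hcomp_eq_0[OF hdeg_tdeg l] hcomp_tdeg_nz[OF assms(1)]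
        in \<open>simp_all add: hcomp_add\<close>)
qed simp

lemma tdeg_uminus [simp]: "tdeg w (- a) = tdeg w a"
  by (simp add: tdeg_def)

lemma tdeg_cst [simp]: "c \<noteq> 0 \<Longrightarrow> tdeg w (cst c) = 0"
  by (rule tdeg_unique) (simp_all add: homog_imp_hdeg hcomp_homog[OF homog_cst])

lemma tdeg_var [simp]: "tdeg w (var v) = int (w v)"
  by (rule tdeg_unique) (simp_all add: homog_imp_hdeg homog_var hcomp_homog[OF homog_var])

text \<open>The powers of \<open>h\<close> have strictly increasing degrees, so the last term
  dominates.\<close>

lemma tdeg_upol:
  assumes "c k \<noteq> 0" "h \<noteq> 0" "tdeg w h \<ge> 1"
  shows "upol k c h \<noteq> 0 \<and> tdeg w (upol k c h) = int k * tdeg w h"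
proof -
  define b where "b = cst (c k) * h ^ k"
  define a where "a = (\<Sum>i<k. cst (c i) * h ^ i)"
  have eq: "upol k c h = a + b" by (simp add: upol_def a_def b_def lessThan_Suc_atMost[symmetric])
  have b: "b \<noteq> 0" "tdeg w b = int k * tdeg w h"
    using assms by (simp_all add: b_def tdeg_mult tdeg_power)
  have "hdeg w (int k * tdeg w h - 1) a"
    unfolding a_def
  proof (rule hdeg_sum)
    fix i assume "i \<in> {..<k}"
    then have "(int i + 1) * tdeg w h \<le> int k * tdeg w h" using assms by (intro mult_right_mono) auto
    then have "int i * tdeg w h \<le> int k * tdeg w h - 1" using assms by (simp add: algebra_simps)
    then show "hdeg w (int k * tdeg w h - 1) (cst (c i) * h ^ i)"
      using hdeg_mono[OF hdeg_cst_mult[OF hdeg_power[OF hdeg_tdeg]]] by blast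
  qed
  then have "a = 0 \<or> tdeg w a < tdeg w b" using b by (cases "a = 0") (auto simp: hdeg_iff_tdeg)
  then have t: "tdeg w (a + b) = tdeg w b" using b by (intro tdeg_add_eq)
  moreover have "a + b \<noteq> 0" using \<open>a = 0 \<or> tdeg w a < tdeg w b\<close> b
    by (metis add.inverse_unique add_0 less_irrefl minus_unique neg_equal_0_iff_equal tdeg_uminus)
  ultimately show ?thesis by (simp add: eq b)
qed

context kder
begin

lemma d_upol:
  assumes "k > 0"
  shows "d (upol k c h) = upol (k - 1) (\<lambda>i. of_nat (Suc i) * c (Suc i)) h * d h"
proof -
  obtain j where k: "k = Suc j" using assms gr0_implies_Suc by blast
  have "d (upol k c h) = (\<Sum>i\<le>Suc j. cst (c i) * (of_nat i * h ^ (i - 1) * d h))"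
    by (simp only: k upol_def d_sum d_cst_mult d_power)
  also have "\<dots> = (\<Sum>i\<le>j. cst (c (Suc i)) * (of_nat (Suc i) * h ^ i * d h))"
    by (subst sum.atMost_Suc_shift) simp
  also have "\<dots> = upol j (\<lambda>i. of_nat (Suc i) * c (Suc i)) h * d h"
    unfolding upol_def sum_distrib_right cst_mult cst_of_nat by (simp only: mult_ac)
  finally show ?thesis by (simp add: k)
qed

end

text \<open>The assumption is the form in which irreducibility of \<open>D\<close> reaches the
  plane: when \<open>d f = 0\<close>, all values of \<open>d\<close> are multiples of
  \<open>d s\<close>.\<close>

locale lnd2_irr = lnd2 +
  assumes irr: "coords f s \<Longrightarrow> d f = 0 \<Longrightarrow> \<exists>c. d s = cst c"
begin

text \<open>
  Along the Euclidean algorithm the total degree of \<open>d g\<close> is determined by \<open>deg g\<close>; for linear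
  coordinates this links \<open>deg g\<close> to the degree of \<open>d\<close>.
\<close>

lemma tdeg_derivative:
  assumes "coords g h" "deg h < deg g" "td g \<le> td h" "td h \<ge> 1" "h \<noteq> 0"
  shows "td (d g) = td h * (int (deg g) - 1) \<and> (d h = 0 \<or> td (d h) < td (d g))"
  using assms
proof (induction "deg h" arbitrary: g h rule: less_induct)
  case less
  show ?case
  proof (cases "deg h = 0")
    \<comment> \<open>Base case: \<open>d g\<close> is a nonzero constant and
      \<open>deg g = 1\<close>, so both sides are zero.\<close>
    case True
    then have "d h = 0" by (simp add: deg_eq_0_iff)
    then obtain c where c: "d g = cst c" using irr[OF coords_swap[OF less.prems(1)]] by blast
    have "d g \<noteq> 0" using less.prems True by (auto simp: deg_eq_0_iff[symmetric])
    then have "deg g = 1" "c \<noteq> 0" using deg_d[of g] c by auto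
    then show ?thesis using c \<open>d h = 0\<close> by simp
  next
    case False
    then have h0: "deg h > 0" by simp
    obtain k c where kc: "deg (g - upol k c h) < deg h" "k * deg h = deg g" "c k \<noteq> 0"
      using euclid_step[OF less.prems(1) h0] less.prems(2) by auto
    have k2: "k \<ge> 2"
    proof (rule ccontr)
      assume "\<not> k \<ge> 2"
      then have "k = 0 \<or> k = 1" by auto
      then show False using kc less.prems(2) h0 by auto
    qed
    define g' where "g' = g - upol k c h"
    define T where "T = td h"
    have T1: "T \<ge> 1" using less.prems by (simp add: T_def)
    have up: "upol k c h \<noteq> 0" "td (upol k c h) = int k * T"
      using tdeg_upol[of c k h w1] kc less.prems by (auto simp: T_def)
    have kT: "int k * T \<ge> 2 * T" using k2 T1 by (intro mult_right_mono) auto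
    then have gT: "td g < int k * T" using less.prems(3) T1 unfolding T_def by linarith
    have tg': "td g' = int k * T" "g' \<noteq> 0"
    proof -
      have "td (g + - upol k c h) = td (- upol k c h)"
        using gT up by (intro tdeg_add_eq) (simp_all del: One_nat_def)
      then show "td g' = int k * T" using up by (simp add: g'_def)
      show "g' \<noteq> 0"
      proof
        assume "g' = 0"
        then have "g = upol k c h" by (simp add: g'_def)
        then show False using gT up by simp
      qed
    qed
    have co': "coords h g'" unfolding g'_def by (rule coords_swap[OF coords_shear[OF less.prems(1)]])
    have dg'h: "deg g' < deg h" using kc by (simp add: g'_def)
    \<comment> \<open>Subtracting a polynomial of degree \<open>k \<ge> 2\<close> in
      \<open>h\<close> lifts the total degree to \<open>k\<close> times that of \<open>h\<close>, so
      the pair \<open>(h, g')\<close> meets the hypotheses again.\<close>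
    have "td h \<le> td g'" "td g' \<ge> 1" using tg'(1) kT T1 unfolding T_def by linarith+
    from less.hyps[OF dg'h co' dg'h this tg'(2)]
    have IH: "td (d h) = int k * T * (int (deg h) - 1)" "d g' = 0 \<or> td (d g') < td (d h)"
      using tg' by auto
    \<comment> \<open>By the chain rule \<open>P * d h\<close> is the derivative of the subtracted
      polynomial. It dominates \<open>d g'\<close>, so the total degree is
      \<open>(k - 1) T + k T (deg h - 1) = T (k deg h - 1)\<close>.\<close>
    define P where "P = upol (k - 1) (\<lambda>i. of_nat (Suc i) * c (Suc i)) h"
    have "of_nat (Suc (k - 1)) * c (Suc (k - 1)) \<noteq> 0" using k2 kc by (simp del: of_nat_Suc)
    then have P: "P \<noteq> 0" "td P = int (k - 1) * T"
      using tdeg_upol[of "\<lambda>i. of_nat (Suc i) * c (Suc i)" "k - 1" h w1] less.prems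
      unfolding P_def T_def by blast+
    have dh: "d h \<noteq> 0" using False by (simp add: deg_eq_0_iff)
    have dg: "d g = d g' + P * d h" using k2 by (simp add: g'_def d_diff d_upol P_def)
    have tP: "td (P * d h) = int (k - 1) * T + td (d h)" using P dh by (simp add: tdeg_mult)
    have "int (k - 1) * T \<ge> 0" using T1 by simp
    then have "d g' = 0 \<or> td (d g') < td (P * d h)" using IH(2) tP by linarith
    then have "td (d g) = td (P * d h)" unfolding dg using P dh by (intro tdeg_add_eq) auto
    moreover have kk: "int (k - 1) = int k - 1" using k2 by simp
    ultimately have t1: "td (d g) = (int k - 1) * T + td (d h)" using tP by simp
    then have "td (d g) = T * (int k * int (deg h) - 1)" unfolding t1 IH(1) by (simp add: algebra_simps)
    moreover have "int k * int (deg h) = int (deg g)" using kc(2) by (metis of_nat_mult)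
    moreover have "(int k - 1) * T > 0" using T1 k2 by simp
    ultimately show ?thesis using t1 unfolding T_def by (metis less_add_same_cancel2)
  qed
qed

end

section \<open>Dehomogenization\<close>

lemma hdeg_if_tdeg_less:
  assumes "f = 0 \<or> tdeg w f < j" "j \<le> i" shows "hdeg w i f"
proof (cases "f = 0")
  case False
  then have "tdeg w f \<le> i" using assms by linarith
  then show ?thesis by (rule hdeg_mono[OF hdeg_tdeg])
qed simp

lemma homog_ev:
  fixes u :: "'v::{finite,linorder} \<Rightarrow> ('w::{finite,linorder}, 'k::field) mp"
  assumes "\<And>v. homog w' (int (w v)) (u v)" "homog w i f" shows "homog w' i (ev u f)"
proof -
  have pr: "homog w' (\<Sum>v\<in>S. int (w v * g v)) (\<Prod>v\<in>S. u v ^ g v)" if "finite S" for S g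
    using that
  proof induction
    case (insert x S)
    have "homog w' (int (w x * g x)) (u x ^ g x)"
      using homog_power[OF assms(1)[of x], of "g x"] by (simp add: mult.commute)
    then show ?case using insert homog_mult by force
  qed simp
  have "ev u f = (\<Sum>m\<in>keys f. cst (lookup f m) * (\<Prod>v\<in>UNIV. u v ^ lookup m v))"
    by (simp add: ev_def lext_def)
  also have "homog w' i \<dots>"
  proof (intro homog_sum homog_cst_mult)
    fix m assume "m \<in> keys f"
    then have "i = (\<Sum>v\<in>UNIV. int (w v * lookup m v))" using assms(2) by (simp add: homog_def wd_def)
    then show "homog w' i (\<Prod>v\<in>UNIV. u v ^ lookup m v)" using pr[of UNIV "lookup m"] by simp
  qed
  finally show ?thesis .
qed

lemma hdeg_ev:
  fixes u :: "'v::{finite,linorder} \<Rightarrow> ('w::{finite,linorder}, 'k::field) mp"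
  assumes "\<And>v. hdeg w' (int (w v)) (u v)" "hdeg w i f" shows "hdeg w' i (ev u f)"
proof -
  have pr: "hdeg w' (\<Sum>v\<in>S. int (w v * g v)) (\<Prod>v\<in>S. u v ^ g v)" if "finite S" for S g
    using that
  proof induction
    case (insert x S)
    have "hdeg w' (int (w x * g x)) (u x ^ g x)"
      using hdeg_power[OF assms(1)[of x], of "g x"] by (simp add: mult.commute)
    then show ?case using insert hdeg_mult by force
  qed (simp add: homog_imp_hdeg)
  have "ev u f = (\<Sum>m\<in>keys f. cst (lookup f m) * (\<Prod>v\<in>UNIV. u v ^ lookup m v))"
    by (simp add: ev_def lext_def)
  also have "hdeg w' i \<dots>"
  proof (intro hdeg_sum hdeg_cst_mult)
    fix m assume "m \<in> keys f"
    then have "i \<ge> (\<Sum>v\<in>UNIV. int (w v * lookup m v))" using assms(2) by (simp add: hdeg_def wd_def)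
    then show "hdeg w' i (\<Prod>v\<in>UNIV. u v ^ lookup m v)"
      using hdeg_mono[OF pr[of UNIV "lookup m"]] by simp
  qed
  finally show ?thesis .
qed

abbreviation hom1 :: "int \<Rightarrow> ('v::{finite,linorder}, 'k::field) mp \<Rightarrow> bool" where
  "hom1 \<equiv> homog w1"

lemma hom1_var [simp]: "hom1 1 (var v)"
  using homog_var[of w1 v] by simp

lemma hom1_power: "hom1 1 f \<Longrightarrow> hom1 (int n) (f ^ n)"
  using homog_power[of w1 1 f n] by simp

lemma subalgebra_adjoin: "subalgebra (adjoin S)"
  unfolding adjoin_def by (rule hull_in) (fastforce simp: subalgebra_def)

lemma adjoin_superset: "S \<subseteq> adjoin S"
  unfolding adjoin_def by (rule hull_subset)

lemma adjoin_minimal: "subalgebra T \<Longrightarrow> S \<subseteq> T \<Longrightarrow> adjoin S \<subseteq> T"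
  unfolding adjoin_def by (rule hull_minimal)

lemma const_eq_cst: "const c = cst c" by (simp add: const_def cst_def)

lemma adjoin_closed:
  shows adjoin_add: "a \<in> adjoin S \<Longrightarrow> b \<in> adjoin S \<Longrightarrow> a + b \<in> adjoin S"
    and adjoin_mult: "a \<in> adjoin S \<Longrightarrow> b \<in> adjoin S \<Longrightarrow> a * b \<in> adjoin S"
    and adjoin_cst: "cst c \<in> adjoin S"
  using subalgebra_adjoin[of S] by (auto simp: subalgebra_def const_eq_cst)

lemma adjoin_power: "a \<in> adjoin S \<Longrightarrow> a ^ n \<in> adjoin S"
  using adjoin_cst[of 1 S] by (induction n) (auto intro: adjoin_mult)

lemma adjoin_sum: "(\<And>i. i \<in> I \<Longrightarrow> f i \<in> adjoin S) \<Longrightarrow> sum f I \<in> adjoin S"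
  using adjoin_cst[of 0 S] by (induction I rule: infinite_finite_induct) (auto intro: adjoin_add)

lemma adjoin_diff: "a \<in> adjoin S \<Longrightarrow> b \<in> adjoin S \<Longrightarrow> a - b \<in> adjoin S"
  using adjoin_add[OF _ adjoin_mult[OF adjoin_cst[of "-1"]], of a S b] by (simp add: cst_uminus)

lemma adjoin_vars: assumes "\<And>v. var v \<in> adjoin S" shows "adjoin S = UNIV"
proof -
  have "f \<in> adjoin S" for f
    by (induction f rule: mp_induct) (auto intro: assms adjoin_closed)
  then show ?thesis by blast
qed

text \<open>The names \<open>i0\<close>, \<open>i1\<close>, \<open>i2\<close> leave open which
  coefficient of \<open>X\<close> is nonzero; \<open>X\<close>, \<open>var i1\<close> and
  \<open>var i2\<close> generate \<open>B\<close>.\<close>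

locale homog_lnd = D: lnd_mp D for D :: "'k::field_char_0 poly3 \<Rightarrow> 'k poly3" +
  fixes e :: nat and c :: "indet \<Rightarrow> 'k" and i0 i1 i2 :: indet
  assumes hom_D: "hom1 i f \<Longrightarrow> hom1 (i + int e) (D f)"
    and irred: "(\<And>b. Q dvd D b) \<Longrightarrow> Q dvd 1"
    and ix: "i0 \<noteq> i1" "i0 \<noteq> i2" "i1 \<noteq> i2" "UNIV = {i0, i1, i2}"
    and c0: "c i0 \<noteq> 0"
    and DX0: "D (cst (c i0) * var i0 + cst (c i1) * var i1 + cst (c i2) * var i2) = 0"
begin

definition X :: "'k poly3" where
  "X = cst (c i0) * var i0 + cst (c i1) * var i1 + cst (c i2) * var i2"

lemma DX [simp]: "D X = 0" by (simp add: X_def DX0)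

lemma hom_X [simp]: "hom1 1 X"
  unfolding X_def by (intro homog_add homog_cst_mult hom1_var)

definition tri :: "'a \<Rightarrow> 'a \<Rightarrow> 'a \<Rightarrow> indet \<Rightarrow> 'a" where
  "tri a b b' v = (if v = i0 then a else if v = i1 then b else b')"

lemma tri_simps [simp]: "tri a b b' i0 = a" "tri a b b' i1 = b" "tri a b b' i2 = b'"
  using ix by (auto simp: tri_def)

lemma ix_cases: "v = i0 \<or> v = i1 \<or> v = i2"
  using ix(4) by auto

text \<open>The quotient map modulo \<open>X - 1\<close>: the equation \<open>X = 1\<close> is
  solved for \<open>var i0\<close>.\<close>

definition \<theta> :: "'k poly3 \<Rightarrow> (bool, 'k) mp" where
  "\<theta> = ev (tri (cst (inverse (c i0)) * (1 - cst (c i1) * pX - cst (c i2) * pY)) pX pY)"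

lemma \<theta>_simps: "\<theta> (a + b) = \<theta> a + \<theta> b" "\<theta> (a * b) = \<theta> a * \<theta> b" "\<theta> (a - b) = \<theta> a - \<theta> b"
  "\<theta> (a ^ n) = \<theta> a ^ n" "\<theta> (cst x) = cst x" "\<theta> 0 = 0" "\<theta> 1 = 1"
  "\<theta> (sum f I) = (\<Sum>i\<in>I. \<theta> (f i))"
  by (simp_all add: \<theta>_def ev_simps)

lemma \<theta>_var [simp]: "\<theta> (var i1) = pX" "\<theta> (var i2) = pY"
  by (simp_all add: \<theta>_def)

lemma \<theta>_X [simp]: "\<theta> X = 1"
proof -
  have "cst (c i0) * \<theta> (var i0) = (cst (c i0) * cst (inverse (c i0))) * (1 - cst (c i1) * pX - cst (c i2) * pY)"
    by (simp add: \<theta>_def mult.assoc)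
  also have "cst (c i0) * cst (inverse (c i0)) = (1 :: (bool, 'k) mp)"
    using c0 by (simp flip: cst_mult)
  finally show ?thesis by (simp add: X_def \<theta>_simps)
qed

lemma \<theta>_hdeg: "hom1 i f \<Longrightarrow> hdeg w1 i (\<theta> f)"
proof -
  assume f: "hom1 i f"
  have v: "hdeg w1 1 (var b :: (bool, 'k) mp)" for b by (simp add: homog_imp_hdeg)
  have o: "hdeg w1 1 (1 :: (bool, 'k) mp)"
    using hdeg_mono[OF homog_imp_hdeg[OF homog_1[of w1]], of 1] by simp
  have "hdeg w1 (int (w1 v)) (tri (cst (inverse (c i0)) * (1 - cst (c i1) * pX - cst (c i2) * pY)) pX pY v)" for v :: indet
    using ix_cases[of v] by (auto intro!: hdeg_cst_mult hdeg_diff v o)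
  then show ?thesis unfolding \<theta>_def by (rule hdeg_ev[OF _ homog_imp_hdeg[OF f]])
qed

text \<open>In coordinates containing \<open>X\<close>, setting \<open>X = 1\<close> forgets only
  the exponent of \<open>X\<close>, which the total degree restores; hence distinct terms do not
  collide.\<close>

lemma \<theta>_inj0:
  assumes f: "hom1 i f" and 0: "\<theta> f = 0" shows "f = 0"
proof -
  \<comment> \<open>\<open>?s\<close> rewrites a polynomial in the coordinates \<open>X\<close>,
    \<open>var i1\<close>, \<open>var i2\<close>, with \<open>var i0\<close> standing for
    \<open>X\<close>; \<open>?r\<close> undoes this and \<open>?o\<close> sets the first coordinate
    to 1.\<close>
  let ?s = "tri (cst (inverse (c i0)) * (var i0 - cst (c i1) * var i1 - cst (c i2) * var i2)) (var i1) (var i2)"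
  let ?r = "tri X (var i1) (var i2)"
  let ?o = "tri 1 pX pY"
  have "ev ?r (ev ?s f) = ev var f"
  proof -
    have "ev ?r (?s v) = var v" for v
    proof -
      have "cst (inverse (c i0)) * (cst (c i0) * var i0) = var i0"
        by (simp add: c0 flip: mult.assoc cst_mult)
      then show ?thesis using ix_cases[of v] by (auto simp: ev_simps X_def algebra_simps)
    qed
    then show ?thesis unfolding ev_ev by simp
  qed
  then have rs: "ev ?r (ev ?s f) = f" by simp
  have "ev ?o (?s v) = tri (cst (inverse (c i0)) * (1 - cst (c i1) * pX - cst (c i2) * pY)) pX pY v" for v
    using ix_cases[of v] by (auto simp: ev_simps)
  then have o0: "ev ?o (ev ?s f) = 0" using 0 by (simp add: ev_ev \<theta>_def)
  define g where "g = ev ?s f"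
  have hg: "hom1 i g" unfolding g_def
  proof (rule homog_ev[OF _ f])
    show "hom1 (int (w1 v)) (?s v)" for v
      using ix_cases[of v] by (auto intro!: homog_cst_mult homog_diff)
  qed
  have U: "(\<Sum>v\<in>UNIV. h v) = h i0 + h i1 + h i2" for h :: "indet \<Rightarrow> nat"
    by (simp only: ix(4)) (use ix(1-3) in \<open>simp add: add.assoc\<close>)
  have P: "(\<Prod>v\<in>UNIV. h v) = h i0 * h i1 * h i2" for h :: "indet \<Rightarrow> (bool, 'k) mp"
    by (simp only: ix(4)) (use ix(1-3) in \<open>simp add: mult.assoc\<close>)
  have oe: "ev ?o g = (\<Sum>m\<in>keys g. single (bexp (lookup m i1) (lookup m i2)) (lookup g m))"
    by (simp add: ev_def lext_def P single_bexp)
  have "lookup g m = 0" if m: "m \<in> keys g" for m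
  proof -
    have "m' = m" if "m' \<in> keys g" "bexp (lookup m' i1) (lookup m' i2) = bexp (lookup m i1) (lookup m i2)" for m'
    proof -
      have "wd w1 m = wd w1 m'" using hg m that by (simp add: homog_def)
      then have "lookup m i0 + lookup m i1 + lookup m i2 = lookup m' i0 + lookup m' i1 + lookup m' i2"
        by (simp only: wd_def U w1_def mult_1 of_nat_eq_iff)
      moreover have "lookup m' i1 = lookup m i1" "lookup m' i2 = lookup m i2"
        using that by (simp_all add: bexp_eq_iff)
      ultimately have "lookup m' v = lookup m v" for v using ix_cases[of v] by auto
      then show ?thesis by (rule poly_mapping_eqI)
    qed
    then have "lookup (ev ?o g) (bexp (lookup m i1) (lookup m i2)) = (\<Sum>m'\<in>keys g. if m' = m then lookup g m' else 0)"
      unfolding oe lookup_sum by (intro sum.cong) (auto simp: lookup_single when_def)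
    also have "\<dots> = lookup g m" using m by simp
    finally show ?thesis using o0 by (simp add: g_def)
  qed
  then have "g = 0" by (metis in_keys_iff poly_mapping_eqI lookup_zero)
  then show ?thesis using rs by (simp add: g_def)
qed

lemma \<theta>_inj: "hom1 i f \<Longrightarrow> hom1 i g \<Longrightarrow> \<theta> f = \<theta> g \<Longrightarrow> f = g"
  using \<theta>_inj0[of i "f - g"] by (simp add: homog_diff \<theta>_simps)

text \<open>If \<open>N\<close> is below the degree, the truncated exponent of \<open>X\<close>
  spoils homogeneity, but \<open>\<theta>\<close> still recovers \<open>f\<close>, because it maps
  \<open>X\<close> to 1.\<close>

definition homogenize :: "nat \<Rightarrow> (bool, 'k) mp \<Rightarrow> 'k poly3" where
  "homogenize N = lext (\<lambda>m x. cst x * (X ^ (N - (lookup m False + lookup m True))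
      * (var i1 ^ lookup m False * var i2 ^ lookup m True)))"

lemma \<theta>_homogenize: "\<theta> (homogenize N f) = f"
proof -
  have "\<theta> (homogenize N f) = (\<Sum>m\<in>keys f. single (bexp (lookup m False) (lookup m True)) (lookup f m))"
    by (simp add: homogenize_def lext_def \<theta>_simps single_bexp)
  then show ?thesis by (simp add: bexp_lookup flip: sum_singles)
qed

lemma hom_homogenize:
  assumes "hdeg w1 (int N) f" shows "hom1 (int N) (homogenize N f)"
  unfolding homogenize_def lext_def
proof (intro homog_sum homog_cst_mult)
  fix m assume "m \<in> keys f"
  then have "lookup m False + lookup m True \<le> N"
    using assms by (simp add: hdeg_def wd_def UNIV_bool w1_def add.commute del: of_nat_add)
  moreover have "hom1 (int (N - (lookup m False + lookup m True)) + (int (lookup m False) + int (lookup m True)))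
    (X ^ (N - (lookup m False + lookup m True)) * (var i1 ^ lookup m False * var i2 ^ lookup m True))"
    by (intro homog_mult hom1_power) simp_all
  ultimately show "hom1 (int N) (X ^ (N - (lookup m False + lookup m True)) * (var i1 ^ lookup m False * var i2 ^ lookup m True))"
    by simp
qed

definition \<iota> :: "(bool, 'k) mp \<Rightarrow> 'k poly3" where "\<iota> = ev (bw (var i1) (var i2))"

lemma \<theta>_\<iota> [simp]: "\<theta> (\<iota> b) = b"
  by (simp add: \<theta>_def \<iota>_def ev_bw_ev bw_pX_pY)

text \<open>As \<open>D\<close> kills \<open>X - 1\<close>, it descends to the quotient by this
  element, which is \<open>k[x,y]\<close>; \<open>\<iota>\<close> picks representatives.\<close>

definition \<delta> :: "(bool, 'k) mp \<Rightarrow> (bool, 'k) mp" where "\<delta> b = \<theta> (D (\<iota> b))"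

sublocale \<delta>: kder \<delta>
proof
  have \<iota>s: "\<iota> (a + b) = \<iota> a + \<iota> b" "\<iota> (a * b) = \<iota> a * \<iota> b" "\<iota> (cst x) = cst x" for a b x
    by (simp_all add: \<iota>_def ev_simps)
  show "\<delta> (a + b) = \<delta> a + \<delta> b" "\<delta> (a * b) = \<delta> a * b + a * \<delta> b" "\<delta> (cst x) = 0" for a b x
    by (simp_all add: \<delta>_def \<iota>s D.d_add D.d_mult \<theta>_simps)
qed

lemma \<theta>_D: "\<theta> (D b) = \<delta> (\<theta> b)"
proof (induction b rule: mp_induct)
  case (var v)
  have 12: "\<theta> (D (var i1)) = \<delta> pX" "\<theta> (D (var i2)) = \<delta> pY"
    by (simp_all add: \<delta>_def \<iota>_def)
  have "cst (c i0) * \<theta> (D (var i0)) = cst (c i0) * \<delta> (\<theta> (var i0))"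
  proof -
    have "\<theta> (D X) = \<delta> (\<theta> X)" using \<delta>.d_1 by (simp add: \<theta>_simps)
    then show ?thesis
      unfolding X_def by (simp add: D.d_add D.d_cst_mult \<delta>.d_add \<delta>.d_cst_mult \<theta>_simps 12)
  qed
  then have "\<theta> (D (var i0)) = \<delta> (\<theta> (var i0))" using c0 by simp
  then show ?case using ix_cases[of v] 12 by auto
qed (simp_all add: \<theta>_simps D.d_add D.d_mult \<delta>.d_add \<delta>.d_mult)

lemma \<theta>_D_funpow: "\<theta> ((D ^^ n) b) = (\<delta> ^^ n) (\<theta> b)"
  by (induction n) (simp_all add: \<theta>_D)

sublocale \<delta>: lnd2 \<delta>
proof
  show "\<exists>n. (\<delta> ^^ n) a = 0" for a
    using D.nilp[of "\<iota> a"] \<theta>_D_funpow[of _ "\<iota> a"] by (metis \<theta>_\<iota> \<theta>_simps(6))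
qed

lemma hom_D_funpow: "hom1 i f \<Longrightarrow> hom1 (i + int n * int e) ((D ^^ n) f)"
proof (induction n)
  case (Suc n)
  then show ?case using hom_D[of "i + int n * int e" "(D ^^ n) f"] by (simp add: algebra_simps)
qed simp

lemma dvd_D:
  assumes "Q dvd D (var i1)" "Q dvd D (var i2)" shows "Q dvd 1"
proof (rule irred)
  have eq: "cst (c i0) * D (var i0) = 0 - cst (c i1) * D (var i1) - cst (c i2) * D (var i2)"
  proof -
    have "cst (c i0) * D (var i0) + cst (c i1) * D (var i1) + cst (c i2) * D (var i2) = 0"
      using DX unfolding X_def by (simp only: D.d_add D.d_cst_mult)
    then show ?thesis by algebra
  qed
  have "D (var i0) = cst (inverse (c i0)) * (cst (c i0) * D (var i0))"
    by (simp add: c0 flip: mult.assoc cst_mult)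
  also have "Q dvd \<dots>" unfolding eq by (intro dvd_mult dvd_diff assms) simp
  finally have "Q dvd D (var i0)" .
  then have "Q dvd D (var v)" for v using assms ix_cases[of v] by auto
  then show "Q dvd D b" for b by (rule D.dvd_gen)
qed

lemma hom_DY: "hom1 (int (Suc e)) (D (var v))"
  using hom_D[OF hom1_var[of v]] by (simp add: add.commute)

lemma hdeg_\<delta>: "hdeg w1 (int (Suc e)) (\<delta> (var b))"
proof -
  have "hdeg w1 (int (Suc e)) (\<theta> (D (var i1)))" "hdeg w1 (int (Suc e)) (\<theta> (D (var i2)))"
    by (rule \<theta>_hdeg[OF hom_DY])+
  then show ?thesis by (cases b) (simp_all add: \<theta>_D)
qed

text \<open>Homogenize both factors and let powers of \<open>X\<close> make up the missing degree:
  the product and \<open>b\<close> are homogeneous of the same degree with equal images under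
  \<open>\<theta>\<close>.\<close>

lemma lift_factor:
  assumes b: "hom1 (int N) b" "\<theta> b = u * v" and "u \<noteq> 0"
  shows "homogenize (nat (td u)) u dvd b"
proof (cases "v = 0")
  case True
  then show ?thesis using \<theta>_inj0[OF b(1)] b by simp
next
  case False
  have "hdeg w1 (int N) (u * v)" using \<theta>_hdeg[OF b(1)] b by simp
  then have le: "td u + td v \<le> int N" using False assms(3) by (simp add: hdeg_iff_tdeg tdeg_mult)
  have pos: "td u \<ge> 0" "td v \<ge> 0" using False assms(3) by (auto intro: tdeg_nonneg)
  define M where "M = N - nat (td u)"
  have M: "int N = int (nat (td u)) + int M" "td v \<le> int M" using le pos by (auto simp: M_def)
  have "hom1 (int N) (homogenize (nat (td u)) u * homogenize M v)"
    unfolding M(1) using pos M by (intro homog_mult hom_homogenize) (auto intro: hdeg_mono[OF hdeg_tdeg] hdeg_tdeg)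
  then have "b = homogenize (nat (td u)) u * homogenize M v"
    by (rule \<theta>_inj[OF b(1)]) (simp add: \<theta>_simps \<theta>_homogenize b)
  then show ?thesis by simp
qed

text \<open>A common divisor homogenizes to a common divisor of the values of \<open>D\<close>,
  which is a unit by irreducibility; units have total degree zero.\<close>

lemma dvd_\<delta>:
  assumes "u \<noteq> 0" "u dvd \<delta> pX" "u dvd \<delta> pY" shows "\<exists>x. u = cst x"
proof -
  let ?Q = "homogenize (nat (td u)) u"
  have "?Q dvd D (var i1)" "?Q dvd D (var i2)"
    using assms by (auto elim!: dvdE intro!: lift_factor[OF hom_DY] simp: \<theta>_D)
  then have "?Q dvd 1" by (rule dvd_D)
  then obtain f where "1 = ?Q * f" by (rule dvdE)
  then have "\<theta> 1 = \<theta> (?Q * f)" by simp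
  then have v: "u * \<theta> f = 1" by (simp add: \<theta>_simps \<theta>_homogenize)
  define v where "v = \<theta> f"
  note v = v[folded v_def]
  then have "v \<noteq> 0" by auto
  then have "td u + td v = td (1 :: (bool, 'k) mp)" using assms v by (metis tdeg_mult)
  also have "\<dots> = 0" using tdeg_cst[of "1::'k" "w1 :: bool \<Rightarrow> nat"] by simp
  finally have "td u \<le> 0" using tdeg_nonneg[OF \<open>v \<noteq> 0\<close>, of w1] by simp
  then have "hdeg w1 0 u" using assms(1) by (simp add: hdeg_iff_tdeg)
  then show ?thesis by (intro hdeg_0_cst) (simp_all add: w1_def)
qed

sublocale \<delta>: lnd2_irr \<delta>
proof
  fix f s assume co: "coords f s" and f: "\<delta> f = 0"
  have "\<delta> s dvd \<delta> (ev (bw f s) a)" for a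
    by (rule \<delta>.dvd_ev) (auto simp: bw_def f)
  then have "\<delta> s dvd \<delta> b" for b
    using co by (metis coords_def bij_is_surj surj_def)
  then show "\<exists>x. \<delta> s = cst x" using dvd_\<delta> cst_0 by metis
qed

lemma \<delta>_nz: "\<delta> pX \<noteq> 0 \<or> \<delta> pY \<noteq> 0"
proof (rule ccontr)
  assume "\<not> ?thesis"
  then have "D (var i1) = 0" "D (var i2) = 0"
    using \<theta>_inj0[OF hom_DY[of i1]] \<theta>_inj0[OF hom_DY[of i2]] by (simp_all add: \<theta>_D)
  then show False using dvd_D[of 0] by simp
qed

text \<open>Otherwise \<open>D (var i1)\<close> and \<open>D (var i2)\<close>, of degree
  \<open>e + 1\<close>, would be \<open>X\<close> times homogenizations in degree \<open>e\<close>,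
  against irreducibility.\<close>

lemma not_both_hdeg: "\<not> (hdeg w1 (int e) (\<delta> pX) \<and> hdeg w1 (int e) (\<delta> pY))"
proof
  assume a: "hdeg w1 (int e) (\<delta> pX) \<and> hdeg w1 (int e) (\<delta> pY)"
  have "X dvd b" if b: "hom1 (int (Suc e)) b" "hdeg w1 (int e) (\<theta> b)" for b
  proof -
    have "hom1 (1 + int e) (X * homogenize e (\<theta> b))" by (intro homog_mult hom_homogenize b hom_X)
    then have "hom1 (int (Suc e)) (X * homogenize e (\<theta> b))" by simp
    then have "b = X * homogenize e (\<theta> b)" by (rule \<theta>_inj[OF b(1)]) (simp add: \<theta>_simps \<theta>_homogenize)
    then show ?thesis by (metis dvd_triv_left)
  qed
  then have "X dvd D (var i1)" "X dvd D (var i2)" using a hom_DY by (simp_all add: \<theta>_D del: of_nat_Suc)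
  then have "X dvd 1" by (rule dvd_D)
  then obtain f where "X * f = 1" by (metis dvdE)
  \<comment> \<open>Evaluation at the origin: \<open>X\<close> is not a unit.\<close>
  then have "ev (\<lambda>_. 0 :: 'k poly3) (X * f) = ev (\<lambda>_. 0 :: 'k poly3) 1" by simp
  then show False by (simp add: ev_simps X_def)
qed

text \<open>For linear coordinates \<open>tdeg_derivative\<close> says that the derivative of the
  one of larger degree, \<open>g\<close>, has total degree \<open>deg g - 1\<close> and that the
  other derivative has less. Homogeneity bounds this by \<open>e + 1\<close> and
  \<open>not_both_hdeg\<close> excludes smaller values.\<close>

lemma linear_pair:
  obtains Y1 Y2 where "hom1 1 Y1" "hom1 1 Y2" "adjoin {X, Y1, Y2} = UNIV"
    "coords (\<theta> Y2) (\<theta> Y1)" "\<delta>.deg (\<theta> Y1) < \<delta>.deg (\<theta> Y2)" "\<delta>.deg (\<theta> Y2) = e + 2"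
proof -
  note pair = that
  have adj: "adjoin S = UNIV" if "X \<in> adjoin S" "var i1 \<in> adjoin S" "var i2 \<in> adjoin S" for S
  proof (rule adjoin_vars)
    have "var i0 = cst (inverse (c i0)) * (X - cst (c i1) * var i1 - cst (c i2) * var i2)"
      by (simp add: X_def c0 flip: mult.assoc cst_mult)
    also have "\<dots> \<in> adjoin S" by (intro adjoin_mult adjoin_diff adjoin_cst that)
    finally have "var i0 \<in> adjoin S" .
    then show "var v \<in> adjoin S" for v using that ix_cases[of v] by auto
  qed
  have td: "td (\<delta> (var b)) \<le> int e + 1" if "\<delta> (var b) \<noteq> 0" for b
    using hdeg_\<delta>[of b] that by (simp add: hdeg_iff_tdeg)
  have strict: thesis if lt: "\<delta>.deg (var b') < \<delta>.deg (var b)" and co: "coords (var b :: (bool, 'k) mp) (var b')"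
      and Y: "Y1 \<in> {var i1, var i2}" "Y2 \<in> {var i1, var i2}" "\<theta> Y1 = var b'" "\<theta> Y2 = var b"
    for b b' Y1 Y2
  proof -
    have bb: "b \<noteq> b'"
    proof
      assume "b = b'"
      then show False using lt by (simp only: less_irrefl)
    qed
    have pre: "td (var b :: (bool, 'k) mp) \<le> td (var b' :: (bool, 'k) mp)" "td (var b' :: (bool, 'k) mp) \<ge> 1"
      by simp_all
    from \<delta>.tdeg_derivative[OF co lt pre var_neq_0, unfolded tdeg_var int_w1 mult_1]
    have t: "td (\<delta> (var b)) = int (\<delta>.deg (var b)) - 1" "\<delta> (var b') = 0 \<or> td (\<delta> (var b')) < td (\<delta> (var b))"
      by blast+
    have nz: "\<delta> (var b) \<noteq> 0" using lt by (auto simp: \<delta>.deg_eq_0_iff[symmetric])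
    have "\<not> td (\<delta> (var b)) \<le> int e"
    proof
      assume le: "td (\<delta> (var b)) \<le> int e"
      then have "hdeg w1 (int e) (\<delta> (var b))" using nz by (simp add: hdeg_iff_tdeg)
      moreover have "hdeg w1 (int e) (\<delta> (var b'))"
        using t(2) le by (rule hdeg_if_tdeg_less)
      ultimately show False using not_both_hdeg bb by (cases b; cases b') auto
    qed
    then have "\<delta>.deg (var b) = e + 2" using td[OF nz] t by linarith
    moreover have "Y1 \<noteq> Y2" using Y lt by (metis less_irrefl)
    then have "{Y1, Y2} = {var i1, var i2}" using Y by auto
    then have "{X, Y1, Y2} = {X, var i1, var i2}" by auto
    moreover have "adjoin {X, var i1, var i2} = UNIV"
      by (rule adj) (use adjoin_superset[of "{X, var i1, var i2}"] in auto)
    moreover have "hom1 1 Y1" "hom1 1 Y2" using Y by auto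
    ultimately show thesis using pair[of Y1 Y2] lt co Y by simp
  qed
  consider "\<delta>.deg pY < \<delta>.deg pX" | "\<delta>.deg pX < \<delta>.deg pY" | "\<delta>.deg pX = \<delta>.deg pY" by linarith
  then show thesis
  proof cases
    case 1
    show thesis by (rule strict[OF 1 coords_std, of "var i2" "var i1"]) simp_all
  next
    case 2
    show thesis by (rule strict[OF 2 coords_swap[OF coords_std], of "var i1" "var i2"]) simp_all
  next
    \<comment> \<open>For equal degrees a division step has quotient degree 1: a scalar multiple of
      \<open>pY\<close> is subtracted, and the pair stays linear.\<close>
    case eq: 3
    have "\<delta>.deg pY > 0" using \<delta>_nz eq by (auto simp flip: \<delta>.deg_eq_0_iff)
    from \<delta>.reduce_step[OF this] obtain x l where x: "l * \<delta>.deg pY = \<delta>.deg pX"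
      "(\<delta> ^^ \<delta>.deg pX) (pX - cst x * pY ^ l) = 0" using eq by auto
    then have "l = 1" using eq \<open>\<delta>.deg pY > 0\<close> by simp
    define a where "a = pX - cst x * pY"
    have lt: "\<delta>.deg a < \<delta>.deg pY"
      using x \<open>l = 1\<close> eq \<open>\<delta>.deg pY > 0\<close> by (simp add: a_def \<delta>.deg_less_iff)
    have "a = pX - upol 1 (\<lambda>i. if i = 1 then x else 0) pY" by (simp add: a_def upol_single)
    then have co: "coords pY a" using coords_swap[OF coords_shear[OF coords_std]] by simp
    have a0: "a \<noteq> 0" and ta: "td a = 1"
    proof -
      have "td (pX :: (bool,'k) mp) = 1" "td (pY :: (bool,'k) mp) = 1" by simp_all
      have h: "hom1 1 a" unfolding a_def by (intro homog_diff homog_cst_mult hom1_var)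
      show "a \<noteq> 0"
      proof
        assume "a = 0"
        then have "ev (bw 1 0) a = (0 :: (bool,'k) mp)" by simp
        then show False by (simp add: a_def ev_simps)
      qed
      then show "td a = 1" using h by (intro tdeg_unique) (simp_all add: homog_imp_hdeg hcomp_homog)
    qed
    have t: "td (\<delta> pY) = int (\<delta>.deg pY) - 1" "\<delta> a = 0 \<or> td (\<delta> a) < td (\<delta> pY)"
    proof -
      have "td (pY :: (bool, 'k) mp) \<le> td a" "td a \<ge> 1" by (simp_all add: ta)
      from \<delta>.tdeg_derivative[OF co lt this a0, unfolded ta mult_1]
      show "td (\<delta> pY) = int (\<delta>.deg pY) - 1" "\<delta> a = 0 \<or> td (\<delta> a) < td (\<delta> pY)"
        by blast+
    qed
    have nz: "\<delta> pY \<noteq> 0" using lt by (auto simp: \<delta>.deg_eq_0_iff[symmetric])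
    have "\<not> td (\<delta> pY) \<le> int e"
    proof
      assume le: "td (\<delta> pY) \<le> int e"
      then have hY: "hdeg w1 (int e) (\<delta> pY)" using nz by (simp add: hdeg_iff_tdeg)
      have "hdeg w1 (int e) (\<delta> a)"
        using t(2) le by (rule hdeg_if_tdeg_less)
      then have "hdeg w1 (int e) (\<delta> a + cst x * \<delta> pY)" using hY by (intro hdeg_add hdeg_cst_mult)
      also have "\<delta> a + cst x * \<delta> pY = \<delta> pX" by (simp add: a_def \<delta>.d_diff \<delta>.d_cst_mult)
      finally show False using hY not_both_hdeg by simp
    qed
    then have "\<delta>.deg pY = e + 2" using td[OF nz] t by linarith
    moreover define Y1 where "Y1 = var i1 - cst x * var i2"
    moreover have "adjoin {X, Y1, var i2} = UNIV"
    proof (rule adj)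
      have m: "X \<in> adjoin {X, Y1, var i2}" "Y1 \<in> adjoin {X, Y1, var i2}" "var i2 \<in> adjoin {X, Y1, var i2}"
        using adjoin_superset[of "{X, Y1, var i2}"] by auto
      have "var i1 = Y1 + cst x * var i2" by (simp add: Y1_def)
      also have "\<dots> \<in> adjoin {X, Y1, var i2}" using m by (intro adjoin_closed)
      finally show "var i1 \<in> adjoin {X, Y1, var i2}" .
      show "X \<in> adjoin {X, Y1, var i2}" "var i2 \<in> adjoin {X, Y1, var i2}" using m by auto
    qed
    moreover have "hom1 1 Y1" unfolding Y1_def by (intro homog_diff homog_cst_mult hom1_var)
    moreover have "\<theta> Y1 = a" by (simp add: Y1_def \<theta>_simps a_def)
    ultimately show thesis using that[of Y1 "var i2"] co lt by simp
  qed
qed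

end

section \<open>Image ideals\<close>

lemma is_ideal_principal:
  assumes A: "\<And>a b. a \<in> A \<Longrightarrow> b \<in> A \<Longrightarrow> a + b \<in> A" "\<And>a b. a \<in> A \<Longrightarrow> b \<in> A \<Longrightarrow> a * b \<in> A"
    "0 \<in> A" and x: "x \<in> A"
  shows "is_ideal A ((\<lambda>a. a * x) ` A)"
  unfolding is_ideal_def
proof (intro conjI ballI)
  show "(\<lambda>a. a * x) ` A \<subseteq> A" using A x by auto
  show "0 \<in> (\<lambda>a. a * x) ` A" using A(3) by (metis image_eqI mult_zero_left)
  fix y z assume y: "y \<in> (\<lambda>a. a * x) ` A"
  then obtain a where a: "a \<in> A" "y = a * x" by blast
  { assume "z \<in> (\<lambda>a. a * x) ` A"
    then obtain b where b: "b \<in> A" "z = b * x" by blast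
    then have "y + z = (a + b) * x" using a by (simp add: algebra_simps)
    then show "y + z \<in> (\<lambda>a. a * x) ` A" using A(1) a b by blast }
  { assume z: "z \<in> A"
    have "z * y = (z * a) * x" using a by (simp add: mult.assoc)
    then show "z * y \<in> (\<lambda>a. a * x) ` A" using A(2) a z by blast }
qed

lemma ideal_gen_principal:
  assumes A: "1 \<in> A" "\<And>a b. a \<in> A \<Longrightarrow> b \<in> A \<Longrightarrow> a + b \<in> A" "\<And>a b. a \<in> A \<Longrightarrow> b \<in> A \<Longrightarrow> a * b \<in> A"
    "0 \<in> A" and x: "x \<in> A"
  shows "ideal_gen A {x} = (\<lambda>a. a * x) ` A"
  unfolding ideal_gen_def
proof (rule hull_unique)
  show "{x} \<subseteq> (\<lambda>a. a * x) ` A" using A(1) by force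
  show "is_ideal A ((\<lambda>a. a * x) ` A)" by (rule is_ideal_principal[OF A(2-4) x])
  fix T assume "{x} \<subseteq> T" "is_ideal A T"
  then show "(\<lambda>a. a * x) ` A \<subseteq> T" by (auto simp: is_ideal_def)
qed

context lnd_mp
begin

lemma lc_upol:
  assumes "deg h > 0"
  shows "deg (upol k c h) \<le> k * deg h \<and> lc (k * deg h) (upol k c h) = cst (c k) * lc (deg h) h ^ k"
proof -
  have h: "h \<noteq> 0" using assms by auto
  have le: "deg (cst (c i) * h ^ i) \<le> i * deg h" for i
    using deg_cst_mult[of "c i" "h ^ i"] deg_power[OF h] by (cases "c i = 0") auto
  have "deg (cst (c i) * h ^ i) \<le> k * deg h" if "i \<le> k" for i
    using le[of i] that by (meson le_trans mult_le_mono1)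
  then have d: "deg (upol k c h) \<le> k * deg h" unfolding upol_def by (intro deg_sum_le) auto
  have z: "lc (k * deg h) (cst (c i) * h ^ i) = 0" if "i < k" for i
  proof -
    have "i * deg h < k * deg h" using that assms by simp
    then have "deg (cst (c i) * h ^ i) < k * deg h" using le[of i] by linarith
    then show ?thesis using that assms by (simp add: lc_eq_0_iff deg_less_iff)
  qed
  have "lc (k * deg h) (upol k c h) = (\<Sum>i\<le>k. lc (k * deg h) (cst (c i) * h ^ i))"
    by (simp add: upol_def lc_sum)
  also have "\<dots> = lc (k * deg h) (cst (c k) * h ^ k)"
    by (simp add: z lessThan_Suc_atMost[symmetric])
  also have "\<dots> = cst (c k) * lc (deg h) h ^ k"
    using lc_power[OF deg_nil, of k h] by (simp add: lc_cst_mult)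
  finally show ?thesis using d by blast
qed

text \<open>Each \<open>M i\<close> has degree exactly \<open>i\<close>, so the terms cannot cancel
  at the top. The hypothesis on the sum forces \<open>a i = 0\<close> for \<open>i > n\<close>, and
  \<open>d ^^ n\<close> kills the terms with \<open>i < n\<close>.\<close>

lemma image_of_filtration_basis:
  assumes nil: "\<And>i. (d ^^ Suc i) (M i) = 0" and top: "\<And>i. (d ^^ i) (M i) \<noteq> 0"
    and a: "\<And>i. d (a i) = 0" and z: "(d ^^ Suc n) (\<Sum>i<K. a i * M i) = 0"
  shows "\<exists>b. d b = 0 \<and> (d ^^ n) (\<Sum>i<K. a i * M i) = b * (d ^^ n) (M n)"
  using z
proof (induction K)
  case 0
  show ?case by (intro exI[of _ 0]) simp
next
  case (Suc K)
  have low: "(d ^^ m) (\<Sum>i<K. a i * M i) = 0" if "K \<le> m" for m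
  proof -
    have "(d ^^ m) (a i * M i) = 0" if "i < K" for i
      using funpow_mono[OF nil[of i], of m] that \<open>K \<le> m\<close> by (simp add: funpow_ker_mult[OF a])
    then show ?thesis by (simp add: funpow_sum)
  qed
  have S: "(\<Sum>i<Suc K. a i * M i) = (\<Sum>i<K. a i * M i) + a K * M K" by simp
  consider "K < n" | "K = n" | "K > n" by linarith
  then show ?case
  proof cases
    case 1
    then have "(d ^^ n) (M K) = 0" using funpow_mono[OF nil[of K], of n] by simp
    then have "(d ^^ n) (\<Sum>i<Suc K. a i * M i) = 0 * (d ^^ n) (M n)"
      using low[of n] 1 by (simp add: S funpow_add funpow_ker_mult[OF a])
    then show ?thesis by (intro exI[of _ 0]) simp
  next
    case 2
    then have "(d ^^ n) (\<Sum>i<Suc K. a i * M i) = a n * (d ^^ n) (M n)"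
      using low[of n] by (simp add: S funpow_add funpow_ker_mult[OF a])
    then show ?thesis using a by blast
  next
    case 3
    then have "(d ^^ K) (\<Sum>i<Suc K. a i * M i) = 0" using funpow_mono[OF Suc.prems] by simp
    then have "a K * (d ^^ K) (M K) = 0"
      using low[of K] by (simp add: S funpow_add funpow_ker_mult[OF a])
    then have "a K = 0" using top by simp
    then show ?thesis using Suc by simp
  qed
qed

end

context homog_lnd
begin

text \<open>The source of the powers of \<open>X\<close>: a homogeneous element whose image under
  \<open>\<theta>\<close> is constant is a scalar multiple of a power of \<open>X\<close>, and its
  degree gives the exponent.\<close>

lemma lift_lc:
  assumes b: "hom1 (int N) b" and dg: "\<delta>.deg (\<theta> b) \<le> n" and l: "\<delta>.lc n (\<theta> b) = cst x"
  shows "(D ^^ Suc n) b = 0" "D.lc n b = cst x * X ^ (N + n * e)"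
proof -
  show "(D ^^ Suc n) b = 0"
    using \<theta>_inj0[OF hom_D_funpow[OF b, of "Suc n"]] dg by (simp only: \<theta>_D_funpow \<delta>.deg_le_iff)
  have "hom1 (int N + int n * int e) (D.lc n b)"
    unfolding D.lc_def by (intro homog_cst_mult hom_D_funpow b)
  moreover have "hom1 (int N + int n * int e) (cst x * X ^ (N + n * e))"
    using homog_cst_mult[OF hom1_power[OF hom_X, of "N + n * e"]] by simp
  moreover have "\<theta> (D.lc n b) = cst x"
    using l by (simp add: D.lc_def \<delta>.lc_def \<theta>_simps \<theta>_D_funpow)
  ultimately show "D.lc n b = cst x * X ^ (N + n * e)"
    by (intro \<theta>_inj) (simp_all add: \<theta>_simps)
qed

text \<open>The definitions of \<open>S\<close> and \<open>P\<close> allow \<open>Y1 ^ k1\<close>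
  and \<open>S ^ k2\<close> to be replaced, so exponents \<open>r < k2\<close> and
  \<open>j < k1\<close> suffice. They and \<open>t\<close> are the mixed-radix digits of the degree
  \<open>r + j k2 + t k1 k2\<close>, so every degree occurs exactly once.\<close>

lemma image_ideals:
  fixes Y1 Y2 :: "'k poly3" and c1 c2 :: "nat \<Rightarrow> 'k" and k1 k2 :: nat
  defines "s \<equiv> \<theta> Y2 - upol k1 c1 (\<theta> Y1)"
  assumes Y: "hom1 1 Y1" "hom1 1 Y2" and gen: "adjoin {X, Y1, Y2} = UNIV"
    and k: "k1 \<ge> 2" "k2 \<ge> 2" and c: "c1 k1 \<noteq> 0" "c2 k2 \<noteq> 0"
    and e: "e + 2 = k1 * k2"
    and ds: "\<delta> s = cst u" "u \<noteq> 0" and df: "\<delta> (\<theta> Y1 - upol k2 c2 s) = 0"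
  shows "image_ideal D n = ideal_gen (kernel D)
    {X ^ (n * e + k1 * (n mod k2) + n div k2 mod k1 + n div k2 div k1)}"
proof -
  \<comment> \<open>Homogenizations of \<open>s\<close> and of the kernel element, in degrees
    \<open>k1\<close> and \<open>k1 * k2\<close>; powers of \<open>X\<close> fill up the lower
    terms.\<close>
  define S where "S = X ^ (k1 - 1) * Y2 - (\<Sum>i\<le>k1. cst (c1 i) * (X ^ (k1 - i) * Y1 ^ i))"
  define P where "P = X ^ (k1 * k2 - 1) * Y1 - (\<Sum>i\<le>k2. cst (c2 i) * (X ^ (k1 * (k2 - i)) * S ^ i))"
  have \<theta>S: "\<theta> S = s" by (simp add: S_def s_def \<theta>_simps upol_def)
  have \<theta>P: "\<theta> P = \<theta> Y1 - upol k2 c2 s" by (simp add: P_def \<theta>_simps upol_def \<theta>S)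
  have hS: "hom1 (int k1) S"
    unfolding S_def
  proof (intro homog_diff homog_sum homog_cst_mult)
    have "hom1 (int (k1 - 1) + 1) (X ^ (k1 - 1) * Y2)" by (intro homog_mult hom1_power hom_X Y)
    then show "hom1 (int k1) (X ^ (k1 - 1) * Y2)" using k by simp
    fix i assume "i \<in> {..k1}"
    moreover have "hom1 (int (k1 - i) + int i) (X ^ (k1 - i) * Y1 ^ i)" by (intro homog_mult hom1_power hom_X Y)
    ultimately show "hom1 (int k1) (X ^ (k1 - i) * Y1 ^ i)" by simp
  qed
  have kk: "k1 * k2 \<ge> 2 * 2" using k by (rule mult_le_mono)
  have hP: "hom1 (int (k1 * k2)) P"
    unfolding P_def
  proof (intro homog_diff homog_sum homog_cst_mult)
    have "hom1 (int (k1 * k2 - 1) + 1) (X ^ (k1 * k2 - 1) * Y1)" by (intro homog_mult hom1_power hom_X Y)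
    moreover have "int (k1 * k2 - 1) + 1 = int (k1 * k2)" using kk by linarith
    ultimately show "hom1 (int (k1 * k2)) (X ^ (k1 * k2 - 1) * Y1)" by simp
    fix i assume i: "i \<in> {..k2}"
    have "hom1 (int (k1 * (k2 - i)) + int i * int k1) (X ^ (k1 * (k2 - i)) * S ^ i)"
      by (intro homog_mult hom1_power hom_X homog_power hS)
    moreover have "int (k1 * (k2 - i)) + int i * int k1 = int (k1 * k2)"
      using i by (simp add: algebra_simps flip: of_nat_mult of_nat_add)
    ultimately show "hom1 (int (k1 * k2)) (X ^ (k1 * (k2 - i)) * S ^ i)" by simp
  qed
  have DP: "D P = 0" using \<theta>_inj0[OF hom_D[OF hP]] df by (simp add: \<theta>_D \<theta>P)
  have kerp: "D (X ^ i) = 0" for i by (simp add: D.d_power)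

  have snz: "s \<noteq> 0" using ds by auto
  have degs: "\<delta>.deg s = 1"
    by (rule \<delta>.deg_unique) (simp_all add: ds)
  have lcs: "\<delta>.lc 1 s = cst u" by (simp add: \<delta>.lc_def ds)
  define a where "a = \<theta> Y1"
  have a: "a = (a - upol k2 c2 s) + upol k2 c2 s" by simp
  have df': "\<delta> (a - upol k2 c2 s) = 0" using df by (simp add: a_def)
  have lca: "\<delta>.lc k2 a = cst (c2 k2 * u ^ k2)" and dega: "\<delta>.deg a \<le> k2"
  proof -
    have l: "\<delta>.deg (upol k2 c2 s) \<le> k2" "\<delta>.lc k2 (upol k2 c2 s) = cst (c2 k2 * u ^ k2)"
      using \<delta>.lc_upol[of s k2 c2] by (simp_all add: degs lcs[simplified] cst_mult cst_power)
    have z: "\<delta>.deg (a - upol k2 c2 s) = 0" using df' by (simp add: \<delta>.deg_eq_0_iff)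
    then have "\<delta>.lc k2 (a - upol k2 c2 s) = 0"
      using k by (simp add: \<delta>.lc_eq_0_iff flip: \<delta>.deg_less_iff)
    then show "\<delta>.lc k2 a = cst (c2 k2 * u ^ k2)"
      using l by (subst a) (simp only: \<delta>.lc_add, simp)
    show "\<delta>.deg a \<le> k2" using \<delta>.deg_add_le[of "a - upol k2 c2 s" k2 "upol k2 c2 s"] z l by simp
  qed
  have dega_eq: "\<delta>.deg a = k2"
  proof -
    have "(\<delta> ^^ k2) a \<noteq> 0" using lca ds c by (simp flip: \<delta>.lc_eq_0_iff)
    then have "\<not> \<delta>.deg a < k2" using k by (simp add: \<delta>.deg_less_iff)
    then show ?thesis using dega by simp
  qed
  define b where "b = \<theta> Y2"
  have b: "b = s + upol k1 c1 a" by (simp add: b_def s_def a_def)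
  define v where "v = c1 k1 * (c2 k2 * u ^ k2) ^ k1"
  have lcb: "\<delta>.lc (k1 * k2) b = cst v" and degb: "\<delta>.deg b \<le> k1 * k2"
  proof -
    have l: "\<delta>.deg (upol k1 c1 a) \<le> k1 * k2" "\<delta>.lc (k1 * k2) (upol k1 c1 a) = cst v"
      using \<delta>.lc_upol[of a k1 c1] k by (simp_all add: dega_eq lca cst_mult cst_power v_def)
    have "\<delta>.lc (k1 * k2) s = 0"
    proof -
      have "0 < k1 * k2" "\<delta>.deg s < k1 * k2" using kk degs by linarith+
      then show ?thesis by (simp only: \<delta>.lc_eq_0_iff \<delta>.deg_less_iff)
    qed
    then show "\<delta>.lc (k1 * k2) b = cst v" using l by (simp add: b \<delta>.lc_add)
    have "\<delta>.deg s \<le> k1 * k2" using kk degs by linarith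
    then show "\<delta>.deg b \<le> k1 * k2" unfolding b using l(1) by (rule \<delta>.deg_add_le)
  qed
  have vnz: "v \<noteq> 0" using c ds by (simp add: v_def)

  have LS: "(D ^^ Suc 1) S = 0" "D.lc 1 S = cst u * X ^ (k1 + e)"
    using lift_lc[OF hS, of 1 u] by (simp_all add: \<theta>S degs lcs[simplified])
  have LY1: "(D ^^ Suc k2) Y1 = 0" "D.lc k2 Y1 = cst (c2 k2 * u ^ k2) * X ^ (1 + k2 * e)"
    using lift_lc[of 1 Y1 k2 "c2 k2 * u ^ k2"] Y lca dega by (simp_all add: a_def del: funpow.simps)
  have LY2: "(D ^^ Suc (k1 * k2)) Y2 = 0" "D.lc (k1 * k2) Y2 = cst v * X ^ (1 + k1 * k2 * e)"
    using lift_lc[of 1 Y2 "k1 * k2" v] Y lcb degb by (simp_all add: b_def del: funpow.simps)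

  have pw: "(D ^^ Suc (n * m)) (Z ^ n) = 0" "D.lc (n * m) (Z ^ n) = cst (y ^ n) * X ^ (n * E)"
    if "(D ^^ Suc m) Z = 0" "D.lc m Z = cst y * X ^ E" for Z y n m E
  proof -
    have "(cst y * X ^ E) ^ n = cst (y ^ n) * X ^ (n * E)"
      by (simp only: power_mult_distrib cst_power mult.commute[of n] power_mult)
    then show "(D ^^ Suc (n * m)) (Z ^ n) = 0" "D.lc (n * m) (Z ^ n) = cst (y ^ n) * X ^ (n * E)"
      using D.lc_power[OF that(1), of n] unfolding that(2) by (simp_all only:)
  qed
  define M where "M r j t = S ^ r * (Y1 ^ j * Y2 ^ t)" for r j t
  define Md where "Md i = M (i mod k2) (i div k2 mod k1) (i div k2 div k1)" for i
  have lcM: "(D ^^ Suc (r + (j * k2 + t * (k1 * k2)))) (M r j t) = 0 \<and>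
    (\<exists>x. x \<noteq> 0 \<and> D.lc (r + (j * k2 + t * (k1 * k2))) (M r j t)
      = cst x * X ^ (r * (k1 + e) + (j * (1 + k2 * e) + t * (1 + k1 * k2 * e))))" for r j t
  proof -
    have 1: "(D ^^ Suc r) (S ^ r) = 0" "D.lc r (S ^ r) = cst (u ^ r) * X ^ (r * (k1 + e))"
      using pw[OF LS, of r] by (simp_all only: mult_1_right)
    note 2 = pw[OF LY1, of j] and 3 = pw[OF LY2, of t]
    have 23: "(D ^^ Suc (j * k2 + t * (k1 * k2))) (Y1 ^ j * Y2 ^ t) = 0"
      by (rule D.funpow_mult_0[OF 2(1) 3(1)])
    have "D.lc (r + (j * k2 + t * (k1 * k2))) (M r j t)
        = cst (u ^ r * ((c2 k2 * u ^ k2) ^ j * v ^ t)) * X ^ (r * (k1 + e) + (j * (1 + k2 * e) + t * (1 + k1 * k2 * e)))"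
      unfolding M_def D.lc_mult[OF 1(1) 23] D.lc_mult[OF 2(1) 3(1)] 1(2) 2(2) 3(2) cst_mult power_add
      by (simp only: mult_ac)
    moreover have "u ^ r * ((c2 k2 * u ^ k2) ^ j * v ^ t) \<noteq> 0" using c ds vnz by simp
    ultimately show ?thesis
      using D.funpow_mult_0[OF 1(1) 23] unfolding M_def by blast
  qed

  have idx: "i mod k2 + ((i div k2 mod k1) * k2 + (i div k2 div k1) * (k1 * k2)) = i" for i
  proof -
    have "(i div k2 mod k1) * k2 + (i div k2 div k1) * (k1 * k2) = (i div k2 mod k1 + k1 * (i div k2 div k1)) * k2"
      by (simp only: distrib_left mult_ac)
    also have "\<dots> = (i div k2) * k2" by (simp only: mod_mult_div_eq)
    finally show ?thesis by (simp only: mod_div_mult_eq)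
  qed
  \<comment> \<open>The total degree \<open>k1 r + j + t\<close> of \<open>Md i\<close>, raised by
    \<open>e\<close> for each of the \<open>i\<close> applications of \<open>D\<close>.\<close>
  define E where "E i = i * e + k1 * (i mod k2) + i div k2 mod k1 + i div k2 div k1" for i
  have nilMd: "(D ^^ Suc i) (Md i) = 0" for i
    using lcM[of "i mod k2" "i div k2 mod k1" "i div k2 div k1"] unfolding Md_def idx by blast
  have "\<exists>x. x \<noteq> 0 \<and> D.lc i (Md i) = cst x * X ^ E i" for i
  proof -
    let ?r = "i mod k2" and ?j = "i div k2 mod k1" and ?t = "i div k2 div k1"
    have "?r * (k1 + e) + (?j * (1 + k2 * e) + ?t * (1 + k1 * k2 * e))
      = (?r + (?j * k2 + ?t * (k1 * k2))) * e + k1 * ?r + ?j + ?t"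
      by (simp add: algebra_simps)
    also have "\<dots> = E i" unfolding idx E_def ..
    finally show ?thesis
      using lcM[of ?r ?j ?t] unfolding Md_def idx by metis
  qed
  then obtain x where x: "\<And>i. x i \<noteq> 0" "\<And>i. D.lc i (Md i) = cst (x i) * X ^ E i" by metis
  have DMd: "(D ^^ i) (Md i) = cst (fact i * x i) * X ^ E i" for i
    unfolding D.funpow_eq_lc x(2) by (simp add: cst_mult mult.assoc)
  have Xnz: "X \<noteq> 0" using \<theta>_X \<theta>_simps(6) by force
  have topMd: "(D ^^ i) (Md i) \<noteq> 0" for i
    using x(1)[of i] Xnz by (simp add: DMd)

  \<comment> \<open>The module over the kernel spanned by the products \<open>Md i\<close>; it is
    shown to be all of \<open>B\<close>.\<close>
  define Mod where "Mod = {b. \<exists>K a. (\<forall>i. D (a i) = 0) \<and> b = (\<Sum>i<K. a i * Md i)}"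
  have Mod_add: "y + z \<in> Mod" if "y \<in> Mod" "z \<in> Mod" for y z
  proof -
    from that obtain K a where a: "\<forall>i. D (a i) = 0" "y = (\<Sum>i<K. a i * Md i)" by (auto simp: Mod_def)
    from that obtain L b where b: "\<forall>i. D (b i) = 0" "z = (\<Sum>i<L. b i * Md i)" by (auto simp: Mod_def)
    have "(\<Sum>i<K. a i * Md i) = (\<Sum>i<max K L. (if i < K then a i else 0) * Md i)"
      by (rule sum.mono_neutral_cong_left) auto
    moreover have "(\<Sum>i<L. b i * Md i) = (\<Sum>i<max K L. (if i < L then b i else 0) * Md i)"
      by (rule sum.mono_neutral_cong_left) auto
    ultimately have "y + z = (\<Sum>i<max K L. ((if i < K then a i else 0) + (if i < L then b i else 0)) * Md i)"
      using a b by (simp add: sum.distrib distrib_right)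
    moreover have "\<forall>i. D ((if i < K then a i else 0) + (if i < L then b i else 0)) = 0"
      using a b by (simp add: D.d_add)
    ultimately show ?thesis unfolding Mod_def mem_Collect_eq by (intro exI conjI)
  qed
  have Mod_mult: "w * y \<in> Mod" if "D w = 0" "y \<in> Mod" for w y
  proof -
    from that obtain K a where a: "\<forall>i. D (a i) = 0" "y = (\<Sum>i<K. a i * Md i)" by (auto simp: Mod_def)
    then have "w * y = (\<Sum>i<K. (w * a i) * Md i)" by (simp add: sum_distrib_left mult.assoc)
    moreover have "\<forall>i. D (w * a i) = 0" using a that by (simp add: D.d_mult)
    ultimately show ?thesis unfolding Mod_def mem_Collect_eq by (intro exI conjI)
  qed
  have Mod_0: "0 \<in> Mod" unfolding Mod_def mem_Collect_eq by (intro exI[of _ 0] exI[of _ "\<lambda>_. 0"]) simp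
  have Mod_sum: "sum f I \<in> Mod" if "\<And>i. i \<in> I \<Longrightarrow> f i \<in> Mod" for f and I :: "nat set"
    using that by (induction I rule: infinite_finite_induct) (auto simp: Mod_0 Mod_add)
  have Mod_diff: "y - z \<in> Mod" if "y \<in> Mod" "z \<in> Mod" for y z
    using Mod_add[OF that(1) Mod_mult[OF D.d_cst[of "- 1"] that(2)]] by (simp add: cst_uminus)
  have Mod_Md: "Md i \<in> Mod" for i
  proof -
    have "Md i = (\<Sum>l<Suc i. (if l = i then 1 else 0) * Md l)" by simp
    moreover have "\<forall>l. D (if l = i then 1 else 0) = 0" by simp
    ultimately show ?thesis unfolding Mod_def mem_Collect_eq by (intro exI conjI)
  qed
  have c1i: "cst (inverse (c1 k1)) * (cst (c1 k1) * y) = y" "cst (inverse (c2 k2)) * (cst (c2 k2) * y) = y" for y :: "'k poly3"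
    using c by (simp_all add: cst_inverse flip: mult.assoc)
  have redY: "Y1 ^ k1 = cst (inverse (c1 k1)) *
    (X ^ (k1 - 1) * Y2 - S - (\<Sum>i<k1. cst (c1 i) * (X ^ (k1 - i) * Y1 ^ i)))"
  proof -
    have "cst (c1 k1) * Y1 ^ k1 = X ^ (k1 - 1) * Y2 - S - (\<Sum>i<k1. cst (c1 i) * (X ^ (k1 - i) * Y1 ^ i))"
      by (simp add: S_def lessThan_Suc_atMost[symmetric])
    then show ?thesis using c1i(1) by metis
  qed
  have redS: "S ^ k2 = cst (inverse (c2 k2)) *
    (X ^ (k1 * k2 - 1) * Y1 - P - (\<Sum>i<k2. cst (c2 i) * (X ^ (k1 * (k2 - i)) * S ^ i)))"
  proof -
    have "cst (c2 k2) * S ^ k2 = X ^ (k1 * k2 - 1) * Y1 - P - (\<Sum>i<k2. cst (c2 i) * (X ^ (k1 * (k2 - i)) * S ^ i))"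
      by (simp add: P_def lessThan_Suc_atMost[symmetric])
    then show ?thesis using c1i(2) by metis
  qed
  \<comment> \<open>Rewriting terminates by induction on the total degree of
    \<open>S^r Y1^j Y2^t\<close>, then on \<open>j\<close>: replacing \<open>Y1 ^ k1\<close> lowers
    the degree except in the term with one more factor \<open>S\<close>, where \<open>j\<close>
    drops. Replacing \<open>S ^ k2\<close> always lowers it, the remaining factors being powers of
    \<open>X\<close> and \<open>P\<close> from the kernel.\<close>
  have Mmono: "M r j t \<in> Mod" if "k1 * r + j + t = N" for N r j t
    using that
  proof (induction N arbitrary: r j t rule: less_induct)
    case outer: (less N)
    have *: "M r' j' t' \<in> Mod" if "k1 * r' + j' + t' < N" for r' j' t'
      using outer.IH that by blast
    show ?case using outer.prems
    proof (induction j arbitrary: r t rule: less_induct)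
      case inner: (less j)
      show ?case
      proof (cases "j \<ge> k1")
        case True
        then obtain j' where j: "j = k1 + j'" using le_Suc_ex by blast
        have eq: "M r j t = cst (inverse (c1 k1)) * (X ^ (k1 - 1) * M r j' (Suc t) - M (Suc r) j' t
          - (\<Sum>i<k1. cst (c1 i) * (X ^ (k1 - i) * M r (i + j') t)))"
          unfolding j M_def power_add redY
          by (simp add: algebra_simps sum_distrib_left)
        have "M r j' (Suc t) \<in> Mod" using inner.prems k by (intro *) (simp add: j)
        moreover have "M (Suc r) j' t \<in> Mod" using inner.prems k by (intro inner.IH) (simp_all add: j)
        moreover have "M r (i + j') t \<in> Mod" if "i < k1" for i using inner.prems that by (intro *) (simp add: j)
        ultimately show ?thesis
          unfolding eq by (intro Mod_mult Mod_diff Mod_sum kerp D.d_cst) auto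
      next
        case jk: False
        show ?thesis
        proof (cases "r \<ge> k2")
          case True
          then obtain r' where r: "r = k2 + r'" using le_Suc_ex by blast
          have eq: "M r j t = cst (inverse (c2 k2)) * (X ^ (k1 * k2 - 1) * M r' (Suc j) t - P * M r' j t
            - (\<Sum>i<k2. cst (c2 i) * (X ^ (k1 * (k2 - i)) * M (i + r') j t)))"
            unfolding r M_def power_add redS
            by (simp add: algebra_simps sum_distrib_left)
          have N: "N = k1 * k2 + (k1 * r' + j + t)" using inner.prems by (simp add: r algebra_simps)
          have "M r' (Suc j) t \<in> Mod" using N kk by (intro *) linarith
          moreover have "M r' j t \<in> Mod" using N kk by (intro *) linarith
          moreover have "M (i + r') j t \<in> Mod" if "i < k2" for i
          proof (rule *)
            have "k1 * i < k1 * k2" using that k by simp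
            then show "k1 * (i + r') + j + t < N" using N by (simp add: algebra_simps)
          qed
          ultimately show ?thesis
            unfolding eq by (intro Mod_mult Mod_diff Mod_sum kerp D.d_cst DP) auto
        next
          case False
          have "M r j t = Md (r + k2 * (j + k1 * t))"
            using False jk by (simp add: Md_def)
          then show ?thesis using Mod_Md by simp
        qed
      qed
    qed
  qed
  \<comment> \<open>The multipliers that preserve \<open>Mod\<close>. They form a subalgebra
    containing the generators of \<open>B\<close>, and \<open>M 0 0 0 = 1\<close>.\<close>
  define T where "T = {b. \<forall>r j t. b * M r j t \<in> Mod}"
  have "subalgebra T"
    unfolding subalgebra_def
  proof (intro conjI ballI)
    show "range const \<subseteq> T" by (auto simp: T_def const_eq_cst intro!: Mod_mult Mmono)
    fix y z assume yz: "y \<in> T" "z \<in> T"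
    show "y + z \<in> T" using yz by (auto simp: T_def distrib_right intro: Mod_add)
    have "(y * z) * M r j t \<in> Mod" for r j t
    proof -
      have "z * M r j t \<in> Mod" using yz by (simp add: T_def)
      then obtain K a where a: "\<forall>i. D (a i) = 0" "z * M r j t = (\<Sum>i<K. a i * Md i)" by (auto simp: Mod_def)
      have "(y * z) * M r j t = (\<Sum>i<K. a i * (y * Md i))"
        using a(2) by (simp add: mult.assoc sum_distrib_left mult.left_commute)
      moreover have "y * Md i \<in> Mod" for i using yz by (simp add: T_def Md_def)
      moreover have "(\<Sum>i<K. a i * (y * Md i)) \<in> Mod"
      proof (rule Mod_sum)
        show "a i * (y * Md i) \<in> Mod" for i
          by (rule Mod_mult) (use a(1) calculation(2) in auto)
      qed
      ultimately show ?thesis by simp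
    qed
    then show "y * z \<in> T" by (simp add: T_def)
  qed
  moreover have "{X, Y1, Y2} \<subseteq> T"
  proof -
    have "Y1 * M r j t = M r (Suc j) t" "Y2 * M r j t = M r j (Suc t)" for r j t
      by (simp_all add: M_def mult_ac)
    then show ?thesis by (auto simp: T_def intro!: Mod_mult Mmono)
  qed
  ultimately have "adjoin {X, Y1, Y2} \<subseteq> T" by (rule adjoin_minimal)
  then have "y \<in> T" for y using gen by auto
  then have "y * M 0 0 0 \<in> Mod" for y by (simp add: T_def)
  then have all: "y \<in> Mod" for y by (simp add: M_def)

  have "image_ideal D n = (\<lambda>a. a * X ^ E n) ` kernel D"
  proof
    show "image_ideal D n \<subseteq> (\<lambda>a. a * X ^ E n) ` kernel D"
    proof
      fix z assume "z \<in> image_ideal D n"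
      then obtain y where y: "z = (D ^^ n) y" "D z = 0" by (auto simp: image_ideal_def kernel_def)
      obtain K a where a: "\<forall>i. D (a i) = 0" "y = (\<Sum>i<K. a i * Md i)" using all[of y] by (auto simp: Mod_def)
      obtain b where b: "D b = 0" "z = b * (D ^^ n) (Md n)"
        using D.image_of_filtration_basis[OF nilMd topMd, of a n K] a y by auto
      then have "z = (b * cst (fact n * x n)) * X ^ E n" by (simp add: DMd mult.assoc)
      moreover have "D (b * cst (fact n * x n)) = 0" using b by (simp add: D.d_mult)
      ultimately show "z \<in> (\<lambda>a. a * X ^ E n) ` kernel D" unfolding kernel_def by blast
    qed
    show "(\<lambda>a. a * X ^ E n) ` kernel D \<subseteq> image_ideal D n"
    proof
      fix z assume "z \<in> (\<lambda>a. a * X ^ E n) ` kernel D"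
      then obtain a where a: "D a = 0" "z = a * X ^ E n" by (auto simp: kernel_def)
      \<comment> \<open>A preimage of \<open>z\<close>: the product \<open>Md n\<close> times
        \<open>a\<close>, divided by the scalar in \<open>DMd\<close>.\<close>
      have "(D ^^ n) (cst (inverse (fact n * x n)) * (a * Md n)) = cst (inverse (fact n * x n)) * (a * (cst (fact n * x n) * X ^ E n))"
        by (simp add: D.funpow_cst_mult D.funpow_ker_mult[OF a(1)] DMd)
      also have "\<dots> = (cst (inverse (fact n * x n)) * cst (fact n * x n)) * z"
        by (simp only: a(2) mult_ac)
      also have "\<dots> = z"
      proof -
        have "fact n * x n \<noteq> 0" using x(1)[of n] by simp
        then show ?thesis by (subst cst_inverse) simp_all
      qed
      finally have "z \<in> range (D ^^ n)" by (metis rangeI)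
      moreover have "D z = 0" using a by (simp add: D.d_mult kerp)
      ultimately show "z \<in> image_ideal D n" by (simp add: image_ideal_def kernel_def)
    qed
  qed
  also have "\<dots> = ideal_gen (kernel D) {X ^ E n}"
    by (rule ideal_gen_principal[symmetric]) (auto simp: kernel_def D.d_add D.d_mult kerp)
  finally show ?thesis by (simp add: E_def)
qed

end

section \<open>The number of Euclidean steps\<close>

lemma two_factors_of_prime_product:
  fixes p q k l j :: nat
  assumes "prime p" "prime q" "k * (l * j) = p * q" "k \<noteq> 1" "l \<noteq> 1"
  shows "j = 1 \<and> (k = p \<and> l = q \<or> k = q \<and> l = p)"
proof -
  have p0: "p > 0" using assms(1) by (rule prime_gt_0_nat)
  have "p dvd k * (l * j)" using assms(3) by simp
  then consider "p dvd k" | "p dvd l * j" using assms(1) by (auto simp: prime_dvd_mult_iff)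
  then show ?thesis
  proof cases
    case 1
    then obtain m where k: "k = p * m" by blast
    then have "l * (m * j) = q" using assms(3) p0 by (simp add: algebra_simps)
    then have "l = q \<and> m * j = 1" using prime_product[of l "m * j"] assms by auto
    then show ?thesis using k by simp
  next
    case 2
    then obtain m where m: "l * j = p * m" by blast
    then have "p * (k * m) = p * q" using assms(3) by (simp add: algebra_simps)
    then have "k * m = q" using p0 by simp
    then have k: "k = q" "m = 1" using prime_product[of k m] assms by auto
    then have "l * j = p" using m by simp
    then have "l = p" "j = 1" using prime_product[of l j] assms by auto
    then show ?thesis using k by simp
  qed
qed

context homog_lnd
begin

lemma triangularizableI:
  assumes "adjoin {X, Y1, Y2} = UNIV" "D Y1 \<in> adjoin {X}" "D Y2 \<in> adjoin {X, Y1}"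
  shows "triangularizable D"
  unfolding triangularizable_def coordinate_system_def
proof (intro exI conjI)
  let ?C = "\<lambda>i::nat. if i = 1 then X else if i = 2 then Y1 else Y2"
  show "adjoin {?C 1, ?C 2, ?C 3} = UNIV" using assms by simp
  show "D (?C 1) \<in> range const" by (simp add: const_eq_cst)
  show "D (?C 2) \<in> adjoin {?C 1}" "D (?C 3) \<in> adjoin {?C 1, ?C 2}" using assms by simp_all
qed

text \<open>Both sides are homogeneous of degree \<open>N\<close> with the same image under
  \<open>\<theta>\<close>.\<close>

lemma lift_upol:
  assumes z: "hom1 (int N) z" "\<theta> z = upol k x (\<theta> Y)" and Y: "hom1 1 Y" and k: "k \<le> N"
  shows "z = (\<Sum>i\<le>k. cst (x i) * (X ^ (N - i) * Y ^ i))"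
proof (rule \<theta>_inj[OF z(1)])
  show "hom1 (int N) (\<Sum>i\<le>k. cst (x i) * (X ^ (N - i) * Y ^ i))"
  proof (intro homog_sum homog_cst_mult)
    fix i assume "i \<in> {..k}"
    then have "int (N - i) + int i = int N" using k by simp
    moreover have "hom1 (int (N - i) + int i) (X ^ (N - i) * Y ^ i)"
      by (intro homog_mult hom1_power hom_X Y)
    ultimately show "hom1 (int N) (X ^ (N - i) * Y ^ i)" by simp
  qed
  show "\<theta> z = \<theta> (\<Sum>i\<le>k. cst (x i) * (X ^ (N - i) * Y ^ i))"
    by (simp add: z(2) upol_def \<theta>_simps)
qed

lemma hom_D1: "hom1 1 Y \<Longrightarrow> hom1 (int (Suc e)) (D Y)"
  using hom_D[of 1 Y] by (simp add: add.commute)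

lemma image_ideals_dichotomy:
  assumes pq: "prime p" "prime q" "e + 2 = p * q" and nt: "\<not> triangularizable D"
  shows "(\<forall>n. image_ideal D n = ideal_gen (kernel D)
            {X ^ (n * e + q * (n mod p) + n div p mod q + n div p div q)}) \<or>
         (\<forall>n. image_ideal D n = ideal_gen (kernel D)
            {X ^ (n * e + p * (n mod q) + n div q mod p + n div q div p)})"
proof -
  obtain Y1 Y2 where Y: "hom1 1 Y1" "hom1 1 Y2" and gen: "adjoin {X, Y1, Y2} = UNIV"
    and co: "coords (\<theta> Y2) (\<theta> Y1)" and lt: "\<delta>.deg (\<theta> Y1) < \<delta>.deg (\<theta> Y2)"
    and degb: "\<delta>.deg (\<theta> Y2) = e + 2"
    by (rule linear_pair)
  define a b where "a = \<theta> Y1" and "b = \<theta> Y2"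
  note co = co[folded a_def b_def] and lt = lt[folded a_def b_def] and degb = degb[folded b_def]
  \<comment> \<open>Homogeneity leaves \<open>u X^(e+1)\<close> as the only lift of the constant
    \<open>u\<close>.\<close>
  have const_lift: "D Z \<in> adjoin {X}" if "hom1 1 Z" "\<delta> (\<theta> Z) = cst u" for Z u
  proof -
    have "D Z = (\<Sum>i\<le>0. cst u * (X ^ (Suc e - i) * Z ^ i))"
      using lift_upol[OF hom_D1[OF that(1)], of 0 "\<lambda>_. u" Z] that by (simp add: \<theta>_D upol_def)
    then show ?thesis
      using adjoin_superset[of "{X}"] by (auto intro!: adjoin_mult adjoin_cst adjoin_power)
  qed
  have sub: "adjoin {X} \<subseteq> adjoin {X, Y1}"
    using adjoin_superset[of "{X, Y1}"] by (intro adjoin_minimal subalgebra_adjoin) auto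
  \<comment> \<open>Were no division step possible, \<open>D Y1\<close> would be zero and
    \<open>D Y2\<close> in \<open>k[X]\<close>.\<close>
  have da: "\<delta>.deg a > 0"
  proof (rule ccontr)
    assume "\<not> \<delta>.deg a > 0"
    then have z: "\<delta> a = 0" by (simp add: \<delta>.deg_eq_0_iff)
    obtain u where "\<delta> b = cst u" using \<delta>.irr[OF coords_swap[OF co] z] by blast
    then have "triangularizable D"
      using const_lift[of Y1 0] const_lift[of Y2 u] Y z sub
      by (intro triangularizableI[OF gen]) (auto simp: a_def b_def)
    then show False using nt by blast
  qed
  obtain k1 c1 where k1: "\<delta>.deg (b - upol k1 c1 a) < \<delta>.deg a" "k1 * \<delta>.deg a = \<delta>.deg b" "c1 k1 \<noteq> 0"
    using \<delta>.euclid_step[OF co da] lt by auto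
  define s where "s = b - upol k1 c1 a"
  have cos: "coords a s" unfolding s_def by (rule coords_swap[OF coords_shear[OF co]])
  \<comment> \<open>If one step already led into the kernel, \<open>\<delta> a\<close> would be
    constant and \<open>\<delta> b\<close> a polynomial in \<open>a\<close>, so
    \<open>X, Y1, Y2\<close> would be triangular coordinates.\<close>
  have ds: "\<delta>.deg s > 0"
  proof (rule ccontr)
    assume "\<not> \<delta>.deg s > 0"
    then have z: "\<delta> s = 0" by (simp add: \<delta>.deg_eq_0_iff)
    obtain u where u: "\<delta> a = cst u" using \<delta>.irr[OF coords_swap[OF cos] z] by blast
    have "\<delta> a \<noteq> 0" using da by (auto simp: \<delta>.deg_eq_0_iff[symmetric])
    then have "\<delta>.deg a = 1" using \<delta>.deg_d[of a] u by simp
    \<comment> \<open>This makes the derivative of the subtracted polynomial have formal degree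
      \<open>e + 1\<close>, which is the degree of \<open>D Y2\<close>, so it can be lifted.\<close>
    then have k: "k1 = e + 2" using k1 degb by simp
    have bs: "b = s + upol k1 c1 a" by (simp add: s_def)
    have "\<theta> (D Y2) = \<delta> s + \<delta> (upol k1 c1 a)"
      unfolding \<theta>_D b_def[symmetric] by (subst bs) (rule \<delta>.d_add)
    also have "\<dots> = upol (Suc e) (\<lambda>i. (of_nat (Suc i) * c1 (Suc i)) * u) a"
      using \<delta>.d_upol[of k1 c1 a] k z u
      by (simp add: upol_def cst_mult sum_distrib_left sum_distrib_right mult_ac del: of_nat_Suc sum.atMost_Suc)
    finally have "D Y2 = (\<Sum>i\<le>Suc e. cst ((of_nat (Suc i) * c1 (Suc i)) * u) * (X ^ (Suc e - i) * Y1 ^ i))"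
      unfolding a_def by (intro lift_upol hom_D1 Y) simp_all
    also have "\<dots> \<in> adjoin {X, Y1}"
      using adjoin_superset[of "{X, Y1}"]
      by (intro adjoin_sum adjoin_mult adjoin_cst adjoin_power) auto
    finally have "triangularizable D"
      using const_lift[of Y1 u] Y u by (intro triangularizableI[OF gen]) (auto simp: a_def)
    then show False using nt by blast
  qed
  obtain k2 c2 where k2: "\<delta>.deg (a - upol k2 c2 s) < \<delta>.deg s" "k2 * \<delta>.deg s = \<delta>.deg a" "c2 k2 \<noteq> 0"
    using \<delta>.euclid_step[OF cos ds] k1(1) by (auto simp: s_def)
  \<comment> \<open>Two nontrivial quotient degrees use up both primes, so \<open>s\<close> has
    degree 1 and the next remainder lies in the kernel.\<close>
  have prod: "k1 * (k2 * \<delta>.deg s) = p * q" using k1 k2 degb pq by simp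
  have "k1 \<noteq> 1" "k2 \<noteq> 1" using k1 k2 lt by (auto simp: s_def)
  from two_factors_of_prime_product[OF pq(1,2) prod this]
  have s1: "\<delta>.deg s = 1" and kk: "k1 = p \<and> k2 = q \<or> k1 = q \<and> k2 = p" by blast+
  have df: "\<delta> (a - upol k2 c2 s) = 0" using k2(1) s1 by (simp add: \<delta>.deg_eq_0_iff[symmetric])
  obtain u where u: "\<delta> s = cst u"
    using \<delta>.irr[OF coords_shear[OF cos] df] by blast
  have "u \<noteq> 0" using u ds \<delta>.deg_eq_0_iff[of s] by auto
  moreover have "k1 \<ge> 2" "k2 \<ge> 2" using kk pq prime_ge_2_nat by auto
  moreover have "e + 2 = k1 * k2" using kk pq by auto
  ultimately have "image_ideal D n = ideal_gen (kernel D)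
      {X ^ (n * e + k1 * (n mod k2) + n div k2 mod k1 + n div k2 div k1)}" for n
    using image_ideals[of Y1 Y2 k1 k2 c1 c2 u n] Y gen k1(3) k2(3) u df
    unfolding s_def a_def b_def by blast
  \<comment> \<open>\<open>k2 = p\<close> gives the first form, \<open>k2 = q\<close> the
    second.\<close>
  then show ?thesis using kk by auto
qed

end

section \<open>Linear forms, grading and irreducibility in the original terms\<close>

lemma linear_form:
  fixes f :: "'k::field_char_0 poly3"
  assumes "hom1 1 f"
  shows "f = cst (lookup f (single U 1)) * var U + cst (lookup f (single V 1)) * var V
    + cst (lookup f (single W 1)) * var W"
proof (rule poly_mapping_eqI)
  fix m
  have sing: "\<exists>v. m = single v 1" if "m \<in> keys f"
  proof -
    have "(\<Sum>v\<in>UNIV. lookup m v) = 1" using assms that by (simp add: homog_def wd_def w1_def flip: of_nat_sum)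
    then obtain v where v: "lookup m v = 1" "\<And>b. v \<noteq> b \<Longrightarrow> lookup m b = 0"
      by (auto simp: sum_eq_Suc0_iff)
    have "m = single v 1" by (rule poly_mapping_eqI) (auto simp: lookup_single when_def v)
    then show ?thesis by blast
  qed
  have inj: "single v (1::nat) = single w 1 \<longleftrightarrow> v = w" for v w :: indet
    by (metis lookup_single_eq lookup_single_not_eq one_neq_zero)
  have var: "lookup (cst x * var v) m = x * (1 when single v 1 = m)" for x :: 'k and v
    by (simp add: lookup_cst_mult var_def lookup_single)
  show "lookup f m = lookup (cst (lookup f (single U 1)) * var U + cst (lookup f (single V 1)) * var V
    + cst (lookup f (single W 1)) * var W) m"
  proof (cases "\<exists>v. m = single v 1")
    case True
    then obtain v where "m = single v 1" by blast
    then show ?thesis unfolding lookup_add var by (cases v) (simp_all add: inj del: One_nat_def)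
  next
    case False
    then have "lookup f m = 0" using sing by (auto simp: in_keys_iff)
    moreover have "(1 when single v 1 = m) = (0 :: 'k)" for v using False unfolding when_def by metis
    ultimately show ?thesis unfolding lookup_add var by simp
  qed
qed

lemma graded_part_hom1: "f \<in> graded_part i \<longleftrightarrow> hom1 i f"
proof -
  have "int (mdeg m) = wd w1 m" for m
  proof -
    have "mdeg m = (\<Sum>x\<in>UNIV. lookup m x)"
      unfolding mdeg_def by (rule sum.mono_neutral_left) (auto simp: in_keys_iff)
    then show ?thesis by (simp add: wd_def w1_def)
  qed
  then show ?thesis by (simp add: graded_part_def homog_def)
qed

text \<open>The multiples of \<open>Q\<close> form an ideal containing the image of
  \<open>D\<close>, so they must be all of \<open>B\<close>.\<close>

lemma irreducible_derivationD:
  assumes "irreducible_derivation D" "\<And>b. Q dvd D b" shows "Q dvd 1"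
proof -
  have P: "ideal_gen UNIV {Q} = range (\<lambda>a. a * Q)" by (rule ideal_gen_principal) auto
  have "ideal_gen UNIV (range D) \<subseteq> range (\<lambda>a. a * Q)"
    unfolding ideal_gen_def
  proof (rule hull_minimal)
    show "range D \<subseteq> range (\<lambda>a. a * Q)" using assms(2) by (auto simp: dvd_def mult.commute)
    show "is_ideal UNIV (range (\<lambda>a. a * Q))" by (rule is_ideal_principal) auto
  qed
  then have "range (\<lambda>a. a * Q) = UNIV"
    using assms(1) unfolding irreducible_derivation_def P[symmetric] by blast
  then obtain a where "1 = a * Q" by (metis UNIV_I imageE)
  then show ?thesis by (metis dvd_triv_right)
qed

theorem theorem4p7:
  fixes D :: "'k::field_char_0 poly3 \<Rightarrow> 'k poly3" and X :: "'k poly3" and p q :: nat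
  assumes "prime p" and "prime q"
    and "lnd D"
    and "irreducible_derivation D"
    and "\<not> triangularizable D"
    and "homogeneous_of_degree D (int p * int q - 2)"
    and "derivation_rank D = 2"
    and "linear_variable X" and "X \<in> kernel D"
  shows
    "(\<forall>n. let r = n mod p; t' = n div p; t = t' div q; s = t' mod q in
        image_ideal D n = ideal_gen (kernel D) {X ^ (n * (p * q - 2) + q * r + s + t)}) \<or>
     (\<forall>n. let r = n mod q; t' = n div q; t = t' div p; s = t' mod p in
        image_ideal D n = ideal_gen (kernel D) {X ^ (n * (p * q - 2) + p * r + s + t)})"
proof -
  \<comment> \<open>As \<open>pq\<close> is at least 4, the truncated difference
    \<open>p * q - 2\<close> agrees with the integer degree of \<open>D\<close>.\<close>
  have "p * q \<ge> 2 * 2" using assms(1,2) by (intro mult_le_mono prime_ge_2_nat)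
  then have e: "p * q - 2 + 2 = p * q" "int p * int q - 2 = int (p * q - 2)"
    by (simp_all add: of_nat_diff)
  interpret D: lnd_mp D
    using assms(3) by unfold_locales (auto simp: lnd_def derivation_def const_eq_cst)
  define c where "c v = lookup X (single v 1)" for v
  have X: "X = cst (c U) * var U + cst (c V) * var V + cst (c W) * var W"
    using linear_form[of X] assms(8) by (simp add: linear_variable_def graded_part_hom1 c_def)
  then have "c U \<noteq> 0 \<or> c V \<noteq> 0 \<or> c W \<noteq> 0" using assms(8) by (auto simp: linear_variable_def)
  then obtain i0 i1 i2 where i: "c i0 \<noteq> 0" "i0 \<noteq> i1" "i0 \<noteq> i2" "i1 \<noteq> i2" "UNIV = {i0, i1, i2}"
    "cst (c i0) * var i0 + cst (c i1) * var i1 + cst (c i2) * var i2 = X"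
  proof (elim disjE)
    assume "c U \<noteq> 0"
    then show thesis using that[of U V W] X UNIV_indet by auto
  next
    assume "c V \<noteq> 0"
    then show thesis using that[of V U W] X UNIV_indet by (auto simp: algebra_simps)
  next
    assume "c W \<noteq> 0"
    then show thesis using that[of W U V] X UNIV_indet by (auto simp: algebra_simps)
  qed
  interpret H: homog_lnd D "p * q - 2" c i0 i1 i2
  proof
    show "hom1 (j + int (p * q - 2)) (D f)" if "hom1 j f" for j f
      using assms(6) that unfolding homogeneous_of_degree_def e(2) by (force simp: graded_part_hom1)
    show "Q dvd 1" if "\<And>b. Q dvd D b" for Q
      by (rule irreducible_derivationD[OF assms(4) that])
    show "D (cst (c i0) * var i0 + cst (c i1) * var i1 + cst (c i2) * var i2) = 0"
      using assms(9) by (simp add: i(6) kernel_def)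
  qed (fact i)+
  have "H.X = X" by (simp add: H.X_def i(6))
  then show ?thesis
    using H.image_ideals_dichotomy[OF assms(1,2) e(1) assms(5)] by (simp add: Let_def)
qed

end
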